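(* Let $\sigma$ be a cuspidal representation of $\mathcal K/\mathcal K_{0+}$ with central character $\theta$. Then the decompositions into irreducible $\mathcal K$-representations of the restrictions to $\mathcal K$ of the corresponding depth-zero supercuspidal representations of $G$ are $$\mathrm{Res}_{\mathcal K}\,\text{c-Ind}_{\mathcal K}^{G}\sigma\;\cong\;\sigma\oplus\bigoplus_{d\in2\mathbb Z_{\ge1}}\mathcal S_d(X_{\varpi^{-d}},\theta)\qquad\text{and}\qquad \mathrm{Res}_{\mathcal K}\,\text{c-Ind}_{\mathcal K^{\eta}}^{G}\sigma^{\eta}\;\cong\;\bigoplus_{d\in2\mathbb Z_{\ge0}+1}\mathcal S_d(X_{\varpi^{-d}},\theta).$$
   Context: All representations are smooth and complex. $F$ is a non-archimedean local field of residual characteristic $p\neq 2$, with ring of integers $\mathcal O_F$, maximal ideal $\mathfrak p_F$, uniformizer $\varpi$, residue field $\mathfrak f$ of cardinality $q$; $E=F[\sqrt\epsilon]$ is the unramified quadratic extension ($\epsilon\in\mathcal O_F^\times$ a non-square) with $\mathcal O_E,\mathfrak p_E$ and Galois conjugation $x\mapsto\overline x$; $E^1=\{x\in E^\times:x\overline x=1\}$. $\psi'$ is an additive character of $F$ trivial on $\mathfrak p_F$ and nontrivial on $\mathcal O_F$, and $\psi(x)=\psi'((x+\overline x)/2)$ for $x\in E$. $G=\{g\in M_2(E):\overline g^{\top}\mathrm w g=\mathrm w\}$, $\mathrm w=\begin{pmatrix}0&1\\1&0\end{pmatrix}$, with center $Z\cong E^1$ (scalar matrices). $\mathcal K=G\cap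 M_2(\mathcal O_E)$ and $\mathcal K_{0+}=\mathcal K\cap(I+M_2(\mathfrak p_E))$, so that $\mathcal K/\mathcal K_{0+}\cong\mathbb U(1,1)(\mathfrak f)$. A cuspidal representation $\sigma$ of $\mathcal K/\mathcal K_{0+}$ is identified with its inflation to $\mathcal K$; its central character is the character $\theta$ of $Z$ with $\sigma(zI)=\theta(z)\mathrm{Id}$. For $\eta=\begin{pmatrix}1&0\\0&\varpi\end{pmatrix}$ (which normalizes $G$), $\mathcal K^\eta=\eta\mathcal K\eta^{-1}$ and $\sigma^\eta(x)=\sigma(\eta^{-1}x\eta)$. For an integer $d>0$ let $\mathcal J_d=\begin{pmatrix}1+\mathfrak p_E^{\lceil d/2\rceil}&\mathfrak p_E^{\lceil d/2\rceil}\\ \mathfrak p_E^{\lceil (d+1)/2\rceil}&1+\mathfrak p_E^{\lceil d/2\rceil}\end{pmatrix}\cap G$, $X_{\varpi^{-d}}=\begin{pmatrix}0&\varpi^{-d}\sqrt\epsilon\\0&0\end{pmatrix}$, $\mathcal U=\left\{\begin{pmatrix}1&\sqrt\epsilon b\\0&1\end{pmatrix}:b\in\mathcal O_F\right\}$. Extend $\theta$ trivially to $\mathcal U$, let $\Psi_{X_{\varpi^{-d}},\theta}$ be the unique character of $Z\mathcal U\mathcal J_d$ extending $\theta$ on $Z\mathcal U$ and $k\mapsto\psi(\mathrm{Tr}(X_{\varpi^{-d}}(k-I)))$ on $\mathcal J_d$, and set $\mathcal S_d(X_{\varpi^{-d}},\theta)=\mathrm{Ind}_{Z\mathcal U\mathcal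 J_d}^{\mathcal K}\Psi_{X_{\varpi^{-d}},\theta}$ (an irreducible representation of $\mathcal K$ of depth $d$ and degree $(q^2-1)q^{d-1}$, by earlier work). *)

theory Defs
  imports "HOL-Analysis.Analysis" "HOL-Algebra.Coset" "HOL-Library.Function_Algebras"
    "HOL-Library.Product_Plus"
begin

section \<open>Non-archimedean local fields\<close>

text \<open>
  A valuation is an integer-valued function; its value at \<open>0\<close> carries no meaning.
  \<open>pideal v n\<close> is the \<open>n\<close>-th power of the maximal ideal, so \<open>pideal v 0\<close> is the ring of integers.
\<close>

definition pideal :: "('a::field \<Rightarrow> int) \<Rightarrow> int \<Rightarrow> 'a set" where
  "pideal v n = {x. x = 0 \<or> n \<le> v x}"

definition residue_classes :: "('a::field \<Rightarrow> int) \<Rightarrow> 'a set set" where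
  "residue_classes v = (\<lambda>x. {y. y - x \<in> pideal v 1}) ` pideal v 0"

definition residue_char :: "('a::field \<Rightarrow> int) \<Rightarrow> nat" where
  "residue_char v = (LEAST n. 0 < n \<and> of_nat n \<in> pideal v 1)"

locale nonarch_local_field =
  fixes v :: "'a::field \<Rightarrow> int"
  assumes val_mult: "\<lbrakk>x \<noteq> 0; y \<noteq> 0\<rbrakk> \<Longrightarrow> v (x * y) = v x + v y"
    and val_add: "\<lbrakk>x \<noteq> 0; y \<noteq> 0; x + y \<noteq> 0\<rbrakk> \<Longrightarrow> min (v x) (v y) \<le> v (x + y)"
    and val_normalized: "\<exists>x. x \<noteq> 0 \<and> v x = 1"
    and val_complete: "\<And>X :: nat \<Rightarrow> 'a.
        (\<forall>n. \<exists>N. \<forall>i\<ge>N. \<forall>j\<ge>N. X i - X j \<in> pideal v n) \<Longrightarrow>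
        \<exists>l. \<forall>n. \<exists>N. \<forall>i\<ge>N. X i - l \<in> pideal v n"
    and finite_residue_field: "finite (residue_classes v)"

section \<open>The unramified quadratic extension\<close>

text \<open>
  \<open>F\<close> is the type \<open>'f\<close> and \<open>E\<close> is the type \<open>'e\<close>, with \<open>F\<close> embedded by \<open>incl\<close>;
  \<open>rt\<close> is the chosen square root of \<open>eps\<close> in \<open>E\<close> and \<open>unif\<close> the uniformizer of \<open>F\<close>.
\<close>

record ('f, 'e) quad_ext =
  valF :: "'f \<Rightarrow> int"
  valE :: "'e \<Rightarrow> int"
  incl :: "'f \<Rightarrow> 'e"
  eps :: 'f
  rt :: 'e
  unif :: 'f

text \<open>
  Both valuations are normalized, so \<open>valE_incl\<close> says that the ramification index is 1.
\<close>

locale unramified_quad_ext =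
  fixes E :: "('f::field, 'e::field) quad_ext"
  assumes local_field_F: "nonarch_local_field (valF E)"
    and local_field_E: "nonarch_local_field (valE E)"
    and residue_char_odd: "residue_char (valF E) \<noteq> 2"
    and incl_one: "incl E 1 = 1"
    and incl_add: "incl E (a + b) = incl E a + incl E b"
    and incl_mult: "incl E (a * b) = incl E a * incl E b"
    and eps_unit: "eps E \<noteq> 0" "valF E (eps E) = 0"
    and eps_nonsquare: "\<not> (\<exists>a. a\<^sup>2 = eps E)"
    and rt_square: "(rt E)\<^sup>2 = incl E (eps E)"
    and generated: "\<exists>a b. x = incl E a + incl E b * rt E"
    and valE_incl: "a \<noteq> 0 \<Longrightarrow> valE E (incl E a) = valF E a"
    and unif: "unif E \<noteq> 0" "valF E (unif E) = 1"

definition gconj :: "('f::field, 'e::field) quad_ext \<Rightarrow> 'e \<Rightarrow> 'e" where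
  "gconj E x = (THE y. \<exists>a b. x = incl E a + incl E b * rt E \<and> y = incl E a - incl E b * rt E)"

definition norm_one :: "('f::field, 'e::field) quad_ext \<Rightarrow> 'e set" where
  "norm_one E = {x. x * gconj E x = 1}"

text \<open>Additive characters of \<open>F\<close> trivial on the maximal ideal and nontrivial on the integers.\<close>

definition level_one_character :: "('f::field, 'e::field) quad_ext \<Rightarrow> ('f \<Rightarrow> complex) \<Rightarrow> bool" where
  "level_one_character E \<psi>' \<longleftrightarrow>
     (\<forall>x y. \<psi>' (x + y) = \<psi>' x * \<psi>' y) \<and>
     (\<forall>x. \<psi>' x \<noteq> 0) \<and>
     (\<forall>x\<in>pideal (valF E) 1. \<psi>' x = 1) \<and>
     (\<exists>x\<in>pideal (valF E) 0. \<psi>' x \<noteq> 1)"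

text \<open>\<open>(x + gconj E x) / 2\<close> lies in the image of \<open>F\<close>.\<close>

definition psiE :: "('f::field, 'e::field) quad_ext \<Rightarrow> ('f \<Rightarrow> complex) \<Rightarrow> 'e \<Rightarrow> complex" where
  "psiE E \<psi>' x = \<psi>' (inv_into UNIV (incl E) ((x + gconj E x) / 2))"

section \<open>Matrix groups\<close>

type_synonym 'e mat2 = "'e ^ 2 ^ 2"

definition mat22 :: "'e::zero \<Rightarrow> 'e \<Rightarrow> 'e \<Rightarrow> 'e \<Rightarrow> 'e mat2" where
  "mat22 a b c d = vector [vector [a, b], vector [c, d]]"

definition matgrp :: "'e::field mat2 set \<Rightarrow> 'e mat2 monoid" where
  "matgrp S = \<lparr>carrier = S, mult = (**), one = mat 1\<rparr>"

text \<open>The topology on 2-by-2 matrices over \<open>E\<close> induced by the valuation.\<close>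

definition mat_open :: "('f::field, 'e::field) quad_ext \<Rightarrow> 'e mat2 set \<Rightarrow> bool" where
  "mat_open E U \<longleftrightarrow>
     (\<forall>g\<in>U. \<exists>n. \<forall>h. (\<forall>i j. h $ i $ j - g $ i $ j \<in> pideal (valE E) n) \<longrightarrow> h \<in> U)"

lemma istopology_mat_open: "istopology (mat_open E)"
proof -
  have inter: "mat_open E (S \<inter> T)" if "mat_open E S" "mat_open E T" for S T
    unfolding mat_open_def
  proof
    fix g assume "g \<in> S \<inter> T"
    with that obtain m n where
      m: "\<forall>h. (\<forall>i j. h $ i $ j - g $ i $ j \<in> pideal (valE E) m) \<longrightarrow> h \<in> S" and
      n: "\<forall>h. (\<forall>i j. h $ i $ j - g $ i $ j \<in> pideal (valE E) n) \<longrightarrow> h \<in> T"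
      unfolding mat_open_def by (meson IntD1 IntD2)
    have "x \<in> pideal (valE E) m \<and> x \<in> pideal (valE E) n" if "x \<in> pideal (valE E) (max m n)" for x
      using that by (auto simp: pideal_def)
    with m n show "\<exists>k. \<forall>h. (\<forall>i j. h $ i $ j - g $ i $ j \<in> pideal (valE E) k) \<longrightarrow> h \<in> S \<inter> T"
      by (intro exI[of _ "max m n"]) blast
  qed
  have union: "mat_open E (\<Union>\<S>)" if "\<forall>S\<in>\<S>. mat_open E S" for \<S>
    using that unfolding mat_open_def by (metis Union_iff)
  show ?thesis
    unfolding istopology_def using inter union by blast
qed

definition mat_top :: "('f::field, 'e::field) quad_ext \<Rightarrow> 'e mat2 topology" where
  "mat_top E = topology (mat_open E)"

definition U11 :: "('f::field, 'e::field) quad_ext \<Rightarrow> 'e mat2 set" where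
  "U11 E = {g. transpose (\<chi> i j. gconj E (g $ i $ j)) ** mat22 0 1 1 0 ** g = mat22 0 1 1 0}"

definition centre :: "('f::field, 'e::field) quad_ext \<Rightarrow> 'e mat2 set" where
  "centre E = {mat z | z. z \<in> norm_one E}"

definition maxcpt :: "('f::field, 'e::field) quad_ext \<Rightarrow> 'e mat2 set" where
  "maxcpt E = {g \<in> U11 E. \<forall>i j. g $ i $ j \<in> pideal (valE E) 0}"

definition maxcpt_plus :: "('f::field, 'e::field) quad_ext \<Rightarrow> 'e mat2 set" where
  "maxcpt_plus E = {g \<in> maxcpt E. \<forall>i j. (g - mat 1) $ i $ j \<in> pideal (valE E) 1}"

definition eta :: "('f::field, 'e::field) quad_ext \<Rightarrow> 'e mat2" where
  "eta E = mat22 1 0 0 (incl E (unif E))"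

definition unip :: "('f::field, 'e::field) quad_ext \<Rightarrow> 'e mat2 set" where
  "unip E = {mat22 1 (rt E * incl E b) 0 1 | b. b \<in> pideal (valF E) 0}"

definition Jgrp :: "('f::field, 'e::field) quad_ext \<Rightarrow> nat \<Rightarrow> 'e mat2 set" where
  "Jgrp E d = {k \<in> U11 E.
     k $ 1 $ 1 - 1 \<in> pideal (valE E) \<lceil>real d / 2\<rceil> \<and>
     k $ 1 $ 2 \<in> pideal (valE E) \<lceil>real d / 2\<rceil> \<and>
     k $ 2 $ 1 \<in> pideal (valE E) \<lceil>(real d + 1) / 2\<rceil> \<and>
     k $ 2 $ 2 - 1 \<in> pideal (valE E) \<lceil>real d / 2\<rceil>}"

definition ZUJ :: "('f::field, 'e::field) quad_ext \<Rightarrow> nat \<Rightarrow> 'e mat2 set" where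
  "ZUJ E d = {z ** u ** k | z u k. z \<in> centre E \<and> u \<in> unip E \<and> k \<in> Jgrp E d}"

definition Xmat :: "('f::field, 'e::field) quad_ext \<Rightarrow> nat \<Rightarrow> 'e mat2" where
  "Xmat E d = mat22 0 (incl E (unif E) powi (- int d) * rt E) 0 0"

section \<open>Complex representations\<close>

text \<open>
  The representation space is a subspace \<open>vs\<close> of a type with scalar multiplication \<open>scal\<close>.
  Values of \<open>act\<close> at arguments outside the group or the space carry no meaning.
\<close>

record ('g, 'v) rep =
  grp :: "'g monoid"
  scal :: "complex \<Rightarrow> 'v \<Rightarrow> 'v"
  vs :: "'v set"
  act :: "'g \<Rightarrow> 'v \<Rightarrow> 'v"

definition is_rep :: "('g, 'v::ab_group_add) rep \<Rightarrow> bool" where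
  "is_rep R \<longleftrightarrow>
     group (grp R) \<and> vector_space (scal R) \<and> module.subspace (scal R) (vs R) \<and>
     (\<forall>g\<in>carrier (grp R). \<forall>x\<in>vs R. act R g x \<in> vs R) \<and>
     (\<forall>g\<in>carrier (grp R). \<forall>x\<in>vs R. \<forall>y\<in>vs R. act R g (x + y) = act R g x + act R g y) \<and>
     (\<forall>g\<in>carrier (grp R). \<forall>c. \<forall>x\<in>vs R. act R g (scal R c x) = scal R c (act R g x)) \<and>
     (\<forall>x\<in>vs R. act R \<one>\<^bsub>grp R\<^esub> x = x) \<and>
     (\<forall>g\<in>carrier (grp R). \<forall>h\<in>carrier (grp R). \<forall>x\<in>vs R.
        act R (g \<otimes>\<^bsub>grp R\<^esub> h) x = act R g (act R h x))"

definition irreducible_rep :: "('g, 'v::ab_group_add) rep \<Rightarrow> bool" where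
  "irreducible_rep R \<longleftrightarrow>
     is_rep R \<and> vs R \<noteq> {0} \<and>
     (\<forall>W. module.subspace (scal R) W \<and> W \<subseteq> vs R \<and>
          (\<forall>g\<in>carrier (grp R). \<forall>x\<in>W. act R g x \<in> W) \<longrightarrow> W = {0} \<or> W = vs R)"

definition rep_iso :: "('g, 'v::ab_group_add) rep \<Rightarrow> ('g, 'w::ab_group_add) rep \<Rightarrow> bool"
    (infix \<open>\<cong>\<^sub>r\<close> 50) where
  "R \<cong>\<^sub>r S \<longleftrightarrow>
     is_rep R \<and> is_rep S \<and> grp R = grp S \<and>
     (\<exists>T. bij_betw T (vs R) (vs S) \<and>
       (\<forall>x\<in>vs R. \<forall>y\<in>vs R. T (x + y) = T x + T y) \<and>
       (\<forall>c. \<forall>x\<in>vs R. T (scal R c x) = scal S c (T x)) \<and>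
       (\<forall>g\<in>carrier (grp R). \<forall>x\<in>vs R. T (act R g x) = act S g (T x)))"

definition Res :: "'g monoid \<Rightarrow> ('g, 'v) rep \<Rightarrow> ('g, 'v) rep" where
  "Res H R = R\<lparr>grp := H\<rparr>"

definition inflate :: "'g monoid \<Rightarrow> 'g set \<Rightarrow> ('g set, 'v) rep \<Rightarrow> ('g, 'v) rep" where
  "inflate K N R =
     \<lparr>grp = K, scal = scal R, vs = vs R, act = (\<lambda>g. act R (N #>\<^bsub>K\<^esub> g))\<rparr>"

text \<open>Smooth induction: the functions live on \<open>G\<close> and are extended by \<open>0\<close> to the whole type.\<close>

definition Ind_space ::
    "'g topology \<Rightarrow> 'g monoid \<Rightarrow> ('g, 'v::ab_group_add) rep \<Rightarrow> ('g \<Rightarrow> 'v) set" where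
  "Ind_space T G R = {f.
     (\<forall>x. x \<notin> carrier G \<longrightarrow> f x = 0) \<and>
     (\<forall>x\<in>carrier G. f x \<in> vs R) \<and>
     (\<forall>h\<in>carrier (grp R). \<forall>x\<in>carrier G. f (h \<otimes>\<^bsub>G\<^esub> x) = act R h (f x)) \<and>
     (\<exists>L. subgroup L G \<and> openin (subtopology T (carrier G)) L \<and>
        (\<forall>x\<in>carrier G. \<forall>l\<in>L. f (x \<otimes>\<^bsub>G\<^esub> l) = f x))}"

definition Ind ::
    "'g topology \<Rightarrow> 'g monoid \<Rightarrow> ('g, 'v::ab_group_add) rep \<Rightarrow> ('g, 'g \<Rightarrow> 'v) rep" where
  "Ind T G R =
     \<lparr>grp = G, scal = (\<lambda>c f x. scal R c (f x)), vs = Ind_space T G R,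
      act = (\<lambda>g f x. if x \<in> carrier G then f (x \<otimes>\<^bsub>G\<^esub> g) else 0)\<rparr>"

definition cInd ::
    "'g topology \<Rightarrow> 'g monoid \<Rightarrow> ('g, 'v::ab_group_add) rep \<Rightarrow> ('g, 'g \<Rightarrow> 'v) rep" where
  "cInd T G R = (Ind T G R)\<lparr>vs := {f \<in> Ind_space T G R.
     \<exists>C. compactin T C \<and> C \<subseteq> carrier G \<and> {x. f x \<noteq> 0} \<subseteq> carrier (grp R) <#>\<^bsub>G\<^esub> C}\<rparr>"

definition rep_sum ::
    "('g, 'v::ab_group_add) rep \<Rightarrow> ('g, 'w::ab_group_add) rep \<Rightarrow> ('g, 'v \<times> 'w) rep"
    (infixr \<open>\<oplus>\<^sub>r\<close> 65) where
  "R \<oplus>\<^sub>r S =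
     \<lparr>grp = grp R, scal = (\<lambda>c (x, y). (scal R c x, scal S c y)), vs = vs R \<times> vs S,
      act = (\<lambda>g (x, y). (act R g x, act S g y))\<rparr>"

definition rep_direct_sum ::
    "'g monoid \<Rightarrow> 'i set \<Rightarrow> ('i \<Rightarrow> ('g, 'v::ab_group_add) rep) \<Rightarrow> ('g, 'i \<Rightarrow> 'v) rep" where
  "rep_direct_sum G I R =
     \<lparr>grp = G, scal = (\<lambda>c \<phi> i. scal (R i) c (\<phi> i)),
      vs = {\<phi>. finite {i. \<phi> i \<noteq> 0} \<and> (\<forall>i\<in>I. \<phi> i \<in> vs (R i)) \<and> (\<forall>i. i \<notin> I \<longrightarrow> \<phi> i = 0)},
      act = (\<lambda>g \<phi> i. if i \<in> I then act (R i) g (\<phi> i) else 0)\<rparr>"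

definition char_rep :: "'g monoid \<Rightarrow> ('g \<Rightarrow> complex) \<Rightarrow> ('g, complex) rep" where
  "char_rep H \<omega> = \<lparr>grp = H, scal = (*), vs = UNIV, act = (\<lambda>h z. \<omega> h * z)\<rparr>"

definition lin_character :: "'g monoid \<Rightarrow> ('g \<Rightarrow> complex) \<Rightarrow> bool" where
  "lin_character H \<omega> \<longleftrightarrow> \<omega> \<in> hom H \<lparr>carrier = - {0}, mult = (*), one = 1\<rparr>"

definition conj_rep :: "'e::field mat2 \<Rightarrow> ('e mat2, 'v) rep \<Rightarrow> ('e mat2, 'v) rep" where
  "conj_rep a R =
     R\<lparr>grp := matgrp ((\<lambda>k. a ** k ** matrix_inv a) ` carrier (grp R)),
       act := (\<lambda>x. act R (matrix_inv a ** x ** a))\<rparr>"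

section \<open>The representations of \<open>U(1,1)\<close> at hand\<close>

abbreviation Ggrp :: "('f::field, 'e::field) quad_ext \<Rightarrow> 'e mat2 monoid" where
  "Ggrp E \<equiv> matgrp (U11 E)"

abbreviation Kgrp :: "('f::field, 'e::field) quad_ext \<Rightarrow> 'e mat2 monoid" where
  "Kgrp E \<equiv> matgrp (maxcpt E)"

text \<open>
  The proper parabolic subgroups of the finite group \<open>U(1,1)\<close> are the Borel subgroups; they are all
  conjugate, and the image of \<open>unip E\<close> in the quotient is the unipotent radical of the upper
  triangular one.
\<close>

definition cuspidal :: "('f::field, 'e::field) quad_ext \<Rightarrow> ('e mat2 set, 'w::ab_group_add) rep \<Rightarrow> bool" where
  "cuspidal E \<sigma> \<longleftrightarrow>
     (let Q = Kgrp E Mod maxcpt_plus E in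
       grp \<sigma> = Q \<and> irreducible_rep \<sigma> \<and>
       (\<forall>g\<in>carrier Q. \<forall>x\<in>vs \<sigma>.
          (\<forall>u\<in>unip E. act \<sigma> (g \<otimes>\<^bsub>Q\<^esub> (maxcpt_plus E #>\<^bsub>Kgrp E\<^esub> u) \<otimes>\<^bsub>Q\<^esub> inv\<^bsub>Q\<^esub> g) x = x)
          \<longrightarrow> x = 0))"

definition inflated :: "('f::field, 'e::field) quad_ext \<Rightarrow> ('e mat2 set, 'w) rep \<Rightarrow> ('e mat2, 'w) rep" where
  "inflated E \<sigma> = inflate (Kgrp E) (maxcpt_plus E) \<sigma>"

definition has_central_character ::
    "('f::field, 'e::field) quad_ext \<Rightarrow> ('e mat2, 'w) rep \<Rightarrow> ('e \<Rightarrow> complex) \<Rightarrow> bool" where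
  "has_central_character E R \<theta> \<longleftrightarrow> (\<forall>z\<in>norm_one E. \<forall>x\<in>vs R. act R (mat z) x = scal R (\<theta> z) x)"

text \<open>
  Membership in \<open>extensional (ZUJ E d)\<close> only normalizes the function outside the group, as is
  needed for uniqueness.
\<close>

definition Psi ::
    "('f::field, 'e::field) quad_ext \<Rightarrow> ('f \<Rightarrow> complex) \<Rightarrow> ('e \<Rightarrow> complex) \<Rightarrow> nat \<Rightarrow> 'e mat2 \<Rightarrow> complex" where
  "Psi E \<psi>' \<theta> d = (THE \<omega>.
     \<omega> \<in> extensional (ZUJ E d) \<and> lin_character (matgrp (ZUJ E d)) \<omega> \<and>
     (\<forall>z\<in>norm_one E. \<forall>u\<in>unip E. \<omega> (mat z ** u) = \<theta> z) \<and>
     (\<forall>k\<in>Jgrp E d. \<omega> k = psiE E \<psi>' (trace (Xmat E d ** (k - mat 1)))))"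

definition S_rep ::
    "('f::field, 'e::field) quad_ext \<Rightarrow> ('f \<Rightarrow> complex) \<Rightarrow> ('e \<Rightarrow> complex) \<Rightarrow> nat
      \<Rightarrow> ('e mat2, 'e mat2 \<Rightarrow> complex) rep" where
  "S_rep E \<psi>' \<theta> d =
     Ind (mat_top E) (Kgrp E) (char_rep (matgrp (ZUJ E d)) (Psi E \<psi>' \<theta> d))"

end

theory Submission
  imports Defs "HOL-Computational_Algebra.Fundamental_Theorem_Algebra"
begin

text \<open>
  Cartan decomposition: a function in the compactly induced representation is determined by its values on the double cosets
  of \<open>diag(\<pi>^m, \<pi>^-n)\<close>, \<open>d = m + n\<close>, where \<open>d\<close> has a fixed parity, and the double coset of index \<open>d > 0\<close> contributes
  \<open>\<sigma>\<close> twisted by conjugation and induced from the elements of \<open>\<K>\<close> whose lower left entry lies in \<open>p^d\<close>. The restriction of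
  \<open>\<sigma>\<close> to a Borel subgroup is induced from a character of the product of the centre and the unipotent radical, because Whittaker
  functionals are unique and the torus permutes the nontrivial characters of the unipotent radical transitively. So the
  contribution of \<open>d\<close> is induced from a character of the group of all \<open>k\<close> with \<open>k11 \<in> E^1 (1 + p)\<close> and \<open>k21 \<in> p^d\<close>. Now
  \<open>\<S>_d\<close> is induced by the same formula from the group with \<open>k11 \<in> E^1 (1 + p^i)\<close> and \<open>k21 \<in> p^j\<close>, where \<open>i + j = d + 1\<close> and
  \<open>i = \<lceil>d/2\<rceil>\<close>. Mackey's criterion holds for every \<open>i\<close> with \<open>1 \<le> i \<le> j\<close>, and the two characters agree on the intersection of
  their domains, so both representations are irreducible and they are isomorphic.
\<close>

section \<open>Representations induced from characters\<close>

text \<open>The two induction data arise differently. Conjugation by the diagonal matrix multiplies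
  the upper right entry by \<open>\<pi>^d\<close> and divides the lower left one, so a cell gives i
  = 1 and j = d, whereas \<open>S_rep\<close> has i and j near d/2. The two are compared without
  dimension counts: averaging over one group maps one space to the other, and it is nonzero because
  on a standard vector it counts cosets in the intersection of the groups. Uniqueness of the
  Whittaker vector has to be derived from irreducibility alone. Gelfand's trick makes the Hecke
  operators on the Whittaker space commute; an eigenvector exists because orbits are finite, and
  then every operator is a scalar. The constant \<open>\<epsilon>\<close> in the Whittaker character
  is the square of \<open>\<delta>\<close>: one factor comes from \<open>Xmat\<close>, the other
  from the lower unipotent matrices. Both compact inductions are treated together by writing G as
  \<open>a\<close> times a set of similitudes, with \<open>a\<close> the identity or
  \<open>eta E\<close>. Equivariance under the conjugate group becomes equivariance under K, and the
  parity of d is read off from the multiplier.\<close>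

locale finite_index_normal = normal +
  assumes finite_rcosets: "finite (rcosets H)"
begin

lemma inv_cancel [simp]:
  assumes "x \<in> carrier G" "y \<in> carrier G"
  shows "inv x \<otimes> (x \<otimes> y) = y" "x \<otimes> (inv x \<otimes> y) = y"
  using assms by (simp_all flip: m_assoc)

section \<open>Sums over the cosets of a normal subgroup of finite index\<close>

definition rep :: "'a set \<Rightarrow> 'a" where
  "rep C = (SOME x. x \<in> C)"

text \<open>An unnormalised integral over the finite quotient group. The choice of representatives
  does not matter for functions with \<open>coset_invariant\<close>, so this invariance is checked
  before each change of variables.\<close>

definition coset_sum :: "('a \<Rightarrow> 'c::comm_monoid_add) \<Rightarrow> 'c" where
  "coset_sum \<phi> = (\<Sum>C\<in>rcosets H. \<phi> (rep C))"

definition coset_invariant :: "('a \<Rightarrow> 'c) \<Rightarrow> bool" where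
  "coset_invariant \<phi> \<longleftrightarrow> (\<forall>n\<in>H. \<forall>x\<in>carrier G. \<phi> (n \<otimes> x) = \<phi> x)"

lemma rep_in: "C \<in> rcosets H \<Longrightarrow> rep C \<in> C"
  unfolding rep_def using rcosets_non_empty[of C] by (simp add: some_in_eq)

lemma rep_carrier: "C \<in> rcosets H \<Longrightarrow> rep C \<in> carrier G"
proof -
  assume C: "C \<in> rcosets H"
  then obtain x where x: "x \<in> carrier G" "C = H #> x" by (auto simp: RCOSETS_def)
  have "C \<subseteq> carrier G" unfolding x(2) by (rule r_coset_subset_G[OF subset x(1)])
  thus ?thesis using rep_in[OF C] by (rule subsetD)
qed

lemma coset_rep: "C \<in> rcosets H \<Longrightarrow> H #> rep C = C"
proof -
  assume C: "C \<in> rcosets H"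
  then obtain x where x: "x \<in> carrier G" "C = H #> x" by (auto simp: RCOSETS_def)
  have "rep C \<in> H #> x" using rep_in[OF C] x(2) by simp
  thus ?thesis using repr_independence[OF _ x(1) subgroup_axioms] x(2) by simp
qed

lemma rep_eq:
  assumes "x \<in> carrier G" obtains n where "n \<in> H" "rep (H #> x) = n \<otimes> x"
proof -
  have "H #> x \<in> rcosets H" using assms by (simp add: rcosetsI subset)
  hence "rep (H #> x) \<in> H #> x" by (rule rep_in)
  thus ?thesis using that by (auto simp: r_coset_def)
qed

lemma invariant_rep:
  assumes "coset_invariant \<phi>" "x \<in> carrier G"
  shows "\<phi> (rep (H #> x)) = \<phi> x"
  using rep_eq[OF assms(2)] assms unfolding coset_invariant_def by metis

lemma coset_absorb: "n \<in> H \<Longrightarrow> x \<in> carrier G \<Longrightarrow> H #> (n \<otimes> x) = H #> x"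
  by (metis coset_mult_assoc rcos_const mem_carrier subset is_group)

text \<open>A change of variables only has to descend to the cosets in both directions. It need not
  send representatives to representatives, since \<open>\<phi>\<close> cannot distinguish elements
  of one coset.\<close>

lemma coset_sum_bij:
  assumes inv: "coset_invariant \<phi>"
    and \<pi>: "\<And>x. x \<in> carrier G \<Longrightarrow> \<pi> x \<in> carrier G" "\<And>x. x \<in> carrier G \<Longrightarrow> \<pi>' x \<in> carrier G"
    and inverse: "\<And>x. x \<in> carrier G \<Longrightarrow> \<pi>' (\<pi> x) = x" "\<And>x. x \<in> carrier G \<Longrightarrow> \<pi> (\<pi>' x) = x"
    and cosets: "\<And>x n. x \<in> carrier G \<Longrightarrow> n \<in> H \<Longrightarrow> H #> \<pi> (n \<otimes> x) = H #> \<pi> x"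
      "\<And>x n. x \<in> carrier G \<Longrightarrow> n \<in> H \<Longrightarrow> H #> \<pi>' (n \<otimes> x) = H #> \<pi>' x"
  shows "coset_sum (\<lambda>x. \<phi> (\<pi> x)) = coset_sum \<phi>"
proof -
  have c: "H #> \<pi> (rep (H #> x)) = H #> \<pi> x" "H #> \<pi>' (rep (H #> x)) = H #> \<pi>' x" if "x \<in> carrier G" for x
    using rep_eq[OF that] cosets that by metis+
  show ?thesis unfolding coset_sum_def
  proof (rule sum.reindex_bij_witness[where i = "\<lambda>C. H #> \<pi>' (rep C)" and j = "\<lambda>C. H #> \<pi> (rep C)"])
    fix C assume C: "C \<in> rcosets H"
    note r = rep_carrier[OF C]
    show "H #> \<pi>' (rep (H #> \<pi> (rep C))) = C" "H #> \<pi> (rep (H #> \<pi>' (rep C))) = C"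
      using c \<pi> inverse r coset_rep[OF C] by simp_all
    show "H #> \<pi> (rep C) \<in> rcosets H" "H #> \<pi>' (rep C) \<in> rcosets H"
      using \<pi> r by (simp_all add: rcosetsI subset)
    show "\<phi> (rep (H #> \<pi> (rep C))) = \<phi> (\<pi> (rep C))"
      using invariant_rep[OF inv] \<pi> r by simp
  qed
qed

lemma coset_sum_right:
  assumes "coset_invariant \<phi>" "g \<in> carrier G"
  shows "coset_sum (\<lambda>x. \<phi> (x \<otimes> g)) = coset_sum \<phi>"
proof (rule coset_sum_bij[OF assms(1), where \<pi>' = "\<lambda>x. x \<otimes> inv g"])
  show "H #> (n \<otimes> x \<otimes> g) = H #> (x \<otimes> g)" "H #> (n \<otimes> x \<otimes> inv g) = H #> (x \<otimes> inv g)"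
    if "x \<in> carrier G" "n \<in> H" for x n
    using that assms by (simp_all add: m_assoc coset_absorb)
qed (use assms in \<open>auto simp: m_assoc\<close>)

lemma coset_sum_left:
  assumes "coset_invariant \<phi>" "g \<in> carrier G"
  shows "coset_sum (\<lambda>x. \<phi> (g \<otimes> x)) = coset_sum \<phi>"
proof (rule coset_sum_bij[OF assms(1), where \<pi>' = "\<lambda>x. inv g \<otimes> x"])
  have "H #> (h \<otimes> (n \<otimes> x)) = H #> (h \<otimes> x)" if "x \<in> carrier G" "n \<in> H" "h \<in> carrier G" for x n h
  proof -
    \<comment> \<open>Left translation respects the right cosets of \<open>H\<close> because
      \<open>H\<close> is normal.\<close>
    have "h \<otimes> (n \<otimes> x) = (h \<otimes> n \<otimes> inv h) \<otimes> (h \<otimes> x)"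
      using that by (simp add: m_assoc)
    moreover have "h \<otimes> n \<otimes> inv h \<in> H" using inv_op_closed2 that by simp
    ultimately show ?thesis
      using that by (simp add: coset_absorb)
  qed
  thus "H #> (g \<otimes> (n \<otimes> x)) = H #> (g \<otimes> x)" "H #> (inv g \<otimes> (n \<otimes> x)) = H #> (inv g \<otimes> x)"
    if "x \<in> carrier G" "n \<in> H" for x n
    using that assms by auto
qed (use assms in \<open>auto simp: m_assoc\<close>)

text \<open>Normality moves \<open>n\<close> to the other side of \<open>x\<close>;
  \<open>coset_invariantI\<close> is the converse.\<close>

lemma coset_invariant_right:
  assumes "coset_invariant \<phi>" "x \<in> carrier G" "n \<in> H"
  shows "\<phi> (x \<otimes> n) = \<phi> x"
proof -
  have "x \<otimes> n = (x \<otimes> n \<otimes> inv x) \<otimes> x" using assms by (simp add: m_assoc)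
  moreover have "x \<otimes> n \<otimes> inv x \<in> H" using inv_op_closed2 assms by simp
  ultimately show ?thesis using assms(1,2) unfolding coset_invariant_def by metis
qed

lemma coset_invariantI:
  assumes "\<And>x n. x \<in> carrier G \<Longrightarrow> n \<in> H \<Longrightarrow> \<phi> (x \<otimes> n) = \<phi> x"
  shows "coset_invariant \<phi>"
  unfolding coset_invariant_def
proof (intro ballI)
  fix n x assume *: "n \<in> H" "x \<in> carrier G"
  have "n \<otimes> x = x \<otimes> (inv x \<otimes> n \<otimes> x)" using * by (simp add: m_assoc)
  moreover have "inv x \<otimes> n \<otimes> x \<in> H" using inv_op_closed1 * by simp
  ultimately show "\<phi> (n \<otimes> x) = \<phi> x" using assms * by metis
qed

section \<open>Functions transforming under a character, and irreducibility by Mackey's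
  criterion\<close>

definition char_space :: "'a set \<Rightarrow> ('a \<Rightarrow> complex) \<Rightarrow> ('a \<Rightarrow> complex) set" where
  "char_space D \<omega> = {f. (\<forall>x. x \<notin> carrier G \<longrightarrow> f x = 0) \<and>
     (\<forall>h\<in>D. \<forall>x\<in>carrier G. f (h \<otimes> x) = \<omega> h * f x)}"

definition translate :: "'a \<Rightarrow> ('a \<Rightarrow> 'c::zero) \<Rightarrow> 'a \<Rightarrow> 'c" where
  "translate g f = (\<lambda>x. if x \<in> carrier G then f (x \<otimes> g) else 0)"

definition stable :: "('a \<Rightarrow> complex) set \<Rightarrow> bool" where
  "stable W \<longleftrightarrow> (\<lambda>x. 0) \<in> W \<and> (\<forall>f\<in>W. \<forall>g\<in>W. (\<lambda>x. f x + g x) \<in> W) \<and>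
     (\<forall>f\<in>W. \<forall>c. (\<lambda>x. c * f x) \<in> W) \<and> (\<forall>f\<in>W. \<forall>g\<in>carrier G. translate g f \<in> W)"

text \<open>The last condition is Mackey's criterion.\<close>

definition mackey :: "'a set \<Rightarrow> ('a \<Rightarrow> complex) \<Rightarrow> bool" where
  "mackey D \<omega> \<longleftrightarrow> subgroup D G \<and> H \<subseteq> D \<and>
     (\<forall>h\<in>D. \<forall>k\<in>D. \<omega> (h \<otimes> k) = \<omega> h * \<omega> k) \<and> (\<forall>n\<in>H. \<omega> n = 1) \<and>
     (\<forall>k\<in>carrier G - D. \<exists>h\<in>D. k \<otimes> h \<otimes> inv k \<in> D \<and> \<omega> (k \<otimes> h \<otimes> inv k) \<noteq> \<omega> h)"

lemma stable_sum:
  assumes "stable W" "finite S" "\<And>i. i \<in> S \<Longrightarrow> F i \<in> W"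
  shows "(\<lambda>x. \<Sum>i\<in>S. F i x) \<in> W"
  using assms(2,3)
proof (induction S rule: finite_induct)
  case empty thus ?case using assms(1) by (simp add: stable_def)
next
  case (insert i S) thus ?case using assms(1) by (simp add: stable_def)
qed

text \<open>The sum is a finite linear combination of right translates of \<open>f\<close>, so a
  stable subspace contains it. Only the values of \<open>c\<close> at the representatives enter,
  hence \<open>c\<close> is arbitrary here.\<close>

lemma stable_coset_sum:
  assumes W: "stable W" "f \<in> W" and zero: "\<And>x. x \<notin> carrier G \<Longrightarrow> f x = 0"
  shows "(\<lambda>x. if x \<in> carrier G then coset_sum (\<lambda>y. c y * f (x \<otimes> y)) else 0) \<in> W"
proof -
  have "(\<lambda>x. \<Sum>C\<in>rcosets H. c (rep C) * translate (rep C) f x) \<in> W"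
    using W rep_carrier by (intro stable_sum[OF W(1) finite_rcosets]) (auto simp: stable_def)
  also have "(\<lambda>x. \<Sum>C\<in>rcosets H. c (rep C) * translate (rep C) f x) =
      (\<lambda>x. if x \<in> carrier G then coset_sum (\<lambda>y. c y * f (x \<otimes> y)) else 0)"
    by (auto simp: translate_def coset_sum_def)
  finally show ?thesis .
qed

text \<open>The sum counts the representatives that lie in \<open>D\<close>, and the coset
  \<open>H\<close> itself contributes one of them.\<close>

lemma coset_sum_indicator_nonzero:
  assumes "subgroup D G" "H \<subseteq> D"
  shows "coset_sum (\<lambda>y. if y \<in> D then 1 else 0) \<noteq> (0::complex)"
proof -
  have "coset_sum (\<lambda>y. if y \<in> D then 1 else (0::complex)) = of_nat (card {C\<in>rcosets H. rep C \<in> D})"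
    unfolding coset_sum_def using finite_rcosets by (simp add: sum.If_cases Int_def)
  moreover have "H \<in> {C\<in>rcosets H. rep C \<in> D}"
  proof -
    have "H \<in> rcosets H" using subgroup_in_rcosets is_group by blast
    thus ?thesis using rep_in assms(2) by blast
  qed
  hence "card {C\<in>rcosets H. rep C \<in> D} \<noteq> 0" using finite_rcosets by (auto simp: card_eq_0_iff)
  ultimately show ?thesis by simp
qed

context
  fixes D \<omega> assumes m: "mackey D \<omega>"
begin

lemma mackey_subgroup: "subgroup D G"
  using m by (simp add: mackey_def)

lemma mackey_carrier: "h \<in> D \<Longrightarrow> h \<in> carrier G"
  by (rule subgroup.mem_carrier[OF mackey_subgroup])

lemma mackey_one: "\<omega> \<one> = 1"
  using m by (simp add: mackey_def)

lemma mackey_mult: "h \<in> D \<Longrightarrow> k \<in> D \<Longrightarrow> \<omega> (h \<otimes> k) = \<omega> h * \<omega> k"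
  using m by (simp add: mackey_def)

lemma mackey_inv: "h \<in> D \<Longrightarrow> \<omega> (inv h) * \<omega> h = 1"
  using mackey_mult[of "inv h" h] mackey_one mackey_carrier subgroup.m_inv_closed[OF mackey_subgroup]
  by simp

lemma mackey_nonzero: "h \<in> D \<Longrightarrow> \<omega> h \<noteq> 0"
  using mackey_inv by force

lemma mackey_mem: "h \<in> D \<Longrightarrow> x \<in> carrier G \<Longrightarrow> h \<otimes> x \<in> D \<longleftrightarrow> x \<in> D"
proof
  assume a: "h \<in> D" "x \<in> carrier G" "h \<otimes> x \<in> D"
  have "inv h \<otimes> (h \<otimes> x) \<in> D" using m a unfolding mackey_def
    by (meson subgroup.m_closed subgroup.m_inv_closed)
  thus "x \<in> D" using a mackey_carrier by (simp add: m_assoc)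
qed (use m in \<open>auto simp: mackey_def subgroup.m_closed\<close>)

lemma char_space_invariant: "f \<in> char_space D \<omega> \<Longrightarrow> coset_invariant f"
  using m unfolding char_space_def coset_invariant_def mackey_def by auto

text \<open>The standard generator of the induced space: it is supported on \<open>D\<close>, and
  right translation by \<open>D\<close> multiplies it by \<open>\<omega>\<close>.\<close>

definition delta :: "'a \<Rightarrow> complex" where
  "delta x = (if x \<in> D then \<omega> x else 0)"

lemma delta_in: "delta \<in> char_space D \<omega>"
  unfolding char_space_def delta_def using mackey_mem mackey_mult mackey_carrier by auto

text \<open>For x outside \<open>D\<close>, moving a suitable h across x computes
  \<open>f (x \<otimes> h)\<close> in two ways, with the factors \<open>\<omega> h\<close> and
  \<open>\<omega> (x \<otimes> h \<otimes> inv x)\<close>. Mackey's criterion provides an h for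
  which they differ, so \<open>f x = 0\<close>.\<close>

lemma right_equivariant:
  assumes f: "f \<in> char_space D \<omega>"
    and eq: "\<And>x h. x \<in> carrier G \<Longrightarrow> h \<in> D \<Longrightarrow> f (x \<otimes> h) = \<omega> h * f x"
  shows "f x = f \<one> * delta x"
proof (cases "x \<in> D")
  case True thus ?thesis using eq[of \<one> x] by (simp add: delta_def mackey_carrier)
next
  case False
  show ?thesis
  proof (cases "x \<in> carrier G")
    case True
    then obtain h where h: "h \<in> D" "x \<otimes> h \<otimes> inv x \<in> D" "\<omega> (x \<otimes> h \<otimes> inv x) \<noteq> \<omega> h"
      using m False unfolding mackey_def by blast
    have "\<omega> h * f x = f (x \<otimes> h)" using eq True h by simp
    also have "x \<otimes> h = x \<otimes> h \<otimes> inv x \<otimes> x" using True h mackey_carrier by (simp add: m_assoc)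
    also have "f \<dots> = \<omega> (x \<otimes> h \<otimes> inv x) * f x" using f h True unfolding char_space_def by blast
    finally show ?thesis using h False by (simp add: delta_def)
  qed (use f False in \<open>auto simp: char_space_def delta_def\<close>)
qed

text \<open>Averaging a suitable translate of a nonzero vector against the inverse character yields
  a nonzero multiple of \<open>delta\<close>, and the translates of \<open>delta\<close> span the
  induced space.\<close>

lemma mackey_irreducible:
  assumes W: "stable W" "W \<subseteq> char_space D \<omega>" and f0: "f0 \<in> W" "f0 \<noteq> (\<lambda>x. 0)"
  shows "W = char_space D \<omega>"
proof -
  have m0: "coset_sum (\<lambda>y. if y \<in> D then 1 else 0) \<noteq> (0::complex)"
    using coset_sum_indicator_nonzero m unfolding mackey_def by blast
  have zero: "f x = 0" if "f \<in> char_space D \<omega>" "x \<notin> carrier G" for f x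
    using that unfolding char_space_def by blast
  obtain x0 where x0: "f0 x0 \<noteq> 0" "x0 \<in> carrier G" using f0 W zero by blast
  define f where "f = translate x0 f0"
  have f: "f \<in> W" "f \<one> \<noteq> 0" using f0 x0 W unfolding f_def by (auto simp: stable_def translate_def)
  have fc: "f \<in> char_space D \<omega>" using f W by blast
  note fi = char_space_invariant[OF fc]
  \<comment> \<open>Weights of the projector onto the functions on which right translation by
    \<open>D\<close> acts through \<open>\<omega>\<close>; the value 0 off \<open>D\<close>
    restricts the sum to \<open>D\<close>.\<close>
  define c where "c y = (if y \<in> D then inverse (\<omega> y) else 0)" for y
  define e where "e x = (if x \<in> carrier G then coset_sum (\<lambda>y. c y * f (x \<otimes> y)) else 0)" for x
  have eW: "e \<in> W"
    using stable_coset_sum[OF W(1) f(1) zero[OF fc], of c] by (simp add: e_def[abs_def])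
  hence ec: "e \<in> char_space D \<omega>" using W by blast
  have ci: "coset_invariant c"
    using m mackey_mem mackey_mult mackey_carrier unfolding coset_invariant_def c_def mackey_def
    by (auto simp: subset_iff)
  have prodinv: "coset_invariant (\<lambda>y. c y * f (x \<otimes> y))" if "x \<in> carrier G" for x
    using that coset_invariant_right[OF ci] coset_invariant_right[OF fi]
    by (intro coset_invariantI) (simp flip: m_assoc)
  have ch: "c (inv h \<otimes> y) = \<omega> h * c y" if "h \<in> D" "y \<in> carrier G" for h y
  proof -
    have i: "inv h \<in> D" using that m unfolding mackey_def by (meson subgroup.m_inv_closed)
    have "inverse (\<omega> (inv h)) = \<omega> h" using mackey_inv[OF that(1)] by (metis inverse_unique mult.commute)
    thus ?thesis unfolding c_def using mackey_mem[OF i that(2)] mackey_mult[OF i] by auto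
  qed
  have "e (x \<otimes> h) = \<omega> h * e x" if "x \<in> carrier G" "h \<in> D" for x h
  proof -
    have hc: "h \<in> carrier G" using that mackey_carrier by blast
    have "e (x \<otimes> h) = coset_sum (\<lambda>y. c y * f (x \<otimes> h \<otimes> y))"
      using that hc by (simp add: e_def)
    also have "\<dots> = coset_sum (\<lambda>y. c (inv h \<otimes> (h \<otimes> y)) * f (x \<otimes> (h \<otimes> y)))"
      unfolding coset_sum_def using that hc rep_carrier
      by (intro sum.cong refl) (simp add: m_assoc)
    also have "\<dots> = coset_sum (\<lambda>y. c (inv h \<otimes> y) * f (x \<otimes> y))"
    proof (rule coset_sum_left[where \<phi> = "\<lambda>y. c (inv h \<otimes> y) * f (x \<otimes> y)", OF _ hc])
      show "coset_invariant (\<lambda>y. c (inv h \<otimes> y) * f (x \<otimes> y))"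
        using that hc coset_invariant_right[OF ci] coset_invariant_right[OF fi]
        by (intro coset_invariantI) (simp flip: m_assoc)
    qed
    also have "\<dots> = \<omega> h * e x"
      using that rep_carrier ch unfolding e_def coset_sum_def by (simp add: sum_distrib_left mult.assoc)
    finally show ?thesis .
  qed
  from right_equivariant[OF ec this] have e: "e x = e \<one> * delta x" for x .
  \<comment> \<open>On \<open>D\<close> the weight cancels the factor \<open>\<omega> y\<close> of
    \<open>f y\<close>, so the value at the identity survives up to a nonzero integer.\<close>
  have "e \<one> = f \<one> * coset_sum (\<lambda>y. if y \<in> D then 1 else 0)"
  proof -
    have "c y * f y = f \<one> * (if y \<in> D then 1 else 0)" for y
    proof (cases "y \<in> D")
      case True
      with fc have "f (y \<otimes> \<one>) = \<omega> y * f \<one>" unfolding char_space_def by blast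
      thus ?thesis using True mackey_nonzero[OF True] mackey_carrier[OF True] by (simp add: c_def)
    qed (simp add: c_def)
    thus ?thesis using rep_carrier unfolding e_def coset_sum_def by (simp add: sum_distrib_left)
  qed
  hence "e \<one> \<noteq> 0" using f m0 by simp
  moreover have "(\<lambda>x. inverse (e \<one>) * e x) \<in> W" using eW W by (simp add: stable_def)
  ultimately have dW: "delta \<in> W"
  proof -
    assume 1: "e \<one> \<noteq> 0" and 2: "(\<lambda>x. inverse (e \<one>) * e x) \<in> W"
    have "inverse (e \<one>) * e x = delta x" for x using 1 by (subst e) simp
    with 2 show ?thesis by simp
  qed
  show ?thesis
  proof
    show "char_space D \<omega> \<subseteq> W"
    proof
      fix F assume F: "F \<in> char_space D \<omega>"
      note Fi = char_space_invariant[OF F]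
      have Finv: "coset_invariant (\<lambda>y. F (inv y))"
        using coset_invariant_right[OF Fi] unfolding coset_invariant_def by (simp add: inv_mult_group)
      \<comment> \<open>Convolution of \<open>F\<close> with \<open>delta\<close>. After replacing
        \<open>y\<close> by \<open>inv x \<otimes> y\<close>, each term with y in \<open>D\<close>
        is \<open>F (inv y \<otimes> x) * \<omega> y = F x\<close>, so the sum is a nonzero multiple
        of \<open>F x\<close>.\<close>
      define F' where "F' x = (if x \<in> carrier G then coset_sum (\<lambda>y. F (inv y) * delta (x \<otimes> y)) else 0)" for x
      have "F' \<in> W"
        using stable_coset_sum[OF W(1) dW zero[OF delta_in], of "\<lambda>y. F (inv y)"] by (simp add: F'_def[abs_def])
      moreover have "F' x = F x * coset_sum (\<lambda>y. if y \<in> D then 1 else 0)" if x: "x \<in> carrier G" for x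
      proof -
        have "F' x = coset_sum (\<lambda>y. F (inv (inv x \<otimes> (x \<otimes> y))) * delta (x \<otimes> y))"
          using x rep_carrier by (simp add: F'_def coset_sum_def)
        also have "\<dots> = coset_sum (\<lambda>y. F (inv (inv x \<otimes> y)) * delta y)"
        proof (rule coset_sum_left[where \<phi> = "\<lambda>y. F (inv (inv x \<otimes> y)) * delta y", OF _ x])
          show "coset_invariant (\<lambda>y. F (inv (inv x \<otimes> y)) * delta y)"
            using x coset_invariant_right[OF Finv] coset_invariant_right[OF char_space_invariant[OF delta_in]]
            by (intro coset_invariantI) (simp flip: m_assoc)
        qed
        also have "\<dots> = coset_sum (\<lambda>y. F x * (if y \<in> D then 1 else 0))"
        proof -
          have "F (inv (inv x \<otimes> y)) * delta y = F x * (if y \<in> D then 1 else 0)" for y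
          proof (cases "y \<in> D")
            case True
            have i: "inv y \<in> D" using True m unfolding mackey_def by (meson subgroup.m_inv_closed)
            have "F (inv (inv x \<otimes> y)) = \<omega> (inv y) * F x"
              using True x F i by (simp add: inv_mult_group mackey_carrier char_space_def)
            thus ?thesis using mackey_inv[OF True] True by (simp add: delta_def)
          qed (simp add: delta_def)
          thus ?thesis by simp
        qed
        finally show ?thesis by (simp add: coset_sum_def sum_distrib_left)
      qed
      hence "(\<lambda>x. inverse (coset_sum (\<lambda>y. if y \<in> D then 1 else 0)) * F' x) = F"
        using m0 zero[OF F] by (auto simp: F'_def)
      ultimately show "F \<in> W" using W(1) unfolding stable_def by metis
    qed
  qed (use W in simp)
qed

end

section \<open>Averaging maps between two induced representations\<close>

definition intertwiner :: "'a set \<Rightarrow> ('a \<Rightarrow> complex) \<Rightarrow> ('a \<Rightarrow> complex) \<Rightarrow> 'a \<Rightarrow> complex" where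
  "intertwiner D \<omega> f x = (if x \<in> carrier G then
     coset_sum (\<lambda>y. (if y \<in> D then inverse (\<omega> y) else 0) * f (y \<otimes> x)) else 0)"

lemma stable_char_space:
  assumes m: "mackey D \<omega>"
  shows "stable (char_space D \<omega>)"
  using mackey_carrier[OF m] unfolding stable_def char_space_def translate_def
  by (auto simp: algebra_simps m_assoc)

lemma intertwiner_add: "intertwiner D \<omega> (\<lambda>x. f x + g x) = (\<lambda>x. intertwiner D \<omega> f x + intertwiner D \<omega> g x)"
  by (auto simp: intertwiner_def fun_eq_iff coset_sum_def algebra_simps sum.distrib)

lemma intertwiner_scale: "intertwiner D \<omega> (\<lambda>x. c * f x) = (\<lambda>x. c * intertwiner D \<omega> f x)"
  by (auto simp: intertwiner_def fun_eq_iff coset_sum_def algebra_simps sum_distrib_left)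

lemma intertwiner_translate:
  "g \<in> carrier G \<Longrightarrow> intertwiner D \<omega> (translate g f) = translate g (intertwiner D \<omega> f)"
  using rep_carrier
  by (auto simp: intertwiner_def fun_eq_iff coset_sum_def translate_def m_assoc intro!: sum.cong)

text \<open>Averaging on the left forces equivariance under \<open>D'\<close> and commutes with
  right translation. Since the characters agree on \<open>D \<inter> D'\<close>, the average of
  \<open>delta\<close> has at the identity a positive integer as value. Kernel and image are stable,
  so irreducibility of the source gives injectivity and that of the target surjectivity.\<close>

lemma intertwiner_bij:
  assumes m: "mackey D \<omega>" "mackey D' \<omega>'" and eq: "\<And>h. h \<in> D \<Longrightarrow> h \<in> D' \<Longrightarrow> \<omega> h = \<omega>' h"
  shows "bij_betw (intertwiner D' \<omega>') (char_space D \<omega>) (char_space D' \<omega>')"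
proof -
  let ?A = "intertwiner D' \<omega>'"
  have zero: "f x = 0" if "f \<in> char_space D \<omega>" "x \<notin> carrier G" for f x
    using that unfolding char_space_def by blast
  note add = intertwiner_add[of D' \<omega>'] and scale = intertwiner_scale[of D' \<omega>']
    and trans = intertwiner_translate[of _ D' \<omega>']
  have zz: "?A (\<lambda>x. 0) = (\<lambda>x. 0)" by (auto simp: intertwiner_def coset_sum_def)
  define c where "c y = (if y \<in> D' then inverse (\<omega>' y) else 0)" for y
  have ci: "coset_invariant c"
    using m mackey_mem[OF m(2)] mackey_mult[OF m(2)] mackey_carrier[OF m(2)]
    unfolding coset_invariant_def c_def mackey_def
    by (auto simp: subset_iff)
  have ch: "c (y \<otimes> inv h) = \<omega>' h * c y" if "h \<in> D'" "y \<in> carrier G" for h y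
  proof -
    have i: "inv h \<in> D'" using that m unfolding mackey_def by (meson subgroup.m_inv_closed)
    have s: "subgroup D' G" using m unfolding mackey_def by blast
    have hc: "h \<in> carrier G" using that mackey_carrier[OF m(2)] by blast
    have "inverse (\<omega>' (inv h)) = \<omega>' h" using mackey_inv[OF m(2) that(1)] by (metis inverse_unique mult.commute)
    moreover have "y \<otimes> inv h \<in> D' \<longleftrightarrow> y \<in> D'"
    proof
      assume "y \<otimes> inv h \<in> D'"
      from subgroup.m_closed[OF s this that(1)] show "y \<in> D'" using hc that by (simp add: m_assoc)
    qed (use i s in \<open>auto simp: subgroup.m_closed\<close>)
    ultimately show ?thesis unfolding c_def using mackey_mult[OF m(2) _ i] by auto
  qed
  have into: "?A f \<in> char_space D' \<omega>'" if f: "f \<in> char_space D \<omega>" for f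
  proof -
    note fi = char_space_invariant[OF m(1) f]
    have "?A f (h \<otimes> x) = \<omega>' h * ?A f x" if h: "h \<in> D'" and x: "x \<in> carrier G" for h x
    proof -
      have hc: "h \<in> carrier G" using h mackey_carrier[OF m(2)] by blast
      have "?A f (h \<otimes> x) = coset_sum (\<lambda>y. c y * f (y \<otimes> (h \<otimes> x)))"
        using hc x by (simp add: intertwiner_def c_def)
      also have "\<dots> = coset_sum (\<lambda>y. c (y \<otimes> h \<otimes> inv h) * f (y \<otimes> h \<otimes> x))"
        unfolding coset_sum_def using x hc rep_carrier
        by (intro sum.cong refl) (simp add: m_assoc)
      also have "\<dots> = coset_sum (\<lambda>y. c (y \<otimes> inv h) * f (y \<otimes> x))"
      proof (rule coset_sum_right[where \<phi> = "\<lambda>y. c (y \<otimes> inv h) * f (y \<otimes> x)", OF _ hc])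
        show "coset_invariant (\<lambda>y. c (y \<otimes> inv h) * f (y \<otimes> x))"
          using x hc ci fi by (simp add: coset_invariant_def m_assoc)
      qed
      also have "\<dots> = \<omega>' h * ?A f x"
        using x h rep_carrier ch unfolding intertwiner_def c_def[symmetric] coset_sum_def
        by (simp add: sum_distrib_left mult.assoc)
      finally show ?thesis .
    qed
    thus ?thesis unfolding char_space_def by (simp add: intertwiner_def)
  qed
  note st = stable_char_space[OF m(1)]
  have nz: "?A (delta D \<omega>) \<one> \<noteq> 0"
  proof -
    have "subgroup (D \<inter> D') G" "H \<subseteq> D \<inter> D'"
      using m subgroups_Inter_pair unfolding mackey_def by auto
    note n = coset_sum_indicator_nonzero[OF this]
    have "?A (delta D \<omega>) \<one> = coset_sum (\<lambda>y. if y \<in> D \<inter> D' then 1 else 0)"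
      unfolding intertwiner_def coset_sum_def using rep_carrier eq mackey_nonzero[OF m(2)]
      by (auto simp: delta_def[OF m(1)] intro!: sum.cong)
    thus ?thesis using n by simp
  qed
  have ker: "f = (\<lambda>x. 0)" if "f \<in> char_space D \<omega>" "?A f = (\<lambda>x. 0)" for f
  proof (rule ccontr)
    assume "f \<noteq> (\<lambda>x. 0)"
    let ?W = "{f \<in> char_space D \<omega>. ?A f = (\<lambda>x. 0)}"
    have "stable ?W" using st unfolding stable_def
      by (auto simp: add scale trans zz) (auto simp: translate_def)
    hence "?W = char_space D \<omega>"
      using mackey_irreducible[OF m(1), of ?W f] that \<open>f \<noteq> (\<lambda>x. 0)\<close> by blast
    with delta_in[OF m(1)] have "?A (delta D \<omega>) = (\<lambda>x. 0)" by blast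
    with nz show False by simp
  qed
  have inj: "inj_on ?A (char_space D \<omega>)"
  proof (rule inj_onI)
    fix f g assume *: "f \<in> char_space D \<omega>" "g \<in> char_space D \<omega>" "?A f = ?A g"
    have "(\<lambda>x. f x + (-1) * g x) \<in> char_space D \<omega>"
      using *(1,2) by (simp add: char_space_def algebra_simps)
    moreover have "?A (\<lambda>x. f x + (-1) * g x) = (\<lambda>x. 0)"
      unfolding add scale *(3) by simp
    ultimately have "(\<lambda>x. f x + (-1) * g x) = (\<lambda>x. 0)" by (rule ker)
    thus "f = g" by (auto simp: fun_eq_iff)
  qed
  have "?A ` char_space D \<omega> = char_space D' \<omega>'"
  proof (rule mackey_irreducible[OF m(2)])
    show "stable (?A ` char_space D \<omega>)"
      unfolding stable_def
    proof (intro conjI ballI allI)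
      show "(\<lambda>x. 0) \<in> ?A ` char_space D \<omega>" using st zz unfolding stable_def by (metis image_eqI)
      show "(\<lambda>x. f x + g x) \<in> ?A ` char_space D \<omega>"
        if "f \<in> ?A ` char_space D \<omega>" "g \<in> ?A ` char_space D \<omega>" for f g
        using that st by (auto simp: stable_def simp flip: add)
      show "(\<lambda>x. c * f x) \<in> ?A ` char_space D \<omega>"
        if "f \<in> ?A ` char_space D \<omega>" for f c
        using that st by (auto simp: stable_def simp flip: scale)
      show "translate g f \<in> ?A ` char_space D \<omega>"
        if "f \<in> ?A ` char_space D \<omega>" "g \<in> carrier G" for f g
        using that st by (auto simp: stable_def simp flip: trans)
    qed
    show "?A (delta D \<omega>) \<in> ?A ` char_space D \<omega>" using delta_in[OF m(1)] by blast
    show "?A (delta D \<omega>) \<noteq> (\<lambda>x. 0)" using nz by metis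
  qed (use into in blast)
  thus ?thesis using inj by (simp add: bij_betw_def)
qed

end

section \<open>Local fields\<close>

context nonarch_local_field
begin

lemma val_one [simp]: "v 1 = 0"
  using val_mult[of 1 1] by simp

lemma val_minus [simp]: "v (- x) = v x"
proof (cases "x = 0")
  case False
  have "v (-1) + v (-1) = 0" using val_mult[of "-1" "-1"] by simp
  thus ?thesis using val_mult[of "-1" x] False by simp
qed simp

lemma val_inverse: "x \<noteq> 0 \<Longrightarrow> v (inverse x) = - v x"
  using val_mult[of x "inverse x"] by simp

lemma val_divide: "x \<noteq> 0 \<Longrightarrow> y \<noteq> 0 \<Longrightarrow> v (x / y) = v x - v y"
  using val_mult[of x "inverse y"] val_inverse[of y] by (simp add: divide_inverse)

lemma val_power: "x \<noteq> 0 \<Longrightarrow> v (x ^ n) = int n * v x"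
  by (induction n) (auto simp: val_mult algebra_simps)

lemma pideal_zero [simp]: "0 \<in> pideal v n"
  by (simp add: pideal_def)

lemma pideal_iff: "x \<noteq> 0 \<Longrightarrow> x \<in> pideal v n \<longleftrightarrow> n \<le> v x"
  by (simp add: pideal_def)

lemma pideal_add: "x \<in> pideal v n \<Longrightarrow> y \<in> pideal v n \<Longrightarrow> x + y \<in> pideal v n"
  using val_add[of x y] by (cases "x = 0 \<or> y = 0 \<or> x + y = 0") (auto simp: pideal_def)

lemma pideal_minus [simp]: "- x \<in> pideal v n \<longleftrightarrow> x \<in> pideal v n"
  by (simp add: pideal_def)

lemma pideal_diff: "x \<in> pideal v n \<Longrightarrow> y \<in> pideal v n \<Longrightarrow> x - y \<in> pideal v n"
  using pideal_add[of x n "-y"] by simp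

lemma pideal_commute: "x - y \<in> pideal v n \<longleftrightarrow> y - x \<in> pideal v n"
  using pideal_minus[of "x - y" n] by simp

lemma pideal_mult: "x \<in> pideal v m \<Longrightarrow> y \<in> pideal v n \<Longrightarrow> x * y \<in> pideal v (m + n)"
  using val_mult[of x y] by (cases "x = 0 \<or> y = 0") (auto simp: pideal_def)

lemma pideal_mono: "x \<in> pideal v m \<Longrightarrow> n \<le> m \<Longrightarrow> x \<in> pideal v n"
  by (auto simp: pideal_def)

lemma pideal_mult_le: "x \<in> pideal v m \<Longrightarrow> y \<in> pideal v n \<Longrightarrow> k \<le> m + n \<Longrightarrow> x * y \<in> pideal v k"
  using pideal_mult pideal_mono by blast

lemma pideal_mult_left: "x \<in> pideal v 0 \<Longrightarrow> y \<in> pideal v n \<Longrightarrow> x * y \<in> pideal v n"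
  using pideal_mult[of x 0 y n] by simp

lemma pideal_mult_right: "x \<in> pideal v n \<Longrightarrow> y \<in> pideal v 0 \<Longrightarrow> x * y \<in> pideal v n"
  using pideal_mult[of x n y 0] by simp

lemma pideal_one [simp]: "1 \<in> pideal v n \<longleftrightarrow> n \<le> 0"
  by (simp add: pideal_def)

lemma pideal_add_iff: "x \<in> pideal v n \<Longrightarrow> x + y \<in> pideal v n \<longleftrightarrow> y \<in> pideal v n"
  using pideal_add[of x n y] pideal_diff[of "x + y" n x] by auto

lemma pideal_trans: "x - y \<in> pideal v n \<Longrightarrow> y - z \<in> pideal v n \<Longrightarrow> x - z \<in> pideal v n"
  using pideal_add[of "x - y" n "y - z"] by simp

lemma pideal_mult_iff: "y \<noteq> 0 \<Longrightarrow> x * y \<in> pideal v n \<longleftrightarrow> x \<in> pideal v (n - v y)"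
  using val_mult[of x y] by (cases "x = 0") (auto simp: pideal_def)

lemma pideal_mult_iff': "y \<noteq> 0 \<Longrightarrow> y * x \<in> pideal v n \<longleftrightarrow> x \<in> pideal v (n - v y)"
  using pideal_mult_iff[of y x n] by (simp add: mult.commute)

lemma pideal_divide_iff: "y \<noteq> 0 \<Longrightarrow> x / y \<in> pideal v n \<longleftrightarrow> x \<in> pideal v (n + v y)"
  using pideal_mult_iff[of "inverse y" x n] val_inverse[of y] by (simp add: divide_inverse)

lemma unit_val: "x \<in> pideal v 0 \<Longrightarrow> x \<notin> pideal v 1 \<Longrightarrow> x \<noteq> 0 \<and> v x = 0"
  by (auto simp: pideal_def)

lemma one_plus_unit:
  assumes "x - 1 \<in> pideal v n" "1 \<le> n"
  shows "x \<noteq> 0" "v x = 0" "x \<in> pideal v 0"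
proof -
  have 1: "x - 1 \<in> pideal v 1" using assms pideal_mono by blast
  have "x = 1 + (x - 1)" by simp
  hence "x \<in> pideal v 0" using pideal_add[of 1 0 "x - 1"] pideal_mono[OF 1, of 0] by simp
  moreover have "x \<notin> pideal v 1"
  proof
    assume "x \<in> pideal v 1"
    hence "x - (x - 1) \<in> pideal v 1" using 1 pideal_diff by blast
    thus False by simp
  qed
  ultimately show "x \<noteq> 0" "v x = 0" "x \<in> pideal v 0" using unit_val by blast+
qed

lemma one_plus_mult:
  assumes "x - 1 \<in> pideal v n" "y - 1 \<in> pideal v n" "0 \<le> n"
  shows "x * y - 1 \<in> pideal v n"
proof -
  have "(x - 1) * (y - 1) + ((x - 1) + (y - 1)) \<in> pideal v n"
    using assms pideal_mult_le[OF assms(1,2), of n] by (intro pideal_add) simp_all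
  moreover have "x * y - 1 = (x - 1) * (y - 1) + ((x - 1) + (y - 1))" by (simp add: algebra_simps)
  ultimately show ?thesis by metis
qed

lemma pideal_all_zero: "(\<And>n. x \<in> pideal v n) \<Longrightarrow> x = 0"
  using pideal_iff[of x "v x + 1"] by fastforce

text \<open>Hensel's lemma by iterating \<open>y + (u - y^2) / 2\<close>. Dividing by 2 instead of
  2y suffices, because y stays congruent to 1 modulo p^n.\<close>

lemma square_root:
  assumes two: "(2::'a) \<noteq> 0" "v 2 = 0" and u: "u - 1 \<in> pideal v n" "1 \<le> n"
  shows "\<exists>r. r\<^sup>2 = u \<and> r - 1 \<in> pideal v n"
proof -
  define Y where "Y k = ((\<lambda>y. y + (u - y\<^sup>2) / 2) ^^ k) 1" for k
  have Y: "u - (Y k)\<^sup>2 \<in> pideal v (n + int k) \<and> Y k - 1 \<in> pideal v n" for k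
  proof (induction k)
    case 0 thus ?case using u by (simp add: Y_def)
  next
    case (Suc k)
    let ?e = "u - (Y k)\<^sup>2"
    define h where "h = ?e / 2"
    have e2: "?e = 2 * h" using two(1) by (simp add: h_def)
    have u2: "u = (Y k)\<^sup>2 + 2 * h" using e2 by (simp add: algebra_simps)
    have Y': "Y (Suc k) = Y k + h" by (simp add: Y_def h_def)
    have h: "h \<in> pideal v (n + int k)" using Suc two by (simp add: h_def pideal_divide_iff)
    \<comment> \<open>This is the next error term. Both summands gain a power of p, as
      \<open>1 - Y k\<close> lies in p^n and \<open>h\<close> in p^(n+k) with n at least 1.\<close>
    have 1: "2 * h * (1 - Y k) - h * h \<in> pideal v (n + int (Suc k))"
    proof (rule pideal_diff)
      show "2 * h * (1 - Y k) \<in> pideal v (n + int (Suc k))"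
        using Suc u(2) unfolding e2
        by (intro pideal_mult_le[of "2 * h" "n + int k" _ n]) (auto simp: pideal_commute)
      show "h * h \<in> pideal v (n + int (Suc k))"
        using h u(2) by (intro pideal_mult_le[of _ "n + int k" _ "n + int k"]) auto
    qed
    have "u - (Y (Suc k))\<^sup>2 = 2 * h * (1 - Y k) - h * h"
      unfolding Y' by (subst u2) (simp add: algebra_simps power2_eq_square)
    moreover have "(Y k - 1) + h \<in> pideal v n"
      using Suc pideal_mono[OF h, of n] by (intro pideal_add) auto
    moreover have "Y (Suc k) - 1 = (Y k - 1) + h" unfolding Y' by simp
    ultimately show ?case using 1 by metis
  qed
  have step: "Y (k + m) - Y k \<in> pideal v (n + int k)" for k m
  proof (induction m)
    case (Suc m)
    have "Y (k + Suc m) - Y (k + m) = (u - (Y (k + m))\<^sup>2) / 2" by (simp add: Y_def)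
    also have "\<dots> \<in> pideal v (n + int k)"
      using Y[of "k + m"] two pideal_mono[of _ "n + int (k + m)" "n + int k"] by (simp add: pideal_divide_iff)
    finally show ?case using Suc pideal_trans by blast
  qed simp
  have "\<exists>N. \<forall>i\<ge>N. \<forall>j\<ge>N. Y i - Y j \<in> pideal v m" for m
  proof (intro exI allI impI)
    fix i j assume ij: "nat (m - n) \<le> i" "nat (m - n) \<le> j"
    have "Y k - Y (nat (m - n)) \<in> pideal v m" if "nat (m - n) \<le> k" for k
      using step[of "nat (m - n)" "k - nat (m - n)"] that pideal_mono[of _ "n + int (nat (m - n))" m] by simp
    thus "Y i - Y j \<in> pideal v m" using ij pideal_trans pideal_commute by blast
  qed
  then obtain l where l: "\<And>m. \<exists>N. \<forall>i\<ge>N. Y i - l \<in> pideal v m" using val_complete[of Y] by blast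
  have close: "\<exists>i. int i \<ge> m \<and> Y i - l \<in> pideal v m" for m
  proof -
    obtain N where "\<forall>i\<ge>N. Y i - l \<in> pideal v m" using l by blast
    thus ?thesis by (intro exI[of _ "max N (nat m)"]) auto
  qed
  have l1: "l - 1 \<in> pideal v n"
    using close[of n] Y pideal_trans pideal_commute by blast
  have lO: "x - 1 \<in> pideal v n \<Longrightarrow> x \<in> pideal v 0" for x using one_plus_unit u(2) by blast
  have "u - l\<^sup>2 = 0"
  proof (rule pideal_all_zero)
    fix m
    obtain i where i: "int i \<ge> m" "Y i - l \<in> pideal v m" using close by blast
    have eq: "u - l\<^sup>2 = (u - (Y i)\<^sup>2) + (Y i - l) * (Y i + l)" by (simp add: algebra_simps power2_eq_square)
    have "u - (Y i)\<^sup>2 \<in> pideal v m" using Y[of i] i u(2) pideal_mono[of _ "n + int i" m] by simp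
    moreover have "Y i + l \<in> pideal v 0" using Y[of i] l1 lO pideal_add by blast
    ultimately show "u - l\<^sup>2 \<in> pideal v m" unfolding eq using i pideal_add pideal_mult_right by blast
  qed
  thus ?thesis using l1 by auto
qed

lemma two_unit:
  assumes "residue_char v \<noteq> 2"
  shows "(2::'a) \<noteq> 0" "v 2 = 0"
proof -
  have O: "(2::'a) \<in> pideal v 0" using pideal_add[of 1 0 1] by simp
  have "(2::'a) \<notin> pideal v 1"
  proof
    assume 2: "(2::'a) \<in> pideal v 1"
    have "residue_char v = 2" unfolding residue_char_def
    proof (rule Least_equality)
      show "0 < (2::nat) \<and> of_nat 2 \<in> pideal v 1" using 2 by simp
      fix n :: nat assume n: "0 < n \<and> of_nat n \<in> pideal v 1"
      hence "n \<noteq> 1" by auto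
      thus "2 \<le> n" using n by simp
    qed
    thus False using assms by simp
  qed
  thus "(2::'a) \<noteq> 0" "v 2 = 0" using O unit_val by blast+
qed

section \<open>Representatives of the residue field and sums over them\<close>

definition red :: "'a \<Rightarrow> 'a" where
  "red x = (SOME y. y \<in> {y. y - x \<in> pideal v 1})"

definition residues :: "'a set" where
  "residues = red ` pideal v 0"

lemma red_close: "red x - x \<in> pideal v 1"
  unfolding red_def using someI[of "\<lambda>y. y \<in> {y. y - x \<in> pideal v 1}" x] by simp

text \<open>The choice in \<open>red\<close> is made from the residue class as a set, so congruent
  elements receive the same representative and not merely congruent ones.\<close>

lemma red_eq_iff: "red x = red y \<longleftrightarrow> x - y \<in> pideal v 1"
proof
  show "x - y \<in> pideal v 1" if "red x = red y"
    using red_close[of x] red_close[of y] that pideal_trans pideal_commute by metis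
  assume "x - y \<in> pideal v 1"
  hence "{z. z - x \<in> pideal v 1} = {z. z - y \<in> pideal v 1}" using pideal_trans pideal_commute by blast
  thus "red x = red y" unfolding red_def by simp
qed

lemma red_red [simp]: "red (red x) = red x"
  using red_eq_iff red_close by blast

lemma red_integral: "red x \<in> pideal v 0 \<longleftrightarrow> x \<in> pideal v 0"
  using pideal_add_iff[of "red x - x" 0 x] pideal_mono[OF red_close[of x], of 0] by simp

lemma finite_residues: "finite residues"
proof -
  have "residues \<subseteq> (\<lambda>C. SOME y. y \<in> C) ` residue_classes v"
    unfolding residues_def residue_classes_def red_def by blast
  thus ?thesis using finite_residue_field finite_surj by blast
qed

lemma residues_iff: "r \<in> residues \<longleftrightarrow> r \<in> pideal v 0 \<and> red r = r"
  unfolding residues_def using red_integral by (auto simp: image_iff) metis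

lemma red_in: "x \<in> pideal v 0 \<Longrightarrow> red x \<in> residues"
  unfolding residues_def by blast

lemma residues_sum_translate:
  assumes "\<And>x y. x \<in> pideal v 0 \<Longrightarrow> y \<in> pideal v 0 \<Longrightarrow> x - y \<in> pideal v 1 \<Longrightarrow> \<phi> x = \<phi> y"
    and s: "s \<in> pideal v 0"
  shows "(\<Sum>r\<in>residues. \<phi> (r + s)) = (\<Sum>r\<in>residues. \<phi> r)"
proof (rule sum.reindex_bij_witness[where j = "\<lambda>r. red (r + s)" and i = "\<lambda>r. red (r - s)"])
  fix r assume r: "r \<in> residues"
  hence rO: "r \<in> pideal v 0" "red r = r" by (simp_all add: residues_iff)
  show "red (r + s) \<in> residues" "red (r - s) \<in> residues"
    using rO s by (auto intro: red_in pideal_add pideal_diff)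
  have "red (r + s) - s - r \<in> pideal v 1" "red (r - s) + s - r \<in> pideal v 1"
    using red_close[of "r + s"] red_close[of "r - s"] by (simp_all add: algebra_simps)
  thus "red (red (r + s) - s) = r" "red (red (r - s) + s) = r"
    using rO(2) red_eq_iff[of _ r] by metis+
  show "\<phi> (red (r + s)) = \<phi> (r + s)"
    using assms(1)[of "red (r + s)" "r + s"] red_close rO s by (simp add: red_integral pideal_add)
qed

text \<open>Expansion in powers of an element \<open>t\<close> of valuation 1, with one digit from
  \<open>residues\<close> added at each step.\<close>

lemma finite_representatives:
  "\<exists>R. finite R \<and> (\<forall>x\<in>pideal v 0. \<exists>r\<in>R. x - r \<in> pideal v (int m))"
proof (induction m)
  case 0 thus ?case by (intro exI[of _ "{0}"]) simp
next
  case (Suc m)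
  then obtain R where R: "finite R" "\<forall>x\<in>pideal v 0. \<exists>r\<in>R. x - r \<in> pideal v (int m)" by blast
  obtain t where t: "t \<noteq> 0" "v t = 1" using val_normalized by blast
  have tm: "t ^ m \<noteq> 0" "v (t ^ m) = int m" using t val_power[of t m] by simp_all
  show ?case
  proof (intro exI conjI ballI)
    show "finite ((\<lambda>(r, s). r + t ^ m * s) ` (R \<times> residues))" using R(1) finite_residues by blast
    fix x assume "x \<in> pideal v 0"
    then obtain r where r: "r \<in> R" "x - r \<in> pideal v (int m)" using R by blast
    define y where "y = (x - r) / t ^ m"
    have y: "y \<in> pideal v 0" using r tm by (simp add: y_def pideal_divide_iff)
    have "t ^ m * (y - red y) \<in> pideal v (int (Suc m))"
      using tm red_close[of y] by (simp add: pideal_mult_iff' pideal_commute)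
    moreover have "t ^ m * (y - red y) = x - (r + t ^ m * red y)"
      using tm by (simp add: y_def field_simps)
    ultimately show "\<exists>s\<in>(\<lambda>(r, s). r + t ^ m * s) ` (R \<times> residues). x - s \<in> pideal v (int (Suc m))"
      using r(1) red_in[OF y] by (intro bexI[of _ "r + t ^ m * red y"]) auto
  qed
qed

text \<open>The squares make up more than half of the residue field, so \<open>x\<^sup>2\<close> and \<open>a + e y\<^sup>2\<close> take a common value.\<close>

lemma quadratic_form_surjective:
  assumes two: "(2::'a) \<noteq> 0" "v 2 = 0" and e: "e \<noteq> 0" "v e = 0" and a: "a \<in> pideal v 0"
  shows "\<exists>x\<in>pideal v 0. \<exists>y\<in>pideal v 0. x\<^sup>2 - e * y\<^sup>2 - a \<in> pideal v 1"
proof -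
  define sq where "sq r = red (r\<^sup>2)" for r
  define A where "A = sq ` residues"
  define B where "B = (\<lambda>c. red (a + e * c)) ` A"
  have sqO: "r\<^sup>2 \<in> pideal v 0" if "r \<in> pideal v 0" for r
    using pideal_mult_left[OF that that] by (simp add: power2_eq_square)
  have A: "A \<subseteq> residues" unfolding A_def sq_def by (auto simp: residues_iff intro!: red_in sqO)
  hence B: "B \<subseteq> residues" unfolding B_def using a e
    by (force simp: residues_iff pideal_iff red_integral intro!: pideal_add pideal_mult_left)
  have finA: "finite A" using A finite_residues finite_subset by blast
  have finB: "finite B" using B finite_residues finite_subset by blast
  have "inj_on (\<lambda>c. red (a + e * c)) A"
  proof (rule inj_onI)
    fix c d assume cd: "c \<in> A" "d \<in> A" "red (a + e * c) = red (a + e * d)"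
    have "e * (c - d) \<in> pideal v 1" using cd(3) by (simp add: red_eq_iff algebra_simps)
    hence "red c = red d" using e by (simp add: pideal_mult_iff' red_eq_iff)
    moreover have "red c = c" "red d = d" using cd A residues_iff by blast+
    ultimately show "c = d" by simp
  qed
  hence cardB: "card B = card A" unfolding B_def by (rule card_image)
  have sq0: "sq (red 0) = red 0"
    using red_close[of 0] pideal_mult_le[of "red 0" 1 "red 0" 1]
    unfolding sq_def red_eq_iff by (simp add: power2_eq_square)
  hence z: "red 0 \<in> A" unfolding A_def using red_in[of 0] by force
  have eqs: "red r = red s \<or> red r = red (- s)" if "red (r\<^sup>2) = red (s\<^sup>2)" "r \<in> pideal v 0" "s \<in> pideal v 0" for r s
  proof (rule ccontr)
    assume "\<not> ?thesis"
    hence "r - s \<notin> pideal v 1" "r + s \<notin> pideal v 1" by (simp_all add: red_eq_iff)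
    moreover have "r - s \<in> pideal v 0" "r + s \<in> pideal v 0" using that pideal_add pideal_diff by blast+
    ultimately have "r - s \<noteq> 0" "v (r - s) = 0" "r + s \<noteq> 0" "v (r + s) = 0" using unit_val by blast+
    hence "(r - s) * (r + s) \<notin> pideal v 1" by (simp add: pideal_iff val_mult)
    moreover have "(r - s) * (r + s) = r\<^sup>2 - s\<^sup>2" by (simp add: algebra_simps power2_eq_square)
    ultimately show False using that(1) by (simp add: red_eq_iff)
  qed
  \<comment> \<open>By \<open>eqs\<close> a square determines its root up to sign in the residue
    field.\<close>
  have fib: "card {r \<in> residues. sq r = c} \<le> 2" for c
  proof (cases "\<exists>s\<in>residues. sq s = c")
    case True
    then obtain s where s: "s \<in> residues" "sq s = c" by blast
    have "{r \<in> residues. sq r = c} \<subseteq> {s, red (- s)}"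
    proof
      fix r assume "r \<in> {r \<in> residues. sq r = c}"
      hence r: "r \<in> residues" "sq r = c" by simp_all
      thus "r \<in> {s, red (- s)}" using s eqs[of r s] by (auto simp: sq_def residues_iff)
    qed
    hence "card {r \<in> residues. sq r = c} \<le> card {s, red (- s)}" by (intro card_mono) auto
    also have "\<dots> \<le> 2" by (simp add: card_insert_if)
    finally show ?thesis .
  next
    case False
    hence "{r \<in> residues. sq r = c} = {}" by blast
    thus ?thesis by (simp only: card.empty)
  qed
  \<comment> \<open>Zero has a single root. This one saving makes the final count strict: there are
    at most \<open>2 * card A - 1\<close> residues.\<close>
  have fib0: "{r \<in> residues. sq r = red 0} = {red 0}"
  proof -
    have "r = red 0" if "r \<in> residues" "sq r = red 0" for r
      using eqs[of r 0] that by (auto simp: sq_def residues_iff)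
    thus ?thesis using red_in[of 0] sq0 by auto
  qed
  have "residues \<subseteq> {red 0} \<union> (\<Union>c\<in>A - {red 0}. {r \<in> residues. sq r = c})"
  proof
    fix r assume r: "r \<in> residues"
    show "r \<in> {red 0} \<union> (\<Union>c\<in>A - {red 0}. {r \<in> residues. sq r = c})"
    proof (cases "sq r = red 0")
      case True
      hence "r \<in> {r \<in> residues. sq r = red 0}" using r by simp
      thus ?thesis using fib0 by simp
    next
      case False thus ?thesis using r by (simp add: A_def)
    qed
  qed
  moreover have "finite ({red 0} \<union> (\<Union>c\<in>A - {red 0}. {r \<in> residues. sq r = c}))"
    using finA finite_residues by simp
  ultimately have "card residues \<le> card ({red 0} \<union> (\<Union>c\<in>A - {red 0}. {r \<in> residues. sq r = c}))"
    by (rule card_mono[rotated])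
  also have "\<dots> \<le> card {red 0} + card (\<Union>c\<in>A - {red 0}. {r \<in> residues. sq r = c})"
    by (rule card_Un_le)
  also have "card (\<Union>c\<in>A - {red 0}. {r \<in> residues. sq r = c}) \<le> (\<Sum>c\<in>A - {red 0}. card {r \<in> residues. sq r = c})"
    using finA by (intro card_UN_le) simp
  also have "\<dots> \<le> (\<Sum>c\<in>A - {red 0}. 2)" by (intro sum_mono fib)
  also have "\<dots> = 2 * (card A - 1)" using finA z by simp
  finally have "card residues < card A + card B"
    using cardB finA z card_gt_0_iff[of A] by auto
  moreover have "card A + card B \<le> card residues" if "A \<inter> B = {}"
    using card_Un_disjoint[OF finA finB that] card_mono[OF finite_residues, of "A \<union> B"] A B by simp
  ultimately obtain c where "c \<in> A" "c \<in> B" by fastforce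
  then obtain x y where xy: "x \<in> residues" "y \<in> residues" "red (x\<^sup>2) = red (a + e * red (y\<^sup>2))"
    unfolding A_def B_def sq_def by auto
  have "x\<^sup>2 - (a + e * red (y\<^sup>2)) \<in> pideal v 1" using xy red_eq_iff by blast
  moreover have "e * (red (y\<^sup>2) - y\<^sup>2) \<in> pideal v 1" using red_close e by (simp add: pideal_mult_iff')
  ultimately have "(x\<^sup>2 - (a + e * red (y\<^sup>2))) + e * (red (y\<^sup>2) - y\<^sup>2) \<in> pideal v 1" by (rule pideal_add)
  hence "x\<^sup>2 - e * y\<^sup>2 - a \<in> pideal v 1" by (simp add: algebra_simps)
  thus ?thesis using xy by (auto simp: residues_iff)
qed

end

section \<open>The unramified quadratic extension\<close>

lemma (in unramified_quad_ext) incl_zero [simp]: "incl E 0 = 0"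
  by (metis add.right_neutral add_left_cancel incl_add)

sublocale unramified_quad_ext \<subseteq> F: nonarch_local_field "valF E"
  by (rule local_field_F)

sublocale unramified_quad_ext \<subseteq> E: nonarch_local_field "valE E"
  by (rule local_field_E)

context unramified_quad_ext
begin

abbreviation PE :: "int \<Rightarrow> 'e set" where "PE \<equiv> pideal (valE E)"
abbreviation PF :: "int \<Rightarrow> 'f set" where "PF \<equiv> pideal (valF E)"
abbreviation \<iota> :: "'f \<Rightarrow> 'e" where "\<iota> \<equiv> incl E"
abbreviation \<delta> :: 'e where "\<delta> \<equiv> rt E"
abbreviation \<epsilon> :: 'f where "\<epsilon> \<equiv> eps E"
abbreviation \<pi> :: 'f where "\<pi> \<equiv> unif E"
abbreviation bar :: "'e \<Rightarrow> 'e" where "bar \<equiv> gconj E"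

declare incl_one [simp] incl_add [simp] incl_mult [simp]

section \<open>Coordinates over F and Galois conjugation\<close>

lemma incl_minus [simp]: "\<iota> (- a) = - \<iota> a"
  using incl_add[of a "-a"] by (simp add: eq_neg_iff_add_eq_0 add.commute del: incl_add)

lemma incl_diff [simp]: "\<iota> (a - b) = \<iota> a - \<iota> b"
  using incl_add[of a "-b"] by (simp del: incl_add)

lemma incl_eq_0 [simp]: "\<iota> a = 0 \<longleftrightarrow> a = 0"
proof
  assume "\<iota> a = 0"
  hence "\<iota> (a * inverse a) = 0" by simp
  thus "a = 0" by (cases "a = 0") (simp_all del: incl_mult)
qed simp

lemma incl_eq_iff [simp]: "\<iota> a = \<iota> b \<longleftrightarrow> a = b"
  using incl_eq_0[of "a - b"] by (simp del: incl_eq_0)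

lemma inj_incl: "inj \<iota>"
  by (simp add: inj_def)

lemma incl_inverse [simp]: "\<iota> (inverse a) = inverse (\<iota> a)"
proof (cases "a = 0")
  case False
  hence "\<iota> a * \<iota> (inverse a) = 1" by (simp flip: incl_mult)
  thus ?thesis by (metis inverse_unique)
qed simp

lemma incl_divide [simp]: "\<iota> (a / b) = \<iota> a / \<iota> b"
  by (simp add: divide_inverse)

lemma incl_power [simp]: "\<iota> (a ^ n) = \<iota> a ^ n"
  by (induction n) simp_all

lemma incl_two [simp]: "\<iota> 2 = 2"
  using incl_add[of 1 1] by (simp del: incl_add)

lemma two_F: "(2::'f) \<noteq> 0" "valF E 2 = 0"
  using F.two_unit residue_char_odd by blast+

lemma two_E: "(2::'e) \<noteq> 0" "valE E 2 = 0"
  using two_F valE_incl[of 2] incl_eq_0[of 2] by (simp_all del: incl_eq_0)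

lemma rt_rt: "\<delta> * \<delta> = \<iota> \<epsilon>"
  using rt_square by (simp add: power2_eq_square)

lemma rt_nonzero [simp]: "\<delta> \<noteq> 0"
  using rt_rt eps_unit by auto

lemma eps_nonzero [simp]: "\<epsilon> \<noteq> 0"
  using eps_unit by simp

lemma unif_nonzero [simp]: "\<pi> \<noteq> 0"
  using unif by simp

lemma val_rt: "valE E \<delta> = 0"
  using E.val_mult[of \<delta> \<delta>] rt_rt valE_incl[of \<epsilon>] eps_unit by simp

text \<open>If the coefficients of \<open>\<delta>\<close> differed, \<open>\<epsilon>\<close> would
  be the square of \<open>(a - c) / (d - b)\<close>.\<close>

lemma coordinates_unique:
  assumes "\<iota> a + \<iota> b * \<delta> = \<iota> c + \<iota> d * \<delta>"
  shows "a = c \<and> b = d"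
proof -
  have e: "\<iota> (a - c) = \<iota> (d - b) * \<delta>" using assms by (simp add: algebra_simps)
  have "b = d"
  proof (rule ccontr)
    assume "b \<noteq> d"
    have "\<iota> ((a - c)\<^sup>2) = \<iota> ((d - b)\<^sup>2 * \<epsilon>)"
      using arg_cong[OF e, of "\<lambda>x. x\<^sup>2"] by (simp add: power_mult_distrib rt_square)
    hence "(a - c)\<^sup>2 = (d - b)\<^sup>2 * \<epsilon>" unfolding incl_eq_iff .
    hence "((a - c) / (d - b))\<^sup>2 = \<epsilon>" using \<open>b \<noteq> d\<close> by (simp add: power_divide)
    thus False using eps_nonsquare by blast
  qed
  thus ?thesis using assms by simp
qed

definition re :: "'e \<Rightarrow> 'f" where "re x = (SOME a. \<exists>b. x = \<iota> a + \<iota> b * \<delta>)"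
definition im :: "'e \<Rightarrow> 'f" where "im x = (SOME b. x = \<iota> (re x) + \<iota> b * \<delta>)"

lemma coordinates: "x = \<iota> (re x) + \<iota> (im x) * \<delta>"
  unfolding im_def by (rule someI_ex) (unfold re_def, rule someI_ex, rule generated)

lemma re_im_eq: "re (\<iota> a + \<iota> b * \<delta>) = a" "im (\<iota> a + \<iota> b * \<delta>) = b"
  using coordinates_unique[OF coordinates[of "\<iota> a + \<iota> b * \<delta>"]] by simp_all

lemma bar_coordinates: "bar (\<iota> a + \<iota> b * \<delta>) = \<iota> a - \<iota> b * \<delta>"
  unfolding gconj_def by (rule the_equality) (use coordinates_unique in blast)+

lemma bar_eq: "bar x = \<iota> (re x) - \<iota> (im x) * \<delta>"
  using bar_coordinates[of "re x" "im x"] coordinates[of x] by simp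

lemma bar_incl [simp]: "bar (\<iota> a) = \<iota> a"
  using bar_coordinates[of a 0] by simp

lemma bar_rt [simp]: "bar \<delta> = - \<delta>"
  using bar_coordinates[of 0 1] by simp

lemma bar_bar [simp]: "bar (bar x) = x"
  using bar_coordinates[of "re x" "- im x"] coordinates[of x] bar_eq[of x] by simp

lemma bar_add [simp]: "bar (x + y) = bar x + bar y"
proof -
  have "x + y = \<iota> (re x + re y) + \<iota> (im x + im y) * \<delta>"
    by (subst coordinates[of x], subst coordinates[of y]) (simp add: algebra_simps)
  hence "bar (x + y) = \<iota> (re x + re y) - \<iota> (im x + im y) * \<delta>" by (simp only: bar_coordinates)
  thus ?thesis unfolding bar_eq[of x] bar_eq[of y] by (simp add: algebra_simps)
qed

lemma bar_mult [simp]: "bar (x * y) = bar x * bar y"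
proof -
  have d: "a * \<delta> * (b * \<delta>) = a * b * \<iota> \<epsilon>" for a b using rt_rt by (metis mult.assoc mult.left_commute)
  have "x * y = \<iota> (re x * re y + im x * im y * \<epsilon>) + \<iota> (re x * im y + im x * re y) * \<delta>"
    by (subst coordinates[of x], subst coordinates[of y]) (simp add: algebra_simps rt_rt)
  hence "bar (x * y) = \<iota> (re x * re y + im x * im y * \<epsilon>) - \<iota> (re x * im y + im x * re y) * \<delta>"
    by (simp only: bar_coordinates)
  thus ?thesis unfolding bar_eq[of x] bar_eq[of y]
    by (simp add: left_diff_distrib right_diff_distrib distrib_left distrib_right d)
qed

lemma bar_zero [simp]: "bar 0 = 0" and bar_one [simp]: "bar 1 = 1"
  using bar_incl[of 0] bar_incl[of 1] by simp_all

lemma bar_minus [simp]: "bar (- x) = - bar x"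
  using bar_add[of x "-x"] by (simp add: eq_neg_iff_add_eq_0 add.commute del: bar_add)

lemma bar_diff [simp]: "bar (x - y) = bar x - bar y"
  using bar_add[of x "-y"] by (simp del: bar_add)

lemma bar_eq_0 [simp]: "bar x = 0 \<longleftrightarrow> x = 0"
  using bar_bar[of x] bar_zero by metis

lemma bar_inverse [simp]: "bar (inverse x) = inverse (bar x)"
proof (cases "x = 0")
  case False
  hence "bar x * bar (inverse x) = 1" by (simp flip: bar_mult)
  thus ?thesis by (metis inverse_unique)
qed simp

lemma bar_divide [simp]: "bar (x / y) = bar x / bar y"
  by (simp add: divide_inverse)

lemma bar_power [simp]: "bar (x ^ n) = bar x ^ n"
  by (induction n) simp_all

lemma bar_fixed: "bar x = x \<Longrightarrow> x = \<iota> (re x)"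
proof -
  assume "bar x = x"
  hence "\<iota> (re x) + \<iota> (im x) * \<delta> = \<iota> (re x) - \<iota> (im x) * \<delta>"
    using bar_eq[of x] coordinates[of x] by metis
  hence "2 * (\<iota> (im x) * \<delta>) = 0" by (simp add: algebra_simps)
  thus ?thesis using coordinates[of x] two_E by simp
qed

lemma bar_antifixed: "bar x = - x \<Longrightarrow> \<exists>b. x = \<delta> * \<iota> b"
proof -
  assume a: "bar x = - x"
  have "bar (x / \<delta>) = x / \<delta>" using a by simp
  hence "x / \<delta> = \<iota> (re (x / \<delta>))" by (rule bar_fixed)
  hence "x = \<delta> * \<iota> (re (x / \<delta>))" by (metis eq_divide_eq mult.commute rt_nonzero)
  thus ?thesis by blast
qed

lemma norm_coordinates: "x * bar x = \<iota> ((re x)\<^sup>2 - \<epsilon> * (im x)\<^sup>2)"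
proof -
  have "x * bar x = (\<iota> (re x) + \<iota> (im x) * \<delta>) * (\<iota> (re x) - \<iota> (im x) * \<delta>)"
    using coordinates[of x] bar_eq[of x] by metis
  also have "\<dots> = (\<iota> (re x))\<^sup>2 - (\<iota> (im x))\<^sup>2 * \<delta>\<^sup>2" by (simp add: algebra_simps power2_eq_square)
  finally show ?thesis by (simp add: rt_square mult.commute)
qed

lemma trace_half: "(x + bar x) / 2 = \<iota> (re x)"
proof -
  have "x + bar x = (\<iota> (re x) + \<iota> (im x) * \<delta>) + (\<iota> (re x) - \<iota> (im x) * \<delta>)"
    using coordinates[of x] bar_eq[of x] by metis
  hence "x + bar x = 2 * \<iota> (re x)" by simp
  thus ?thesis using two_E by simp
qed

lemma incl_PE [simp]: "\<iota> a \<in> PE n \<longleftrightarrow> a \<in> PF n"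
  using valE_incl[of a] by (cases "a = 0") (simp_all add: pideal_def)

lemma rt_mult_PE [simp]: "\<delta> * x \<in> PE n \<longleftrightarrow> x \<in> PE n" "x * \<delta> \<in> PE n \<longleftrightarrow> x \<in> PE n"
  by (simp_all add: E.pideal_mult_iff E.pideal_mult_iff' val_rt)

text \<open>If the coordinates of \<open>x\<close> had smaller valuation than \<open>x\<close>, then \<open>\<epsilon>\<close> would be a square modulo the maximal
  ideal, hence a square.\<close>

lemma coordinates_PE_step:
  assumes x: "x \<in> PE n" and ab: "re x \<in> PF m" "im x \<in> PF m" and mn: "m < n"
  shows "re x \<in> PF (m + 1) \<and> im x \<in> PF (m + 1)"
proof -
  let ?a = "re x" and ?b = "im x"
  have "bar x \<in> PE m" unfolding bar_eq[of x] using ab by (intro E.pideal_diff) simp_all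
  hence "x * bar x \<in> PE (2 * m + 1)" using x mn by (intro E.pideal_mult_le) auto
  hence N: "?a\<^sup>2 - \<epsilon> * ?b\<^sup>2 \<in> PF (2 * m + 1)" unfolding norm_coordinates by (simp only: incl_PE)
  have b: "?b \<in> PF (m + 1)"
  proof (rule ccontr)
    assume nb: "?b \<notin> PF (m + 1)"
    hence b0: "?b \<noteq> 0" by auto
    have vb: "valF E ?b = m" using nb ab b0 by (simp add: pideal_def)
    have b2: "\<epsilon> * ?b\<^sup>2 \<noteq> 0" "valF E (\<epsilon> * ?b\<^sup>2) = 2 * m"
      using b0 vb eps_unit by (simp_all add: F.val_mult F.val_power)
    have "?a\<^sup>2 / (\<epsilon> * ?b\<^sup>2) - 1 = (?a\<^sup>2 - \<epsilon> * ?b\<^sup>2) / (\<epsilon> * ?b\<^sup>2)" using b2(1) by (simp add: field_simps)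
    hence "?a\<^sup>2 / (\<epsilon> * ?b\<^sup>2) - 1 \<in> PF 1" using N b2 F.pideal_divide_iff[OF b2(1)] by (simp add: add.commute del: incl_diff)
    then obtain r where r: "r\<^sup>2 = ?a\<^sup>2 / (\<epsilon> * ?b\<^sup>2)" "r - 1 \<in> PF 1" using F.square_root two_F by blast
    have "r \<noteq> 0" using F.one_plus_unit[OF r(2)] by simp
    hence "(?a / (?b * r))\<^sup>2 = \<epsilon>" using r(1) b0 by (simp add: power_divide power_mult_distrib field_simps)
    thus False using eps_nonsquare by blast
  qed
  have "\<epsilon> * (?b * ?b) \<in> PF (2 * m + 1)"
    using F.pideal_mult_le[OF b b, of "2 * m + 1"] eps_unit by (simp add: F.pideal_mult_iff')
  hence "(?a\<^sup>2 - \<epsilon> * ?b\<^sup>2) + \<epsilon> * ?b\<^sup>2 \<in> PF (2 * m + 1)"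
    by (intro F.pideal_add[OF N]) (simp add: power2_eq_square)
  hence "?a\<^sup>2 \<in> PF (2 * m + 1)" by simp
  hence "?a \<in> PF (m + 1)" by (cases "?a = 0") (auto simp: pideal_def F.val_power)
  thus ?thesis using b by simp
qed

text \<open>Starting from an ideal that contains both coordinates for trivial reasons,
  \<open>coordinates_PE_step\<close> climbs one power of p at a time until it reaches p^n.
  Invariance of the ideals under conjugation is a consequence, so it cannot be used here.\<close>

lemma PE_coordinates: "x \<in> PE n \<longleftrightarrow> re x \<in> PF n \<and> im x \<in> PF n"
proof
  assume x: "x \<in> PE n"
  \<comment> \<open>The meaningless valuation of 0 does no harm, because a zero coordinate lies in
    every ideal.\<close>
  define m where "m = min n (min (valF E (re x)) (valF E (im x)))"
  have "re x \<in> PF (n - int k) \<and> im x \<in> PF (n - int k)" if "int k \<le> n - m" for k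
    using that
  proof (induction "nat (n - m) - k" arbitrary: k)
    case 0
    hence "n - int k = m" by simp
    thus ?case by (auto simp: m_def pideal_def)
  next
    case (Suc j)
    hence "re x \<in> PF (n - int (Suc k)) \<and> im x \<in> PF (n - int (Suc k))" by (intro Suc(1)) auto
    thus ?case using coordinates_PE_step[OF x, of "n - int (Suc k)"] by simp
  qed
  from this[of 0] show "re x \<in> PF n \<and> im x \<in> PF n" by (simp add: m_def)
next
  assume "re x \<in> PF n \<and> im x \<in> PF n"
  thus "x \<in> PE n" by (subst coordinates) (auto intro: E.pideal_add)
qed

lemma bar_PE [simp]: "bar x \<in> PE n \<longleftrightarrow> x \<in> PE n"
proof -
  have "bar x = \<iota> (re x) + \<iota> (- im x) * \<delta>" by (simp add: bar_eq)
  thus ?thesis by (metis F.pideal_minus PE_coordinates re_im_eq)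
qed

lemma val_bar [simp]: "valE E (bar x) = valE E x"
proof (cases "x = 0")
  case False
  have "n \<le> valE E (bar x) \<longleftrightarrow> n \<le> valE E x" for n
    using bar_PE[of x n] False by (simp add: pideal_def del: bar_PE)
  thus ?thesis by (metis order_antisym order_refl)
qed simp

lemma re_PF: "x \<in> PE n \<Longrightarrow> re x \<in> PF n"
  using PE_coordinates by blast

lemma re_simps [simp]: "re (\<iota> a) = a" "re (x + y) = re x + re y" "re (- x) = - re x" "re 0 = 0"
proof -
  show "re (\<iota> a) = a" for a using re_im_eq(1)[of a 0] by simp
  show "re 0 = 0" using re_im_eq(1)[of 0 0] by simp
  have "x + y = \<iota> (re x + re y) + \<iota> (im x + im y) * \<delta>" for x y
    by (subst coordinates[of x], subst coordinates[of y]) (simp add: algebra_simps)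
  thus a: "re (x + y) = re x + re y" for x y by (metis re_im_eq(1))
  show "re (- x) = - re x" for x using a[of x "-x"] \<open>re 0 = 0\<close> by (simp add: eq_neg_iff_add_eq_0 add.commute)
qed

section \<open>Elements of norm one and the image of the norm\<close>

lemma norm_one_unit: "z \<in> norm_one E \<Longrightarrow> z \<noteq> 0" "z \<in> norm_one E \<Longrightarrow> valE E z = 0" "z \<in> norm_one E \<Longrightarrow> z \<in> PE 0"
proof -
  assume z: "z \<in> norm_one E"
  hence e: "z * bar z = 1" by (simp add: norm_one_def)
  thus "z \<noteq> 0" by auto
  moreover have "valE E z = 0" using E.val_mult[of z "bar z"] e \<open>z \<noteq> 0\<close> by simp
  ultimately show "valE E z = 0" "z \<in> PE 0" by (simp_all add: pideal_def)
qed

lemma norm_one_closed: "z \<in> norm_one E \<Longrightarrow> y \<in> norm_one E \<Longrightarrow> z * y \<in> norm_one E"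
  "z \<in> norm_one E \<Longrightarrow> bar z \<in> norm_one E" "1 \<in> norm_one E"
  by (auto simp: norm_one_def mult.commute) (metis (no_types, lifting) mult.assoc mult.commute mult.right_neutral)

text \<open>Divide by a square root of the norm.\<close>

lemma norm_near_one:
  assumes "x * bar x - 1 \<in> PE n" "1 \<le> n"
  shows "\<exists>z\<in>norm_one E. x - z \<in> PE n"
proof -
  define s where "s = re (x * bar x)"
  have s: "x * bar x = \<iota> s" unfolding s_def by (rule bar_fixed) (simp add: mult.commute)
  have "\<iota> (s - 1) \<in> PE n" using assms by (simp add: s del: incl_PE)
  then obtain r where r: "r\<^sup>2 = s" "r - 1 \<in> PF n" using F.square_root two_F assms(2) by (metis incl_PE)
  note ru = F.one_plus_unit[OF r(2) assms(2)]
  define z where "z = x / \<iota> r"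
  have z: "z \<in> norm_one E"
    unfolding norm_one_def z_def using s r ru by (auto simp: power2_eq_square field_simps)
  have "x - z = z * \<iota> (r - 1)" using ru by (simp add: z_def field_simps)
  thus ?thesis using z norm_one_unit[OF z] r(2) E.pideal_mult_left[of z "\<iota> (r - 1)" n]
    by (intro bexI[of _ z]) (simp_all del: incl_diff)
qed

text \<open>In coordinates the norm is the binary form \<open>b^2 - \<epsilon> * c^2\<close>, which
  represents every residue by the counting argument over the residue field.\<close>

lemma norm_surjective:
  assumes "a \<in> PF 0"
  shows "\<exists>x\<in>PE 0. x * bar x - \<iota> a \<in> PE 1"
proof -
  obtain b c where bc: "b \<in> PF 0" "c \<in> PF 0" "b\<^sup>2 - \<epsilon> * c\<^sup>2 - a \<in> PF 1"
    using F.quadratic_form_surjective[OF two_F _ _ assms, of \<epsilon>] eps_unit by blast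
  let ?x = "\<iota> b + \<iota> c * \<delta>"
  have "?x * bar ?x - \<iota> a = \<iota> (b\<^sup>2 - \<epsilon> * c\<^sup>2 - a)" unfolding norm_coordinates re_im_eq by simp
  moreover have "?x \<in> PE 0" unfolding PE_coordinates re_im_eq using bc by simp
  ultimately show ?thesis using bc(3) by (metis incl_PE)
qed

end

section \<open>Two-by-two matrices and the unitary group\<close>

lemma mat22_nth [simp]:
  "mat22 a b c d $ 1 $ 1 = a" "mat22 a b c d $ 1 $ 2 = b"
  "mat22 a b c d $ 2 $ 1 = c" "mat22 a b c d $ 2 $ 2 = d"
  by (simp_all add: mat22_def vector_2)

lemma mat2_eq_iff: "A = B \<longleftrightarrow> A $ 1 $ 1 = B $ 1 $ 1 \<and> A $ 1 $ 2 = B $ 1 $ 2 \<and> A $ 2 $ 1 = B $ 2 $ 1 \<and> A $ 2 $ 2 = B $ 2 $ 2"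
  for A :: "'a mat2"
  by (auto simp: vec_eq_iff forall_2)

lemma mat22_eq_iff [simp]: "mat22 a b c d = mat22 a' b' c' d' \<longleftrightarrow> a = a' \<and> b = b' \<and> c = c' \<and> d = d'"
  by (simp add: mat2_eq_iff)

lemma mat22_cases [cases type]: obtains a b c d where "A = mat22 a b c d"
  using that[of "A $ 1 $ 1" "A $ 1 $ 2" "A $ 2 $ 1" "A $ 2 $ 2"] by (simp add: mat2_eq_iff)

lemma mat22_mult [simp]: "mat22 a b c d ** mat22 a' b' c' d' =
    mat22 (a * a' + b * c') (a * b' + b * d') (c * a' + d * c') (c * b' + d * d')"
  for a :: "'a::field"
  by (simp add: mat2_eq_iff matrix_matrix_mult_def sum_2)

lemma mat_mat22: "mat z = mat22 z 0 0 z"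
  by (simp add: mat2_eq_iff mat_def)

lemma transpose_mat22: "transpose (mat22 a b c d) = mat22 a c b d"
  by (simp add: mat2_eq_iff transpose_def)

lemma mat22_diff: "mat22 a b c d - mat22 a' b' c' d' = mat22 (a - a') (b - b') (c - c') (d - d')"
  for a :: "'a::field"
  by (simp add: mat2_eq_iff)

lemma matgrp_simps [simp]:
  "carrier (matgrp S) = S" "x \<otimes>\<^bsub>matgrp S\<^esub> y = x ** y" "\<one>\<^bsub>matgrp S\<^esub> = mat 1"
  by (simp_all add: matgrp_def)

context unramified_quad_ext
begin

text \<open>The adjoint with respect to the Hermitian form; it inverts the elements of the unitary group.\<close>

definition star :: "'e mat2 \<Rightarrow> 'e mat2" where
  "star g = mat22 (bar (g $ 2 $ 2)) (bar (g $ 1 $ 2)) (bar (g $ 2 $ 1)) (bar (g $ 1 $ 1))"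

lemma star_mat22 [simp]: "star (mat22 a b c d) = mat22 (bar d) (bar b) (bar c) (bar a)"
  by (simp add: star_def)

lemma star_star [simp]: "star (star g) = g"
  by (cases g) simp

lemma star_mult: "star (g ** h) = star h ** star g"
  by (simp add: star_def mat2_eq_iff matrix_matrix_mult_def sum_2 algebra_simps)

lemma star_mat [simp]: "star (mat z) = mat (bar z)"
  by (simp add: mat_mat22)

lemma U11_iff: "g \<in> U11 E \<longleftrightarrow> star g ** g = mat 1"
proof (cases g)
  case (1 a b c d)
  have "(\<chi> i j. bar (g $ i $ j)) = mat22 (bar a) (bar b) (bar c) (bar d)" by (simp add: mat2_eq_iff 1)
  thus ?thesis by (auto simp: 1 U11_def transpose_mat22 mat_mat22 algebra_simps)
qed

lemma U11_iff': "g \<in> U11 E \<longleftrightarrow> g ** star g = mat 1"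
  unfolding U11_iff by (rule matrix_left_right_inverse)

lemma U11_mult:
  assumes "g \<in> U11 E" "h \<in> U11 E"
  shows "g ** h \<in> U11 E"
proof -
  have "star (g ** h) ** (g ** h) = star h ** ((star g ** g) ** h)"
    by (simp add: star_mult matrix_mul_assoc)
  thus ?thesis using assms by (simp add: U11_iff)
qed

lemma U11_star: "g \<in> U11 E \<Longrightarrow> star g \<in> U11 E"
  using U11_iff'[of g] U11_iff[of "star g"] by simp

lemma U11_one [simp]: "mat 1 \<in> U11 E"
  by (simp add: U11_iff)

lemma group_G: "group (Ggrp E)"
proof (rule groupI)
  show "\<exists>y\<in>carrier (Ggrp E). y \<otimes>\<^bsub>Ggrp E\<^esub> x = \<one>\<^bsub>Ggrp E\<^esub>" if "x \<in> carrier (Ggrp E)" for x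
    using that U11_star U11_iff by (intro bexI[of _ "star x"]) auto
qed (auto simp: U11_mult matrix_mul_assoc)

lemma relations:
  assumes "mat22 a b c d \<in> U11 E"
  shows "bar a * d + bar c * b = 1" "bar d * a + bar b * c = 1"
    "bar a * c + bar c * a = 0" "bar b * d + bar d * b = 0"
    "a * bar d + b * bar c = 1" "d * bar a + c * bar b = 1"
    "a * bar b + b * bar a = 0" "c * bar d + d * bar c = 0"
  using assms U11_iff[of "mat22 a b c d"] U11_iff'[of "mat22 a b c d"]
  by (auto simp: mat_mat22 algebra_simps)

section \<open>Integral matrices and the maximal compact subgroup\<close>

definition integral :: "'e mat2 \<Rightarrow> bool" where
  "integral g \<longleftrightarrow> g $ 1 $ 1 \<in> PE 0 \<and> g $ 1 $ 2 \<in> PE 0 \<and> g $ 2 $ 1 \<in> PE 0 \<and> g $ 2 $ 2 \<in> PE 0"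

definition mcong :: "int \<Rightarrow> 'e mat2 \<Rightarrow> 'e mat2 \<Rightarrow> bool" where
  "mcong n g h \<longleftrightarrow> g $ 1 $ 1 - h $ 1 $ 1 \<in> PE n \<and> g $ 1 $ 2 - h $ 1 $ 2 \<in> PE n \<and>
     g $ 2 $ 1 - h $ 2 $ 1 \<in> PE n \<and> g $ 2 $ 2 - h $ 2 $ 2 \<in> PE n"

lemma maxcpt_iff: "g \<in> maxcpt E \<longleftrightarrow> g \<in> U11 E \<and> integral g"
  by (auto simp: maxcpt_def integral_def forall_2)

lemma integral_mult: "integral g \<Longrightarrow> integral h \<Longrightarrow> integral (g ** h)"
  by (cases g; cases h) (auto simp: integral_def intro!: E.pideal_add E.pideal_mult_left)

lemma integral_star: "integral g \<Longrightarrow> integral (star g)"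
  by (auto simp: integral_def star_def)

lemma maxcpt_mult: "g \<in> maxcpt E \<Longrightarrow> h \<in> maxcpt E \<Longrightarrow> g ** h \<in> maxcpt E"
  by (simp add: maxcpt_iff U11_mult integral_mult)

lemma maxcpt_star: "g \<in> maxcpt E \<Longrightarrow> star g \<in> maxcpt E"
  by (simp add: maxcpt_iff U11_star integral_star)

lemma maxcpt_U11: "g \<in> maxcpt E \<Longrightarrow> g \<in> U11 E"
  by (simp add: maxcpt_iff)

lemma maxcpt_one [simp]: "mat 1 \<in> maxcpt E"
  by (simp add: maxcpt_iff integral_def) (simp add: mat_def)

lemma maxcpt_entries:
  assumes "mat22 a b c d \<in> maxcpt E"
  shows "a \<in> PE 0" "b \<in> PE 0" "c \<in> PE 0" "d \<in> PE 0"
  using assms by (auto simp: maxcpt_iff integral_def)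

lemma star_cancel:
  assumes "g \<in> U11 E"
  shows "star g ** g = mat 1" "g ** star g = mat 1"
    "star g ** (g ** h) = h" "g ** (star g ** h) = h"
    "(h ** g) ** star g = h" "(h ** star g) ** g = h"
proof -
  show 1: "star g ** g = mat 1" "g ** star g = mat 1" using assms U11_iff U11_iff' by auto
  show "star g ** (g ** h) = h" "g ** (star g ** h) = h" using 1 by (simp_all add: matrix_mul_assoc)
  show "(h ** g) ** star g = h" "(h ** star g) ** g = h" using 1 by (simp_all flip: matrix_mul_assoc)
qed

lemma group_K: "group (Kgrp E)"
proof (rule groupI)
  show "\<exists>y\<in>carrier (Kgrp E). y \<otimes>\<^bsub>Kgrp E\<^esub> x = \<one>\<^bsub>Kgrp E\<^esub>" if "x \<in> carrier (Kgrp E)" for x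
    using that maxcpt_star star_cancel maxcpt_U11 by (intro bexI[of _ "star x"]) auto
qed (auto simp: maxcpt_mult matrix_mul_assoc)

lemma inv_K: "k \<in> maxcpt E \<Longrightarrow> inv\<^bsub>Kgrp E\<^esub> k = star k"
  using group.inv_equality[OF group_K, of "star k" k] maxcpt_star star_cancel maxcpt_U11 by simp

lemma inv_G: "k \<in> U11 E \<Longrightarrow> inv\<^bsub>Ggrp E\<^esub> k = star k"
  using group.inv_equality[OF group_G, of "star k" k] U11_star star_cancel by simp

lemma mcong_mult_left: "integral k \<Longrightarrow> mcong n g h \<Longrightarrow> mcong n (k ** g) (k ** h)"
proof (cases k; cases g; cases h)
  fix a b c d a' b' c' d' a'' b'' c'' d''
  assume *: "k = mat22 a b c d" "g = mat22 a' b' c' d'" "h = mat22 a'' b'' c'' d''"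
    and "integral k" "mcong n g h"
  hence m: "x * (a' - a'') + y * (c' - c'') \<in> PE n" "x * (b' - b'') + y * (d' - d'') \<in> PE n"
    if "x \<in> PE 0" "y \<in> PE 0" for x y
    using that by (auto simp: integral_def mcong_def intro!: E.pideal_add E.pideal_mult_left)
  have "a \<in> PE 0" "b \<in> PE 0" "c \<in> PE 0" "d \<in> PE 0" using * \<open>integral k\<close> by (auto simp: integral_def)
  thus ?thesis using m[of a b] m[of c d] by (simp add: mcong_def * algebra_simps)
qed

lemma mcong_star: "mcong n g h \<Longrightarrow> mcong n (star g) (star h)"
  by (auto simp: mcong_def star_def simp flip: bar_diff)

lemma mcong_mult_right: "integral k \<Longrightarrow> mcong n g h \<Longrightarrow> mcong n (g ** k) (h ** k)"
  using mcong_star[OF mcong_mult_left[OF integral_star[of k] mcong_star]]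
  by (simp add: star_mult)

lemma mcong_refl [simp]: "mcong n g g"
  by (simp add: mcong_def)

lemma mcong_trans: "mcong n g h \<Longrightarrow> mcong n h k \<Longrightarrow> mcong n g k"
  unfolding mcong_def using E.pideal_trans by blast

lemma mcong_mono: "mcong n g h \<Longrightarrow> m \<le> n \<Longrightarrow> mcong m g h"
  unfolding mcong_def using E.pideal_mono by blast

section \<open>Congruence subgroups, their normality and finite index\<close>

definition congruence_subgroup :: "nat \<Rightarrow> 'e mat2 set" where
  "congruence_subgroup m = {k \<in> maxcpt E. mcong (int m) k (mat 1)}"

lemma maxcpt_plus_eq: "maxcpt_plus E = congruence_subgroup 1"
  by (auto simp: maxcpt_plus_def congruence_subgroup_def mcong_def forall_2)

lemma congruence_subgroup_normal: "congruence_subgroup m \<lhd> Kgrp E"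
proof (rule group.normal_invI[OF group_K])
  have conj: "g ** h ** star g \<in> congruence_subgroup m" if "g \<in> maxcpt E" "h \<in> congruence_subgroup m" for g h
  proof -
    have "mcong (int m) (g ** h ** star g) (g ** mat 1 ** star g)"
      using that by (intro mcong_mult_left mcong_mult_right)
        (auto simp: congruence_subgroup_def maxcpt_iff integral_star)
    thus ?thesis using that
      by (simp add: congruence_subgroup_def maxcpt_mult maxcpt_star star_cancel maxcpt_U11)
  qed
  show "x \<otimes>\<^bsub>Kgrp E\<^esub> h \<otimes>\<^bsub>Kgrp E\<^esub> inv\<^bsub>Kgrp E\<^esub> x \<in> congruence_subgroup m"
    if "x \<in> carrier (Kgrp E)" "h \<in> congruence_subgroup m" for x h
    using that conj by (simp add: inv_K)
  show "subgroup (congruence_subgroup m) (Kgrp E)"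
  proof (rule group.subgroupI[OF group_K])
    show "congruence_subgroup m \<subseteq> carrier (Kgrp E)" by (auto simp: congruence_subgroup_def)
    have "mat 1 \<in> congruence_subgroup m" by (simp add: congruence_subgroup_def)
    thus "congruence_subgroup m \<noteq> {}" by blast
    fix g assume g: "g \<in> congruence_subgroup m"
    show "inv\<^bsub>Kgrp E\<^esub> g \<in> congruence_subgroup m"
      using g mcong_star[of "int m" g "mat 1"] by (simp add: congruence_subgroup_def inv_K maxcpt_star)
    fix h assume h: "h \<in> congruence_subgroup m"
    have "mcong (int m) (g ** h) (g ** mat 1)"
      using g h by (intro mcong_mult_left) (auto simp: congruence_subgroup_def maxcpt_iff)
    thus "g \<otimes>\<^bsub>Kgrp E\<^esub> h \<in> congruence_subgroup m"
      using g h mcong_trans[of "int m" "g ** h" g "mat 1"] by (simp add: congruence_subgroup_def maxcpt_mult)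
  qed
qed

lemma congruence_coset:
  assumes "g \<in> maxcpt E" "h \<in> maxcpt E"
  shows "congruence_subgroup m #>\<^bsub>Kgrp E\<^esub> g = congruence_subgroup m #>\<^bsub>Kgrp E\<^esub> h \<longleftrightarrow> mcong (int m) g h"
proof -
  interpret normal "congruence_subgroup m" "Kgrp E" by (rule congruence_subgroup_normal)
  have eq: "g ** star h \<in> congruence_subgroup m \<longleftrightarrow> mcong (int m) g h"
  proof
    assume "g ** star h \<in> congruence_subgroup m"
    hence "mcong (int m) (g ** star h ** h) (mat 1 ** h)"
      using assms by (intro mcong_mult_right) (auto simp: congruence_subgroup_def maxcpt_iff)
    thus "mcong (int m) g h" using assms by (simp add: star_cancel maxcpt_U11)
  next
    assume "mcong (int m) g h"
    hence "mcong (int m) (g ** star h) (h ** star h)"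
      using assms by (intro mcong_mult_right) (auto simp: maxcpt_iff integral_star)
    thus "g ** star h \<in> congruence_subgroup m"
      using assms by (simp add: congruence_subgroup_def maxcpt_mult maxcpt_star star_cancel maxcpt_U11)
  qed
  show ?thesis
  proof
    assume "congruence_subgroup m #>\<^bsub>Kgrp E\<^esub> g = congruence_subgroup m #>\<^bsub>Kgrp E\<^esub> h"
    moreover have "g \<in> congruence_subgroup m #>\<^bsub>Kgrp E\<^esub> g" using rcos_self[OF _ subgroup_axioms, of g] assms by simp
    ultimately obtain n where n: "n \<in> congruence_subgroup m" "g = n ** h" by (auto simp: r_coset_def)
    hence "g ** star h = n" using assms by (simp add: star_cancel maxcpt_U11)
    thus "mcong (int m) g h" using n eq by simp
  next
    assume "mcong (int m) g h"
    hence n: "g ** star h \<in> congruence_subgroup m" using eq by simp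
    have "g = (g ** star h) ** h" using assms by (simp add: star_cancel maxcpt_U11)
    hence "g \<in> congruence_subgroup m #>\<^bsub>Kgrp E\<^esub> h" using n by (auto simp: r_coset_def)
    thus "congruence_subgroup m #>\<^bsub>Kgrp E\<^esub> g = congruence_subgroup m #>\<^bsub>Kgrp E\<^esub> h"
      using repr_independence[OF _ _ subgroup_axioms] assms by (metis matgrp_simps(1))
  qed
qed

text \<open>A coset is determined by the classes of the four entries modulo p^m, and these range
  over a finite set.\<close>

lemma congruence_finite_index: "finite_index_normal (congruence_subgroup m) (Kgrp E)"
proof -
  interpret normal "congruence_subgroup m" "Kgrp E" by (rule congruence_subgroup_normal)
  obtain R where R: "finite R" "\<forall>x\<in>PE 0. \<exists>r\<in>R. x - r \<in> PE (int m)"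
    using E.finite_representatives by blast
  then obtain r where r: "\<And>x. x \<in> PE 0 \<Longrightarrow> r x \<in> R" "\<And>x. x \<in> PE 0 \<Longrightarrow> x - r x \<in> PE (int m)" by metis
  define t where "t g = (r (g $ 1 $ 1), r (g $ 1 $ 2), r (g $ 2 $ 1), r (g $ 2 $ 2))" for g :: "'e mat2"
  have same: "x - y \<in> PE (int m)" if "r x = r y" "x \<in> PE 0" "y \<in> PE 0" for x y
    using r(2)[of x] r(2)[of y] that E.pideal_trans E.pideal_commute by metis
  have t: "mcong (int m) g h" if "t g = t h" "g \<in> maxcpt E" "h \<in> maxcpt E" for g h :: "'e mat2"
    using that same by (auto simp: t_def mcong_def maxcpt_iff integral_def)
  have "rcosets\<^bsub>Kgrp E\<^esub> congruence_subgroup m \<subseteq>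
      (\<lambda>u. congruence_subgroup m #>\<^bsub>Kgrp E\<^esub> (SOME g. g \<in> maxcpt E \<and> t g = u)) ` (R \<times> R \<times> R \<times> R)"
  proof
    fix C assume "C \<in> rcosets\<^bsub>Kgrp E\<^esub> congruence_subgroup m"
    then obtain g where g: "g \<in> maxcpt E" "C = congruence_subgroup m #>\<^bsub>Kgrp E\<^esub> g"
      by (auto simp: RCOSETS_def)
    define h where "h = (SOME h. h \<in> maxcpt E \<and> t h = t g)"
    have h: "h \<in> maxcpt E \<and> t h = t g" unfolding h_def by (rule someI[of _ g]) (use g in simp)
    have "t g \<in> R \<times> R \<times> R \<times> R" using g r by (simp add: t_def maxcpt_iff integral_def)
    moreover have "C = congruence_subgroup m #>\<^bsub>Kgrp E\<^esub> h"
      using g h t congruence_coset by metis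
    ultimately show "C \<in> (\<lambda>u. congruence_subgroup m #>\<^bsub>Kgrp E\<^esub> (SOME g. g \<in> maxcpt E \<and> t g = u)) ` (R \<times> R \<times> R \<times> R)"
      unfolding h_def by (intro image_eqI[where x = "t g"])
  qed
  hence "finite (rcosets\<^bsub>Kgrp E\<^esub> congruence_subgroup m)"
    by (rule finite_subset) (use R in simp)
  thus ?thesis by unfold_locales
qed

end

section \<open>The inducing characters\<close>

text \<open>Only the properties of \<open>\<theta>\<close> that the central character of a
  depth-zero representation has are recorded, so that the study of \<open>S_rep\<close> does not
  refer to \<open>\<sigma>\<close>.\<close>

locale central_character_data = unramified_quad_ext E
  for E :: "('f::field, 'e::field) quad_ext" +
  fixes \<psi>' :: "'f \<Rightarrow> complex" and \<theta> :: "'e \<Rightarrow> complex"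
  assumes level_one: "level_one_character E \<psi>'"
    and \<theta>_mult: "z \<in> norm_one E \<Longrightarrow> y \<in> norm_one E \<Longrightarrow> \<theta> (z * y) = \<theta> z * \<theta> y"
    and \<theta>_trivial: "z \<in> norm_one E \<Longrightarrow> z - 1 \<in> PE 1 \<Longrightarrow> \<theta> z = 1"
begin

abbreviation \<psi> :: "'e \<Rightarrow> complex" where "\<psi> \<equiv> psiE E \<psi>'"

lemma psi'_add: "\<psi>' (x + y) = \<psi>' x * \<psi>' y" and psi'_nonzero [simp]: "\<psi>' x \<noteq> 0"
  and psi'_trivial: "x \<in> PF 1 \<Longrightarrow> \<psi>' x = 1"
  using level_one by (auto simp: level_one_character_def)

lemma psi'_zero [simp]: "\<psi>' 0 = 1"
  by (simp add: psi'_trivial)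

lemma psi_eq: "\<psi> x = \<psi>' (re x)"
  unfolding psiE_def trace_half by (simp add: inv_into_f_f inj_incl)

lemma psi_incl [simp]: "\<psi> (\<iota> a) = \<psi>' a"
  by (simp add: psi_eq)

lemma psi_add: "\<psi> (x + y) = \<psi> x * \<psi> y" and psi_nonzero [simp]: "\<psi> x \<noteq> 0"
  and psi_trivial: "x \<in> PE 1 \<Longrightarrow> \<psi> x = 1"
  by (simp_all add: psi_eq psi'_add psi'_trivial re_PF)

lemma psi_cong: "x - y \<in> PE 1 \<Longrightarrow> \<psi> x = \<psi> y"
  using psi_add[of "x - y" y] psi_trivial[of "x - y"] by simp

lemma theta_one [simp]: "\<theta> 1 = 1"
  using \<theta>_trivial[of 1] norm_one_closed(3) by simp

lemma theta_nonzero: "z \<in> norm_one E \<Longrightarrow> \<theta> z \<noteq> 0"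
  using \<theta>_mult[of z "bar z"] norm_one_closed(2)[of z] by (auto simp: norm_one_def)

lemma theta_cong:
  assumes "z \<in> norm_one E" "y \<in> norm_one E" "z - y \<in> PE 1"
  shows "\<theta> z = \<theta> y"
proof -
  have b: "bar y \<in> norm_one E" "y * bar y = 1" using assms norm_one_closed by (auto simp: norm_one_def)
  have "bar y * z - 1 = bar y * (z - y)" using b by (simp add: algebra_simps)
  hence "bar y * z - 1 \<in> PE 1" using assms(3) norm_one_unit(3)[OF b(1)] by (simp add: E.pideal_mult_left del: bar_mult)
  hence "\<theta> (bar y * z) = 1" using assms b norm_one_closed by (intro \<theta>_trivial) auto
  moreover have "\<theta> (y * (bar y * z)) = \<theta> y * \<theta> (bar y * z)"
    using assms b norm_one_closed by (intro \<theta>_mult) auto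
  moreover have "y * (bar y * z) = z" using b by (simp flip: mult.assoc)
  ultimately show ?thesis by simp
qed

text \<open>Extension of \<open>\<theta>\<close> by 1 on 1 + p to the elements whose norm is 1
  modulo p. The diagonal entries of the inducing groups are only congruent to elements of E^1; by
  \<open>theta_cong\<close> the choice among these does not matter.\<close>

definition \<theta>_ext :: "'e \<Rightarrow> complex" where
  "\<theta>_ext a = \<theta> (SOME z. z \<in> norm_one E \<and> a - z \<in> PE 1)"

lemma theta_ext_eq:
  assumes "z \<in> norm_one E" "a - z \<in> PE 1"
  shows "\<theta>_ext a = \<theta> z"
proof -
  have "(SOME z. z \<in> norm_one E \<and> a - z \<in> PE 1) \<in> norm_one E \<and> a - (SOME z. z \<in> norm_one E \<and> a - z \<in> PE 1) \<in> PE 1"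
    by (rule someI[of _ z]) (use assms in simp)
  thus ?thesis unfolding \<theta>_ext_def using assms E.pideal_trans E.pideal_commute
    by (intro theta_cong) blast+
qed

lemma theta_ext_one_plus: "a - 1 \<in> PE 1 \<Longrightarrow> \<theta>_ext a = 1"
  using theta_ext_eq[of 1 a] norm_one_closed(3) by simp

lemma theta_ext_cong:
  assumes "a * bar a - 1 \<in> PE 1" "a - b \<in> PE 1"
  shows "\<theta>_ext a = \<theta>_ext b"
proof -
  obtain z where z: "z \<in> norm_one E" "a - z \<in> PE 1" using norm_near_one[OF assms(1)] by auto
  thus ?thesis using theta_ext_eq[OF z] theta_ext_eq[OF z(1), of b] assms(2) E.pideal_trans E.pideal_commute by metis
qed

lemma theta_ext_mult:
  assumes "a * bar a - 1 \<in> PE 1" "b * bar b - 1 \<in> PE 1"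
  shows "\<theta>_ext (a * b) = \<theta>_ext a * \<theta>_ext b"
proof -
  obtain z where z: "z \<in> norm_one E" "a - z \<in> PE 1" using norm_near_one[OF assms(1)] by auto
  obtain y where y: "y \<in> norm_one E" "b - y \<in> PE 1" using norm_near_one[OF assms(2)] by auto
  have zb: "z \<in> PE 0" "y \<in> PE 0" using z y norm_one_unit by auto
  hence b: "b \<in> PE 0" using E.pideal_add[of "b - y" 0 y] E.pideal_mono[OF y(2), of 0] by simp
  have "(a - z) * b + z * (b - y) \<in> PE 1"
    using z y zb b by (intro E.pideal_add E.pideal_mult_left E.pideal_mult_right)
  hence "a * b - z * y \<in> PE 1" by (simp add: algebra_simps)
  thus ?thesis using theta_ext_eq[OF z] theta_ext_eq[OF y] theta_ext_eq[of "z * y" "a * b"] z y norm_one_closed \<theta>_mult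
    by simp
qed

text \<open>The nonzero entry of \<open>Xmat E d\<close>, so that \<open>\<kappa> d * k21\<close> is
  the trace that defines the character on \<open>Jgrp E d\<close>.\<close>

definition \<kappa> :: "nat \<Rightarrow> 'e" where
  "\<kappa> d = \<iota> (1 / \<pi> ^ d) * \<delta>"

text \<open>
  On \<open>Dgrp i j\<close> with \<open>i + j = d + 1\<close> the entry \<open>k11\<close> is congruent to some \<open>z \<in> E^1\<close> modulo \<open>p^i\<close>; dividing by \<open>k11\<close>
  instead of \<open>z\<close> makes the formula for the character independent of \<open>i\<close>. The group \<open>ZUJ E d\<close> is the case \<open>i = \<lceil>d/2\<rceil>\<close>.
\<close>

definition Omega :: "nat \<Rightarrow> 'e mat2 \<Rightarrow> complex" where
  "Omega d k = \<theta>_ext (k $ 1 $ 1) * \<psi> (\<kappa> d * (k $ 2 $ 1 / k $ 1 $ 1))"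

definition Dgrp :: "nat \<Rightarrow> nat \<Rightarrow> 'e mat2 set" where
  "Dgrp i j = {k \<in> maxcpt E. k $ 1 $ 1 * bar (k $ 1 $ 1) - 1 \<in> PE (int i) \<and> k $ 2 $ 1 \<in> PE (int j)}"

lemma val_unif_power: "valF E (\<pi> ^ d) = int d"
  using F.val_power[of \<pi> d] unif by simp

lemma scaled_PE: "\<kappa> d * x \<in> PE 1 \<longleftrightarrow> x \<in> PE (int d + 1)"
proof -
  have "\<kappa> d \<noteq> 0" "valE E (\<kappa> d) = - int d"
    using val_unif_power[of d]
    by (simp_all add: \<kappa>_def E.val_mult val_rt valE_incl F.val_divide del: incl_divide incl_power)
  thus ?thesis using E.pideal_mult_iff'[of "\<kappa> d" x 1] by (simp add: add.commute)
qed

lemma kappa_rt: "\<kappa> d * (\<delta> * \<iota> x) = \<iota> (\<epsilon> * x / \<pi> ^ d)"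
proof -
  have "\<kappa> d * (\<delta> * \<iota> x) = (\<delta> * \<delta>) * \<iota> (x / \<pi> ^ d)" by (simp add: \<kappa>_def)
  thus ?thesis unfolding rt_rt by simp
qed

lemma psi_scaled_cong:
  "x - y \<in> PE (int d + 1) \<Longrightarrow> \<psi> (\<kappa> d * x) = \<psi> (\<kappa> d * y)"
  by (rule psi_cong) (simp only: scaled_PE flip: right_diff_distrib)

lemma quotient_cong:
  assumes "c \<in> PE n" "a \<noteq> 0" "valE E a = 0" "a - a' \<in> PE m" "1 \<le> m"
  shows "c / a - c / a' \<in> PE (n + m)"
proof -
  have a1: "a \<notin> PE 1" "a \<in> PE 0" using assms by (simp_all add: pideal_def)
  have "a' \<notin> PE 1" using E.pideal_add[of "a - a'" 1 a'] E.pideal_mono[OF assms(4,5)] a1 by auto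
  moreover have "a' \<in> PE 0" using E.pideal_diff[OF a1(2) E.pideal_mono[OF assms(4), of 0]] assms(5) by simp
  ultimately have a': "a' \<noteq> 0" "valE E a' = 0" using E.unit_val by blast+
  have "c / a - c / a' = - (c * (a - a')) / (a * a')" using assms(2) a' by (simp add: field_simps)
  moreover have "c * (a - a') \<in> PE (n + m)" using assms E.pideal_mult by blast
  ultimately show ?thesis using assms a' by (simp add: E.pideal_divide_iff E.val_mult del: minus_mult_right)
qed

text \<open>Unitarity makes \<open>bar a * e\<close> congruent to 1 modulo p^j. Comparison with
  \<open>a * bar a\<close>, which is 1 modulo p^i, forces e to be close to a; here i at most j lets
  both congruences be used modulo p^i.\<close>

lemma Dgrp_entries:
  assumes k: "mat22 a b c e \<in> Dgrp i j" and ij: "1 \<le> i" "i \<le> j"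
  shows "a \<noteq> 0" "valE E a = 0" "a * bar a - 1 \<in> PE (int i)" "a * bar a - 1 \<in> PE 1" "c \<in> PE (int j)"
    "bar a * e - 1 \<in> PE (int j)" "e - a \<in> PE (int i)" "e * bar e - 1 \<in> PE (int i)"
    "a \<in> PE 0" "b \<in> PE 0" "c \<in> PE 0" "e \<in> PE 0"
proof -
  have K: "mat22 a b c e \<in> maxcpt E" using k by (simp add: Dgrp_def)
  note r = relations[OF maxcpt_U11[OF K]]
  show O: "a \<in> PE 0" "b \<in> PE 0" "c \<in> PE 0" "e \<in> PE 0" using maxcpt_entries[OF K] by auto
  show N: "a * bar a - 1 \<in> PE (int i)" and c: "c \<in> PE (int j)" using k by (auto simp: Dgrp_def)
  show N1: "a * bar a - 1 \<in> PE 1" using E.pideal_mono[OF N] ij by simp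
  have "a * bar a \<noteq> 0" "valE E (a * bar a) = 0" using E.one_plus_unit[OF N1] by auto
  thus a: "a \<noteq> 0" "valE E a = 0" using E.val_mult[of a "bar a"] by auto
  have "bar a * e - 1 = - (bar c * b)" using r(1) by (simp add: algebra_simps)
  thus ae: "bar a * e - 1 \<in> PE (int j)" using O c by (simp add: E.pideal_mult_right)
  have "(bar a * e - 1) - (a * bar a - 1) \<in> PE (int i)"
    by (rule E.pideal_diff[OF E.pideal_mono[OF ae] N]) (use ij in simp)
  hence "bar a * (e - a) \<in> PE (int i)" by (simp add: algebra_simps)
  thus ea: "e - a \<in> PE (int i)" using a by (simp add: E.pideal_mult_iff')
  have "(e - a) * bar e + a * bar (e - a) + (a * bar a - 1) \<in> PE (int i)"
    using ea O N by (intro E.pideal_add E.pideal_mult_right[OF ea] E.pideal_mult_left) (auto simp del: bar_diff)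
  thus "e * bar e - 1 \<in> PE (int i)" by (simp add: algebra_simps)
qed

lemma Dgrp_subgroup:
  assumes ij: "1 \<le> i" "i \<le> j"
  shows "subgroup (Dgrp i j) (Kgrp E)"
proof (rule group.subgroupI[OF group_K])
  show "Dgrp i j \<subseteq> carrier (Kgrp E)" by (auto simp: Dgrp_def)
  have "mat 1 \<in> Dgrp i j" by (simp add: Dgrp_def) (simp add: mat_mat22)
  thus "Dgrp i j \<noteq> {}" by blast
  fix g assume g: "g \<in> Dgrp i j"
  obtain a b c e where ge: "g = mat22 a b c e" by (cases g)
  note G = Dgrp_entries[OF g[unfolded ge] ij]
  show "inv\<^bsub>Kgrp E\<^esub> g \<in> Dgrp i j"
    using g G maxcpt_star[of g] by (simp add: Dgrp_def inv_K) (simp add: ge mult.commute)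
  fix h assume h: "h \<in> Dgrp i j"
  obtain a' b' c' e' where he: "h = mat22 a' b' c' e'" by (cases h)
  note H = Dgrp_entries[OF h[unfolded he] ij]
  have bc: "b * c' \<in> PE (int i)" using G H ij E.pideal_mono[OF H(5), of "int i"] by (intro E.pideal_mult_left) auto
  have N: "(a * bar a) * (a' * bar a') - 1 \<in> PE (int i)" using E.one_plus_mult[OF G(3) H(3)] by simp
  have "((a * bar a) * (a' * bar a') - 1) + ((a * a' + b * c') * bar (b * c') + (b * c') * bar (a * a')) \<in> PE (int i)"
    using G H bc by (intro E.pideal_add[OF N] E.pideal_add E.pideal_mult_left E.pideal_mult_right[OF bc])
      (auto intro!: E.pideal_add E.pideal_mult_left simp del: bar_mult simp: bar_mult[of a a'])
  hence "(a * a' + b * c') * bar (a * a' + b * c') - 1 \<in> PE (int i)" by (simp add: algebra_simps)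
  moreover have "c * a' + e * c' \<in> PE (int j)"
    using G H by (intro E.pideal_add E.pideal_mult_left E.pideal_mult_right) auto
  ultimately show "g \<otimes>\<^bsub>Kgrp E\<^esub> h \<in> Dgrp i j"
    using g h by (simp add: Dgrp_def maxcpt_mult) (simp add: ge he)
qed

text \<open>The quotient \<open>k21 / k11\<close> is additive modulo p^(d+1), where the character no
  longer sees it. Dropping \<open>b * c'\<close> from the denominator costs an error in p^(2j), and
  replacing e by a in the numerator an error in p^(i+j); both ideals lie in p^(d+1) because i + j =
  d + 1 and i is at most j.\<close>

lemma Omega_mult:
  assumes ij: "1 \<le> i" "i \<le> j" "i + j = d + 1" and g: "g \<in> Dgrp i j" and h: "h \<in> Dgrp i j"
  shows "Omega d (g ** h) = Omega d g * Omega d h"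
proof -
  obtain a b c e where ge: "g = mat22 a b c e" by (cases g)
  obtain a' b' c' e' where he: "h = mat22 a' b' c' e'" by (cases h)
  note G = Dgrp_entries[OF g[unfolded ge] ij(1,2)] and H = Dgrp_entries[OF h[unfolded he] ij(1,2)]
  have bc: "b * c' \<in> PE (int j)" using G H by (intro E.pideal_mult_left) auto
  have aa: "a * a' \<noteq> 0" "valE E (a * a') = 0" using G H by (simp_all add: E.val_mult)
  have N: "(a * a') * bar (a * a') - 1 \<in> PE 1"
    using E.one_plus_mult[OF G(4) H(4)] by (simp add: algebra_simps)
  have "\<theta>_ext (a * a') = \<theta>_ext (a * a' + b * c')"
    using bc ij E.pideal_mono[OF bc, of 1] by (intro theta_ext_cong[OF N]) simp
  moreover have "\<theta>_ext (a * a') = \<theta>_ext a * \<theta>_ext a'" using G H by (intro theta_ext_mult) auto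
  moreover have "(c * a' + e * c') / (a * a' + b * c') - (c / a + c' / a') \<in> PE (int d + 1)"
  proof -
    have c2: "c * a' + e * c' \<in> PE (int j)"
      using G H by (intro E.pideal_add E.pideal_mult_left E.pideal_mult_right) auto
    have "(c * a' + e * c') / (a * a') - (c * a' + e * c') / (a * a' + b * c') \<in> PE (int j + int j)"
      using bc ij by (intro quotient_cong[OF c2 aa]) auto
    hence 1: "(c * a' + e * c') / (a * a' + b * c') - (c * a' + e * c') / (a * a') \<in> PE (int d + 1)"
      using ij E.pideal_mono[of _ "int j + int j" "int d + 1"] by (simp add: E.pideal_commute)
    have "(e - a) * c' / (a * a') \<in> PE (int d + 1)"
      using aa(2) ij E.pideal_mult_le[OF G(7) H(5), of "int d + 1"]
        E.pideal_divide_iff[OF aa(1), of "(e - a) * c'" "int d + 1"] by simp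
    moreover have "(e - a) * c' / (a * a') = (c * a' + e * c') / (a * a') - (c / a + c' / a')"
      using aa by (simp add: field_simps)
    ultimately show ?thesis using E.pideal_trans[OF 1] by metis
  qed
  hence "\<psi> (\<kappa> d * ((c * a' + e * c') / (a * a' + b * c'))) =
      \<psi> (\<kappa> d * (c / a + c' / a'))" by (rule psi_scaled_cong)
  ultimately show ?thesis unfolding Omega_def ge he mat22_mult mat22_nth
    by (simp only: distrib_left psi_add) simp
qed

text \<open>The bound on m + n ensures that replacing \<open>k11\<close> by 1 changes the quotient
  only within p^(d+1). This gives back the formula in terms of the trace with
  \<open>Xmat\<close>.\<close>

lemma Omega_one_plus:
  assumes "k $ 1 $ 1 - 1 \<in> PE n" "1 \<le> n" "k $ 2 $ 1 \<in> PE m" "int d + 1 \<le> m + n"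
  shows "Omega d k = \<psi> (\<kappa> d * (k $ 2 $ 1))"
proof -
  note u = E.one_plus_unit[OF assms(1,2)]
  have "k $ 2 $ 1 / k $ 1 $ 1 - k $ 2 $ 1 / 1 \<in> PE (m + n)" using u assms by (intro quotient_cong) auto
  hence "k $ 2 $ 1 / k $ 1 $ 1 - k $ 2 $ 1 \<in> PE (int d + 1)" using E.pideal_mono assms(4) by simp
  from psi_scaled_cong[OF this] show ?thesis
    using theta_ext_one_plus[OF E.pideal_mono[OF assms(1,2)]] unfolding Omega_def by simp
qed

lemma level_one_witness:
  obtains x0 where "x0 \<in> PF 0" "\<psi>' x0 \<noteq> 1"
  using level_one by (auto simp: level_one_character_def)

text \<open>An element normalizing the character is tested first against lower unipotent, then against diagonal matrices.\<close>

lemma Omega_intertwining: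
  assumes ij: "1 \<le> i" "i \<le> j" "i + j = d + 1" and k: "k \<in> maxcpt E"
    and fixed: "\<And>h. h \<in> Dgrp i j \<Longrightarrow> k ** h ** star k \<in> Dgrp i j \<Longrightarrow> Omega d (k ** h ** star k) = Omega d h"
  shows "k \<in> Dgrp i j"
proof -
  obtain a b c e where ke: "k = mat22 a b c e" by (cases k)
  note O = maxcpt_entries[OF k[unfolded ke]] and r = relations[OF maxcpt_U11[OF k[unfolded ke]]]
  obtain x0 where x0: "x0 \<in> PF 0" "\<psi>' x0 \<noteq> 1" by (rule level_one_witness)
  \<comment> \<open>Test parameters are obtained by dividing by an element y that violates a
    congruence. If y is not in p^n, the quotient still lies in p^(d+1-n), which for n = i or n = j
    is the ideal with the other exponent.\<close>
  have small: "x0 * \<pi> ^ d / y \<in> PF (int d + 1 - n)" if "y \<noteq> 0" "y \<notin> PF n" for y n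
  proof -
    have "x0 * \<pi> ^ d \<in> PF (int d)" using x0 val_unif_power[of d] by (simp add: F.pideal_mult_iff)
    moreover have "valF E y \<le> n - 1" using that by (simp add: pideal_def)
    ultimately show ?thesis using that F.pideal_mono[of _ "int d" "int d + 1 - n + valF E y"] by (simp add: F.pideal_divide_iff)
  qed
  have ijd: "int d + 1 - int i = int j" "int d + 1 - int j = int i" "int d + 1 \<le> int j + int j"
    "int d + 1 \<le> int d + int i" using ij by simp_all
  define n where "n = re (e * bar e)"
  have n: "e * bar e = \<iota> n" unfolding n_def by (rule bar_fixed) (simp add: mult.commute)
  have n1: "n - 1 \<in> PF (int i)"
  proof (rule ccontr)
    assume bad: "n - 1 \<notin> PF (int i)"
    hence n0: "n - 1 \<noteq> 0" by auto
    \<comment> \<open>Conjugation by k multiplies the parameter of a lower unipotent by the norm n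
      of e. This s makes the resulting change in the argument of \<open>\<psi>'\<close> equal to x0,
      on which \<open>\<psi>'\<close> is nontrivial.\<close>
    define s where "s = x0 * \<pi> ^ d / (\<epsilon> * (n - 1))"
    have sj: "s \<in> PF (int j)"
      using small[of "\<epsilon> * (n - 1)" "int i"] bad n0 eps_unit by (simp add: s_def F.pideal_mult_iff' ijd)
    hence sj': "\<delta> * \<iota> s \<in> PE (int j)" by simp
    define h where "h = mat22 1 0 (\<delta> * \<iota> s) 1"
    have hU: "h \<in> U11 E" unfolding U11_iff h_def by (simp add: mat_mat22)
    have hK: "h \<in> maxcpt E" using hU F.pideal_mono[OF sj, of 0] by (simp add: maxcpt_iff integral_def h_def)
    have hD: "h \<in> Dgrp i j" using hK sj by (simp add: Dgrp_def) (simp add: h_def)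
    let ?g = "k ** h ** star k"
    have g11: "?g $ 1 $ 1 = 1 + \<delta> * \<iota> s * (b * bar e)"
      unfolding ke h_def using r(5) by (simp add: algebra_simps)
    have g21: "?g $ 2 $ 1 = \<delta> * \<iota> (s * n)"
    proof -
      have "?g $ 2 $ 1 = (c * bar e + e * bar c) + \<delta> * \<iota> s * (e * bar e)"
        unfolding ke h_def by (simp add: algebra_simps)
      thus ?thesis unfolding r(8) n by simp
    qed
    have be: "b * bar e \<in> PE 0" using O by (simp add: E.pideal_mult_left)
    have one: "?g $ 1 $ 1 - 1 \<in> PE (int j)" unfolding g11 using E.pideal_mult_right[OF sj' be] by simp
    have "e * bar e \<in> PE 0" using O(4) by (simp add: E.pideal_mult_left)
    hence n0': "n \<in> PF 0" unfolding n by (simp only: incl_PE)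
    have c: "?g $ 2 $ 1 \<in> PE (int j)" unfolding g21 using F.pideal_mult_right[OF sj n0'] by (simp only: rt_mult_PE incl_PE)
    have "?g $ 1 $ 1 * bar (?g $ 1 $ 1) - 1 \<in> PE (int i)"
    proof (rule E.one_plus_mult)
      show "?g $ 1 $ 1 - 1 \<in> PE (int i)" using E.pideal_mono[OF one] ij by simp
      hence "bar (?g $ 1 $ 1 - 1) \<in> PE (int i)" unfolding bar_PE .
      thus "bar (?g $ 1 $ 1) - 1 \<in> PE (int i)" by simp
    qed simp
    hence gD: "?g \<in> Dgrp i j" using c hK k by (simp add: Dgrp_def maxcpt_mult maxcpt_star)
    have "Omega d ?g = \<psi>' (\<epsilon> * (s * n) / \<pi> ^ d)"
      using Omega_one_plus[OF one _ c ijd(3)] ij unfolding g21 kappa_rt psi_incl by simp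
    moreover have "Omega d h = \<psi>' (\<epsilon> * s / \<pi> ^ d)"
      using Omega_one_plus[of h "int j" "int j" d] ij sj' kappa_rt[of d s] psi_incl[of "\<epsilon> * s / \<pi> ^ d"]
      by (simp add: h_def del: psi_incl)
    ultimately have "\<psi>' (\<epsilon> * (s * n) / \<pi> ^ d) = \<psi>' (\<epsilon> * s / \<pi> ^ d)" using fixed[OF hD gD] by simp
    moreover have "\<epsilon> * (s * n) / \<pi> ^ d = x0 + \<epsilon> * s / \<pi> ^ d"
      using n0 by (simp add: s_def field_simps)
    ultimately show False using x0 psi'_add[of x0 "\<epsilon> * s / \<pi> ^ d"] by simp
  qed
  have eN: "e * bar e - 1 \<in> PE (int i)" using n1 unfolding n by (simp flip: incl_PE)
  have eN1: "e * bar e - 1 \<in> PE 1" using E.pideal_mono[OF eN] ij by simp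
  have "e * bar e \<noteq> 0" "valE E (e * bar e) = 0" using E.one_plus_unit[OF eN1] by auto
  hence eu: "e \<noteq> 0" "valE E e = 0" using E.val_mult[of e "bar e"] by auto
  have "bar (c * bar e) = - (c * bar e)" using r(8) by (simp add: eq_neg_iff_add_eq_0 algebra_simps)
  then obtain \<gamma> where g: "c * bar e = \<delta> * \<iota> \<gamma>" using bar_antifixed by blast
  have gj: "\<gamma> \<in> PF (int j)"
  proof (rule ccontr)
    assume bad: "\<gamma> \<notin> PF (int j)"
    hence g0: "\<gamma> \<noteq> 0" by auto
    \<comment> \<open>The diagonal element with t = 1 + s contributes
      \<open>\<gamma> * (t - 1 / t)\<close>, which is \<open>2 * \<gamma> * s\<close> to first
      order. This s turns the leading term into x0.\<close>
    define s where "s = x0 * \<pi> ^ d / (2 * \<epsilon> * \<gamma>)"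
    have si: "s \<in> PF (int i)"
      using small[of "2 * \<epsilon> * \<gamma>" "int j"] bad g0 two_F eps_unit
      by (simp add: s_def F.pideal_mult_iff' F.val_mult ijd)
    define t where "t = 1 + s"
    have t1: "t - 1 \<in> PF (int i)" using si by (simp add: t_def)
    have tu: "t \<noteq> 0" "valF E t = 0" using F.one_plus_unit[OF t1] ij by auto
    have gs: "\<gamma> * s \<in> PF (int d)"
    proof -
      have "\<gamma> * s = x0 * \<pi> ^ d / (2 * \<epsilon>)" using g0 by (simp add: s_def)
      moreover have "x0 * \<pi> ^ d \<in> PF (int d)" using x0 val_unif_power[of d] by (simp add: F.pideal_mult_iff)
      ultimately show ?thesis using two_F eps_unit by (simp add: F.pideal_divide_iff F.val_mult)
    qed
    define h where "h = mat22 (\<iota> t) 0 0 (\<iota> (1 / t))"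
    have hU: "h \<in> U11 E" unfolding U11_iff h_def using tu by (simp add: mat_mat22)
    have tO: "t \<in> PF 0" "1 / t \<in> PF 0" using tu by (simp_all add: pideal_def F.val_divide)
    have hK: "h \<in> maxcpt E" using hU tO by (simp add: maxcpt_iff integral_def h_def del: incl_divide)
    have tt: "t * t - 1 \<in> PF (int i)" using F.one_plus_mult[OF t1 t1] by simp
    have hD: "h \<in> Dgrp i j"
    proof -
      have "\<iota> (t * t - 1) \<in> PE (int i)" using tt by (simp only: incl_PE)
      thus ?thesis using hK by (simp add: Dgrp_def) (simp add: h_def)
    qed
    let ?g = "k ** h ** star k"
    have g11: "?g $ 1 $ 1 - 1 = \<iota> (t - 1) + b * bar c * \<iota> ((1 - t * t) / t)"
    proof -
      have "?g $ 1 $ 1 = \<iota> t * (a * bar e + b * bar c) + b * bar c * \<iota> (1 / t - t)"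
        unfolding ke h_def by (simp add: algebra_simps)
      moreover have "1 / t - t = (1 - t * t) / t" using tu by (simp add: field_simps)
      ultimately show ?thesis unfolding r(5) by simp
    qed
    have g21: "?g $ 2 $ 1 = \<delta> * \<iota> (\<gamma> * (t - 1 / t))"
    proof -
      have ec: "e * bar c = - (\<delta> * \<iota> \<gamma>)" using r(8) g by (metis add.commute eq_neg_iff_add_eq_0)
      have "?g $ 2 $ 1 = (c * bar e) * \<iota> t + (e * bar c) * \<iota> (1 / t)"
        unfolding ke h_def by (simp add: algebra_simps)
      thus ?thesis unfolding ec g by (simp add: algebra_simps)
    qed
    have one: "?g $ 1 $ 1 - 1 \<in> PE (int i)"
      unfolding g11
    proof (rule E.pideal_add)
      show "\<iota> (t - 1) \<in> PE (int i)" using t1 by (simp only: incl_PE)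
      have "(1 - t * t) / t \<in> PF (int i)" using tt tu by (simp add: F.pideal_divide_iff F.pideal_commute)
      thus "b * bar c * \<iota> ((1 - t * t) / t) \<in> PE (int i)"
        using O by (intro E.pideal_mult_left) (simp_all only: incl_PE bar_PE)
    qed
    have tinv: "t - 1 / t = 2 * s - s * s / t"
    proof -
      have "t * t - 1 = 2 * s * t - s * s" by (simp add: t_def algebra_simps)
      thus ?thesis using tu by (simp add: field_simps)
    qed
    \<comment> \<open>The second order term is invisible to the character:
      \<open>\<gamma> * s\<close> lies in p^d and s in p^i with i at least 1.\<close>
    have gss: "\<gamma> * s * s / t \<in> PF (int d + 1)"
      using F.pideal_mult_le[OF gs si, of "int d + 1"] ij tu by (simp add: F.pideal_divide_iff)
    have gt: "\<gamma> * (t - 1 / t) - 2 * (\<gamma> * s) \<in> PF (int d + 1)"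
      using gss unfolding tinv by (simp add: algebra_simps)
    have cd: "\<gamma> * (t - 1 / t) \<in> PF (int d)"
      using F.pideal_add[OF F.pideal_mono[OF gt, of "int d"], of "2 * (\<gamma> * s)"] gs two_F by (simp add: F.pideal_mult_iff')
    have c: "?g $ 2 $ 1 \<in> PE (int d)" unfolding g21 using cd by (simp only: rt_mult_PE incl_PE)
    have "?g $ 1 $ 1 * bar (?g $ 1 $ 1) - 1 \<in> PE (int i)"
    proof (rule E.one_plus_mult[OF one])
      have "bar (?g $ 1 $ 1 - 1) \<in> PE (int i)" using one unfolding bar_PE .
      thus "bar (?g $ 1 $ 1) - 1 \<in> PE (int i)" by simp
    qed simp
    hence gD: "?g \<in> Dgrp i j" using E.pideal_mono[OF c, of "int j"] ij hK k
      by (simp add: Dgrp_def maxcpt_mult maxcpt_star)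
    have "Omega d ?g = \<psi> (\<kappa> d * (\<delta> * \<iota> (\<gamma> * (t - 1 / t))))"
      using Omega_one_plus[OF one _ c ijd(4)] ij unfolding g21 by simp
    also have "\<dots> = \<psi> (\<kappa> d * (\<delta> * \<iota> (2 * (\<gamma> * s))))"
    proof (rule psi_scaled_cong)
      have "\<delta> * \<iota> (\<gamma> * (t - 1 / t) - 2 * (\<gamma> * s)) \<in> PE (int d + 1)" using gt by (simp only: rt_mult_PE incl_PE)
      thus "\<delta> * \<iota> (\<gamma> * (t - 1 / t)) - \<delta> * \<iota> (2 * (\<gamma> * s)) \<in> PE (int d + 1)"
        by (simp only: incl_diff right_diff_distrib)
    qed
    also have "\<dots> = \<psi>' x0"
    proof -
      have "\<epsilon> * (2 * (\<gamma> * s)) / \<pi> ^ d = x0" using g0 two_F by (simp add: s_def field_simps)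
      thus ?thesis unfolding kappa_rt psi_incl by simp
    qed
    finally have "Omega d ?g = \<psi>' x0" .
    moreover have "Omega d h = 1"
    proof -
      have "h $ 1 $ 1 - 1 = \<iota> (t - 1)" by (simp add: h_def)
      hence "h $ 1 $ 1 - 1 \<in> PE (int i)" using t1 by (simp only: incl_PE)
      from Omega_one_plus[OF this, of "int d" d] show ?thesis
        using ij psi_trivial[of 0] by (simp add: h_def)
    qed
    ultimately show False using fixed[OF hD gD] x0 by simp
  qed
  have "c * bar e \<in> PE (int j)" using gj unfolding g by simp
  hence c: "c \<in> PE (int j)" using eu by (simp add: E.pideal_mult_iff)
  \<comment> \<open>As c is small, unitarity puts \<open>a * bar e\<close> near 1; the norm of a
    then follows from that of e.\<close>
  have "a * bar e - 1 = - (b * bar c)" using r(5) by (simp add: algebra_simps)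
  hence ae: "a * bar e - 1 \<in> PE (int i)" using O c E.pideal_mono[of c "int j" "int i"] ij by (simp add: E.pideal_mult_left)
  have "bar (a * bar e - 1) \<in> PE (int i)" using ae unfolding bar_PE .
  hence ae': "bar a * e - 1 \<in> PE (int i)" by simp
  have "(a * bar e) * (bar a * e) - 1 \<in> PE (int i)" using E.one_plus_mult[OF ae ae'] by simp
  moreover have "(a * bar e) * (bar a * e) - 1 = (a * bar a - 1) * (e * bar e) + (e * bar e - 1)" by (simp add: algebra_simps)
  ultimately have "(a * bar a - 1) * (e * bar e) \<in> PE (int i)"
    using E.pideal_diff[OF _ eN] by (metis add_diff_cancel_right')
  hence "a * bar a - 1 \<in> PE (int i)" using E.pideal_mult_iff[OF \<open>e * bar e \<noteq> 0\<close>] \<open>valE E (e * bar e) = 0\<close> by simp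
  thus ?thesis using c k by (simp add: Dgrp_def) (simp add: ke)
qed

text \<open>Level d + 1 suffices as the normal subgroup of finite index: a lower left entry in
  p^(d+1) becomes an element of p after multiplication by \<open>\<kappa> d\<close>.\<close>

lemma Omega_mackey:
  assumes ij: "1 \<le> i" "i \<le> j" "i + j = d + 1"
  shows "finite_index_normal.mackey (congruence_subgroup (d + 1)) (Kgrp E) (Dgrp i j) (Omega d)"
proof -
  interpret finite_index_normal "congruence_subgroup (d + 1)" "Kgrp E" by (rule congruence_finite_index)
  show ?thesis unfolding mackey_def
  proof (intro conjI ballI)
    show "subgroup (Dgrp i j) (Kgrp E)" using ij by (intro Dgrp_subgroup)
    show "congruence_subgroup (d + 1) \<subseteq> Dgrp i j"
    proof
      fix k assume k: "k \<in> congruence_subgroup (d + 1)"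
      hence 1: "k $ 1 $ 1 - 1 \<in> PE (int i)" "k $ 2 $ 1 \<in> PE (int j)"
        using ij E.pideal_mono by (auto simp: congruence_subgroup_def mcong_def mat_mat22)
      have "bar (k $ 1 $ 1 - 1) \<in> PE (int i)" using 1 unfolding bar_PE by blast
      thus "k \<in> Dgrp i j" using 1 k by (auto simp: Dgrp_def congruence_subgroup_def intro: E.one_plus_mult)
    qed
    show "Omega d (g \<otimes>\<^bsub>Kgrp E\<^esub> h) = Omega d g * Omega d h" if "g \<in> Dgrp i j" "h \<in> Dgrp i j" for g h
      using Omega_mult[OF ij that] by simp
    show "Omega d k = 1" if "k \<in> congruence_subgroup (d + 1)" for k
    proof -
      have k: "k $ 1 $ 1 - 1 \<in> PE (int d + 1)" "k $ 2 $ 1 \<in> PE (int d + 1)"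
        using that by (auto simp: congruence_subgroup_def mcong_def mat_mat22 add.commute)
      have "Omega d k = \<psi> (\<kappa> d * (k $ 2 $ 1))"
        using k by (intro Omega_one_plus[of _ "int d + 1" "int d + 1"]) auto
      thus ?thesis using psi_trivial k(2) scaled_PE by simp
    qed
    fix k assume k: "k \<in> carrier (Kgrp E) - Dgrp i j"
    thus "\<exists>h\<in>Dgrp i j. k \<otimes>\<^bsub>Kgrp E\<^esub> h \<otimes>\<^bsub>Kgrp E\<^esub> inv\<^bsub>Kgrp E\<^esub> k \<in> Dgrp i j \<and>
        Omega d (k \<otimes>\<^bsub>Kgrp E\<^esub> h \<otimes>\<^bsub>Kgrp E\<^esub> inv\<^bsub>Kgrp E\<^esub> k) \<noteq> Omega d h"
      using Omega_intertwining[OF ij, of k] by (auto simp: inv_K)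
  qed
qed

end

lemma vector_space_fun:
  assumes "vector_space sc"
  shows "vector_space (\<lambda>c f x. sc c (f x))"
  using assms unfolding vector_space_def by (auto simp: fun_eq_iff)

lemma subspace_iff:
  assumes "vector_space sc"
  shows "module.subspace sc S \<longleftrightarrow> 0 \<in> S \<and> (\<forall>x\<in>S. \<forall>y\<in>S. x + y \<in> S) \<and> (\<forall>c. \<forall>x\<in>S. sc c x \<in> S)"
proof -
  interpret vector_space sc by (rule assms)
  show ?thesis by (auto simp: subspace_def)
qed

context unramified_quad_ext
begin

lemma unip_maxcpt: "u \<in> unip E \<Longrightarrow> u \<in> maxcpt E"
  by (auto simp: unip_def maxcpt_iff U11_iff integral_def mat_mat22)

lemma centre_maxcpt: "z \<in> norm_one E \<Longrightarrow> mat z \<in> maxcpt E"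
  using norm_one_unit by (auto simp: maxcpt_iff U11_iff integral_def mat_mat22 norm_one_def mult.commute)

section \<open>The matrix topology and open congruence subgroups\<close>

lemma openin_mat_top: "openin (mat_top E) U \<longleftrightarrow> mat_open E U"
  unfolding mat_top_def by (simp add: topology_inverse' istopology_mat_open)

lemma mat_openI:
  assumes "\<And>g h. g \<in> U \<Longrightarrow> mcong n h g \<Longrightarrow> h \<in> U"
  shows "openin (mat_top E) U"
  unfolding openin_mat_top mat_open_def
  using assms by (auto simp: mcong_def forall_2 intro!: exI[of _ n])

lemma topspace_mat_top [simp]: "topspace (mat_top E) = UNIV"
  using openin_subset[OF mat_openI[of UNIV 0]] by auto

lemma congruence_subgroup_open:
  assumes "maxcpt E \<subseteq> S" "S \<subseteq> U11 E"
  shows "openin (subtopology (mat_top E) S) (congruence_subgroup m)"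
proof -
  have "openin (mat_top E) {g. integral g \<and> mcong (int m) g (mat 1)}"
  proof (rule mat_openI[of _ "int m"])
    fix g h assume g: "g \<in> {g. integral g \<and> mcong (int m) g (mat 1)}" and h: "mcong (int m) h g"
    have "integral h"
      using g mcong_mono[OF h, of 0] E.pideal_add_iff[of "h $ i $ j - g $ i $ j" 0 "g $ i $ j" for i j]
      unfolding integral_def mcong_def by fastforce
    thus "h \<in> {g. integral g \<and> mcong (int m) g (mat 1)}" using g h mcong_trans by blast
  qed
  moreover have "congruence_subgroup m = {g. integral g \<and> mcong (int m) g (mat 1)} \<inter> S"
    using assms by (auto simp: congruence_subgroup_def maxcpt_iff)
  ultimately show ?thesis by (auto simp: openin_subtopology)
qed

end

context central_character_data
begin

section \<open>Identification of \<open>Psi\<close> and \<open>S_rep\<close> with the explicit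
  character and its induced space\<close>

lemma half_indices:
  fixes d :: nat
  assumes "0 < d"
  shows "1 \<le> (d + 1) div 2" "(d + 1) div 2 \<le> d div 2 + 1" "(d + 1) div 2 + (d div 2 + 1) = d + 1"
  using assms by presburger+

lemma ceiling_halves: "\<lceil>real d / 2\<rceil> = int ((d + 1) div 2)" "\<lceil>(real d + 1) / 2\<rceil> = int (d div 2 + 1)"
proof -
  have *: "\<lceil>real n / 2\<rceil> = int ((n + 1) div 2)" for n
    by (cases "even n") (auto elim!: evenE oddE simp: ceiling_eq_iff)
  show "\<lceil>real d / 2\<rceil> = int ((d + 1) div 2)" by (rule *)
  show "\<lceil>(real d + 1) / 2\<rceil> = int (d div 2 + 1)" using *[of "d + 1"] by (simp add: add.commute)
qed

lemma one_unip: "mat 1 \<in> unip E"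
  unfolding unip_def by (auto simp: mat_mat22 intro!: exI[of _ 0])

lemma one_Jgrp: "mat 1 \<in> Jgrp E d"
  by (simp add: Jgrp_def) (simp add: mat_def)

lemma Jgrp_entries:
  assumes "mat22 a b c e \<in> Jgrp E d"
  shows "a - 1 \<in> PE (int ((d + 1) div 2))" "b \<in> PE (int ((d + 1) div 2))" "c \<in> PE (int (d div 2 + 1))"
    "e - 1 \<in> PE (int ((d + 1) div 2))" "mat22 a b c e \<in> maxcpt E"
proof -
  show 1: "a - 1 \<in> PE (int ((d + 1) div 2))" "b \<in> PE (int ((d + 1) div 2))" "c \<in> PE (int (d div 2 + 1))"
    "e - 1 \<in> PE (int ((d + 1) div 2))" using assms unfolding Jgrp_def ceiling_halves by auto
  have "x \<in> PE 0" if "x - 1 \<in> PE (int ((d + 1) div 2))" for x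
    using E.pideal_add[OF E.pideal_mono[OF that, of 0], of 1] by simp
  thus "mat22 a b c e \<in> maxcpt E"
    using 1 E.pideal_mono[OF 1(2), of 0] E.pideal_mono[OF 1(3), of 0] assms
    by (simp add: maxcpt_iff integral_def Jgrp_def)
qed

lemma one_plus_norm:
  assumes "x - 1 \<in> PE n" "0 \<le> n" shows "x * bar x - 1 \<in> PE n"
proof (rule E.one_plus_mult[OF assms(1) _ assms(2)])
  have "bar (x - 1) \<in> PE n" using assms(1) unfolding bar_PE .
  thus "bar x - 1 \<in> PE n" by simp
qed

text \<open>For the harder inclusion, a is divided by a nearby z in E^1, after which both diagonal
  entries are 1 modulo p^i. The upper right entry then has its part in F small by unitarity, and its
  part along \<open>\<delta>\<close> is removed by a factor in \<open>unip E\<close>.\<close>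

lemma ZUJ_eq:
  assumes d: "0 < d"
  shows "ZUJ E d = Dgrp ((d + 1) div 2) (d div 2 + 1)"
proof
  define i where "i = (d + 1) div 2"
  define j where "j = d div 2 + 1"
  have ij: "1 \<le> i" "i \<le> j" "i + j = d + 1" unfolding i_def j_def using half_indices[OF d] by auto
  show "ZUJ E d \<subseteq> Dgrp ((d + 1) div 2) (d div 2 + 1)" unfolding i_def[symmetric] j_def[symmetric]
  proof
    fix x assume "x \<in> ZUJ E d"
    then obtain z b k where x: "x = mat z ** mat22 1 (\<delta> * \<iota> b) 0 1 ** k"
      and z: "z \<in> norm_one E" and b: "b \<in> PF 0" and k: "k \<in> Jgrp E d"
      by (auto simp: ZUJ_def centre_def unip_def)
    obtain k1 k2 k3 k4 where ke: "k = mat22 k1 k2 k3 k4" by (cases k)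
    note J = Jgrp_entries[OF k[unfolded ke], folded i_def j_def]
    have u: "mat22 1 (\<delta> * \<iota> b) 0 1 \<in> unip E" using b by (auto simp: unip_def)
    have xK: "x \<in> maxcpt E" unfolding x
      using centre_maxcpt[OF z] unip_maxcpt[OF u] J(5) maxcpt_mult unfolding ke by blast
    have x11: "x $ 1 $ 1 = z * (k1 + \<delta> * \<iota> b * k3)" and x21: "x $ 2 $ 1 = z * k3"
      by (simp_all add: x ke mat_mat22 algebra_simps)
    have dO: "\<delta> * \<iota> b \<in> PE 0" using b by simp
    have "k3 \<in> PE (int i)" using E.pideal_mono[OF J(3), of "int i"] ij by simp
    hence "\<delta> * \<iota> b * k3 \<in> PE (int i)" by (rule E.pideal_mult_left[OF dO])
    hence "(k1 - 1) + \<delta> * \<iota> b * k3 \<in> PE (int i)" by (rule E.pideal_add[OF J(1)])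
    hence y1: "(k1 + \<delta> * \<iota> b * k3) - 1 \<in> PE (int i)" by (simp add: algebra_simps)
    have "x $ 1 $ 1 * bar (x $ 1 $ 1) = (z * bar z) * ((k1 + \<delta> * \<iota> b * k3) * bar (k1 + \<delta> * \<iota> b * k3))"
      unfolding x11 bar_mult[of z] by (simp only: mult.assoc mult.left_commute)
    also have "z * bar z = 1" using z by (simp add: norm_one_def)
    finally have "x $ 1 $ 1 * bar (x $ 1 $ 1) - 1 \<in> PE (int i)" using one_plus_norm[OF y1] by simp
    moreover have "x $ 2 $ 1 \<in> PE (int j)" unfolding x21 using J(3) norm_one_unit[OF z] by (intro E.pideal_mult_left)
    ultimately show "x \<in> Dgrp i j" using xK by (simp add: Dgrp_def)
  qed
  show "Dgrp ((d + 1) div 2) (d div 2 + 1) \<subseteq> ZUJ E d" unfolding i_def[symmetric] j_def[symmetric]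
  proof
    fix x assume x: "x \<in> Dgrp i j"
    obtain a b c e where xe: "x = mat22 a b c e" by (cases x)
    note X = Dgrp_entries[OF x[unfolded xe] ij(1,2)]
    obtain z where z: "z \<in> norm_one E" "a - z \<in> PE (int i)" using norm_near_one[OF X(3)] ij by auto
    note zu = norm_one_unit[OF z(1)]
    have zz: "z * bar z = 1" "bar z * z = 1" using z(1) by (simp_all add: norm_one_def mult.commute)
    hence zz3: "z * (bar z * t) = t" for t by (simp flip: mult.assoc)
    define y where "y = mat (bar z) ** x"
    have yK: "y \<in> maxcpt E" unfolding y_def using x norm_one_closed(2)[OF z(1)] centre_maxcpt maxcpt_mult
      by (simp add: Dgrp_def)
    define a' b' c' e' where ye: "a' = bar z * a" "b' = bar z * b" "c' = bar z * c" "e' = bar z * e"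
    have y: "y = mat22 a' b' c' e'" by (simp add: y_def xe mat_mat22 ye)
    note O = maxcpt_entries[OF yK[unfolded y]] and r = relations[OF maxcpt_U11[OF yK[unfolded y]]]
    have "bar z * (a - z) \<in> PE (int i)" using z zu by (intro E.pideal_mult_left) simp_all
    hence a1: "a' - 1 \<in> PE (int i)" by (simp add: ye algebra_simps zz)
    have c1: "c' \<in> PE (int j)" unfolding ye using X zu by (intro E.pideal_mult_left) simp_all
    have ci: "c' \<in> PE (int i)" using E.pideal_mono[OF c1] ij by simp
    have ab1: "bar (a' - 1) \<in> PE (int i)" using a1 unfolding bar_PE .
    have cb: "bar c' * b' \<in> PE (int i)" using ci O by (simp add: E.pideal_mult_right)
    have e1: "e' - 1 \<in> PE (int i)"
    proof -
      have "- (bar c' * b') - bar (a' - 1) * e' \<in> PE (int i)"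
        using cb ab1 O by (intro E.pideal_diff E.pideal_mult_right) simp_all
      moreover have "e' - 1 = - (bar c' * b') - bar (a' - 1) * e'" using r(1) by (simp add: algebra_simps)
      ultimately show ?thesis by simp
    qed
    have eb1: "bar (e' - 1) \<in> PE (int i)" using e1 unfolding bar_PE .
    \<comment> \<open>With e' congruent to 1, the orthogonality relation between b' and e' bounds
      the trace of b', hence its coordinate in F.\<close>
    have "b' + bar b' = - (bar b' * (e' - 1)) - bar (e' - 1) * b'" using r(4) by (simp add: algebra_simps)
    moreover have "- (bar b' * (e' - 1)) - bar (e' - 1) * b' \<in> PE (int i)"
      using e1 eb1 O by (intro E.pideal_diff E.pideal_mult_right) (simp_all add: E.pideal_mult_left)
    ultimately have "(b' + bar b') / 2 \<in> PE (int i)" using two_E by (simp add: E.pideal_divide_iff)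
    hence rb: "re b' \<in> PF (int i)" unfolding trace_half by simp
    \<comment> \<open>Only integrality is known of this coordinate, which is exactly what membership
      in \<open>unip E\<close> requires.\<close>
    define \<beta> where "\<beta> = im b'"
    have \<beta>O: "\<beta> \<in> PF 0" using O(2) PE_coordinates by (simp add: \<beta>_def)
    define u where "u = mat22 1 (\<delta> * \<iota> \<beta>) 0 1"
    have u: "u \<in> unip E" using \<beta>O by (auto simp: u_def unip_def)
    have dO: "\<delta> * \<iota> \<beta> \<in> PE 0" using \<beta>O by simp
    define k where "k = star u ** y"
    have ke: "k = mat22 (a' - \<delta> * \<iota> \<beta> * c') (b' - \<delta> * \<iota> \<beta> * e') c' e'"
      by (simp add: k_def u_def y)
    have k11: "(a' - 1) - \<delta> * \<iota> \<beta> * c' \<in> PE (int i)"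
      using a1 by (rule E.pideal_diff) (rule E.pideal_mult_left[OF dO ci])
    have "b' - \<delta> * \<iota> \<beta> * e' = \<iota> (re b') - \<delta> * \<iota> \<beta> * (e' - 1)"
      using coordinates[of b'] by (simp add: \<beta>_def algebra_simps)
    moreover have "\<iota> (re b') - \<delta> * \<iota> \<beta> * (e' - 1) \<in> PE (int i)"
      using rb by (intro E.pideal_diff E.pideal_mult_left[OF dO e1]) simp
    ultimately have k12: "b' - \<delta> * \<iota> \<beta> * e' \<in> PE (int i)" by simp
    have kU: "k \<in> U11 E" unfolding k_def using u unip_maxcpt maxcpt_star yK maxcpt_mult maxcpt_U11 by blast
    have "k \<in> Jgrp E d"
      unfolding Jgrp_def ceiling_halves i_def[symmetric] j_def[symmetric]
      using kU k11 k12 c1 e1 by (simp add: ke algebra_simps)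
    moreover have "x = mat z ** u ** k"
    proof -
      have "u ** k = y" unfolding k_def using u unip_maxcpt maxcpt_U11 star_cancel by blast
      moreover have "mat z ** y = x" by (simp add: xe y mat_mat22 ye zz3)
      ultimately show ?thesis by (simp flip: matrix_mul_assoc)
    qed
    ultimately show "x \<in> ZUJ E d" using z u by (auto simp: ZUJ_def centre_def)
  qed
qed

lemma Xmat_eq: "Xmat E d = mat22 0 (\<kappa> d) 0 0"
  by (simp add: Xmat_def \<kappa>_def power_int_minus divide_inverse)

text \<open>\<open>Omega d\<close> restricted to the group has the defining properties of
  \<open>Psi\<close>, and it is the only such function because every element is a product of a
  central, a unipotent and a \<open>Jgrp\<close> factor, on which the values are prescribed.\<close>

lemma Psi_eq:
  assumes d: "0 < d" and k: "k \<in> ZUJ E d"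
  shows "Psi E \<psi>' \<theta> d k = Omega d k"
proof -
  define i where "i = (d + 1) div 2"
  define j where "j = d div 2 + 1"
  have ij: "1 \<le> i" "i \<le> j" "i + j = d + 1" unfolding i_def j_def using half_indices[OF d] by auto
  have Z: "ZUJ E d = Dgrp i j" unfolding i_def j_def by (rule ZUJ_eq[OF d])
  have zu: "mat z ** u \<in> ZUJ E d" if "z \<in> norm_one E" "u \<in> unip E" for z u
    unfolding ZUJ_def using that one_Jgrp[of d] by (force simp: centre_def)
  have J: "k \<in> ZUJ E d" if "k \<in> Jgrp E d" for k
  proof -
    have "mat 1 \<in> centre E" using norm_one_closed(3) by (auto simp: centre_def)
    thus ?thesis unfolding ZUJ_def using that one_unip by (force intro: exI[of _ "mat 1"])
  qed
  let ?P = "\<lambda>\<omega>. \<omega> \<in> extensional (ZUJ E d) \<and> lin_character (matgrp (ZUJ E d)) \<omega> \<and>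
     (\<forall>z\<in>norm_one E. \<forall>u\<in>unip E. \<omega> (mat z ** u) = \<theta> z) \<and>
     (\<forall>k\<in>Jgrp E d. \<omega> k = psiE E \<psi>' (trace (Xmat E d ** (k - mat 1))))"
  have sub: "subgroup (ZUJ E d) (Kgrp E)" unfolding Z using ij by (intro Dgrp_subgroup)
  have closed: "g ** h \<in> ZUJ E d" if "g \<in> ZUJ E d" "h \<in> ZUJ E d" for g h
    using subgroup.m_closed[OF sub that] by simp
  have "(THE \<omega>. ?P \<omega>) = restrict (Omega d) (ZUJ E d)"
  proof (rule the_equality)
    have nz: "Omega d g \<noteq> 0" if "g \<in> ZUJ E d" for g
    proof -
      obtain a b c e where ge: "g = mat22 a b c e" by (cases g)
      have "a * bar a - 1 \<in> PE 1" using Dgrp_entries(4)[OF _ ij(1,2)] that unfolding Z ge by blast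
      then obtain z where "z \<in> norm_one E" "a - z \<in> PE 1" using norm_near_one by auto
      thus ?thesis using theta_ext_eq theta_nonzero by (simp add: Omega_def ge)
    qed
    show "?P (restrict (Omega d) (ZUJ E d))"
    proof (intro conjI ballI)
      show "lin_character (matgrp (ZUJ E d)) (restrict (Omega d) (ZUJ E d))"
        using nz closed Omega_mult[OF ij] unfolding lin_character_def hom_def Z by auto
      fix z u assume zu': "z \<in> norm_one E" "u \<in> unip E"
      show "restrict (Omega d) (ZUJ E d) (mat z ** u) = \<theta> z"
        using zu[OF zu'] theta_ext_eq[OF zu'(1), of z] zu'(2) psi_trivial[of 0]
        by (auto simp: Omega_def unip_def mat_mat22)
    next
      fix k assume k: "k \<in> Jgrp E d"
      obtain a b c e where ke: "k = mat22 a b c e" by (cases k)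
      note e = Jgrp_entries[OF k[unfolded ke], folded i_def j_def]
      have "Omega d k = \<psi> (\<kappa> d * (k $ 2 $ 1))"
        using e ij by (intro Omega_one_plus[of _ "int i" "int j"]) (auto simp: ke)
      thus "restrict (Omega d) (ZUJ E d) k = psiE E \<psi>' (trace (Xmat E d ** (k - mat 1)))"
        using J[OF k] by (simp add: Xmat_eq ke mat_mat22 mat22_diff trace_def sum_2)
    qed simp
  next
    fix \<omega> assume P: "?P \<omega>"
    show "\<omega> = restrict (Omega d) (ZUJ E d)"
    proof (rule extensionalityI[of _ "ZUJ E d"])
      fix x assume x: "x \<in> ZUJ E d"
      then obtain z u k where zuk: "z \<in> norm_one E" "u \<in> unip E" "k \<in> Jgrp E d" "x = (mat z ** u) ** k"
        by (auto simp: ZUJ_def centre_def)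
      have "\<omega> x = \<omega> (mat z ** u) * \<omega> k"
        using P zu[OF zuk(1,2)] J[OF zuk(3)] unfolding zuk(4) lin_character_def hom_def by auto
      moreover have "Omega d x = Omega d (mat z ** u) * Omega d k"
        using Omega_mult[OF ij] zu[OF zuk(1,2)] J[OF zuk(3)] unfolding zuk(4) Z by blast
      moreover have "Omega d (mat z ** u) = \<theta> z"
        using theta_ext_eq[OF zuk(1), of z] zuk(2) psi_trivial[of 0]
        by (auto simp: Omega_def unip_def mat_mat22)
      moreover have "Omega d k = \<omega> k"
      proof -
        obtain a b c e where ke: "k = mat22 a b c e" by (cases k)
        note e = Jgrp_entries[OF zuk(3)[unfolded ke], folded i_def j_def]
        have "Omega d k = \<psi> (\<kappa> d * (k $ 2 $ 1))"
          using e ij by (intro Omega_one_plus[of _ "int i" "int j"]) (auto simp: ke)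
        thus ?thesis using P zuk(3) by (simp add: Xmat_eq ke mat_mat22 mat22_diff trace_def sum_2)
      qed
      ultimately show "\<omega> x = restrict (Omega d) (ZUJ E d) x" using P zuk x by simp
    qed (use P in auto)
  qed
  thus ?thesis unfolding Psi_def using k by simp
qed

text \<open>Smoothness is automatic. The character is trivial on a congruence subgroup, which is
  open and normal, so left equivariance under it amounts to right invariance.\<close>

lemma S_rep_eq:
  assumes d: "0 < d"
  shows "S_rep E \<psi>' \<theta> d = \<lparr>grp = Kgrp E, scal = (\<lambda>c f x. c * f x),
     vs = finite_index_normal.char_space (Kgrp E) (ZUJ E d) (Omega d),
     act = finite_index_normal.translate (Kgrp E)\<rparr>"
proof -
  interpret finite_index_normal "congruence_subgroup (d + 1)" "Kgrp E" by (rule congruence_finite_index)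
  have m: "mackey (ZUJ E d) (Omega d)"
    unfolding ZUJ_eq[OF d] using half_indices[OF d] by (rule Omega_mackey)
  have "Ind_space (mat_top E) (Kgrp E) (char_rep (matgrp (ZUJ E d)) (Psi E \<psi>' \<theta> d)) = char_space (ZUJ E d) (Omega d)"
  proof
    show "Ind_space (mat_top E) (Kgrp E) (char_rep (matgrp (ZUJ E d)) (Psi E \<psi>' \<theta> d)) \<subseteq> char_space (ZUJ E d) (Omega d)"
      by (auto simp: Ind_space_def char_rep_def char_space_def Psi_eq[OF d])
    show "char_space (ZUJ E d) (Omega d) \<subseteq> Ind_space (mat_top E) (Kgrp E) (char_rep (matgrp (ZUJ E d)) (Psi E \<psi>' \<theta> d))"
    proof
      fix f assume f: "f \<in> char_space (ZUJ E d) (Omega d)"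
      have "openin (subtopology (mat_top E) (carrier (Kgrp E))) (congruence_subgroup (d + 1))"
        by (rule congruence_subgroup_open) (auto simp: maxcpt_iff)
      moreover have "f (x \<otimes>\<^bsub>Kgrp E\<^esub> l) = f x" if "x \<in> carrier (Kgrp E)" "l \<in> congruence_subgroup (d + 1)" for x l
        using coset_invariant_right[OF char_space_invariant[OF m f] that] .
      ultimately have "\<exists>L. subgroup L (Kgrp E) \<and> openin (subtopology (mat_top E) (carrier (Kgrp E))) L \<and>
          (\<forall>x\<in>carrier (Kgrp E). \<forall>l\<in>L. f (x \<otimes>\<^bsub>Kgrp E\<^esub> l) = f x)"
        using subgroup_axioms by blast
      thus "f \<in> Ind_space (mat_top E) (Kgrp E) (char_rep (matgrp (ZUJ E d)) (Psi E \<psi>' \<theta> d))"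
        using f by (simp add: Ind_space_def char_rep_def char_space_def Psi_eq[OF d])
    qed
  qed
  thus ?thesis by (simp add: S_rep_def Ind_def char_rep_def translate_def fun_eq_iff)
qed

lemma S_rep_irreducible:
  assumes d: "0 < d"
  shows "irreducible_rep (S_rep E \<psi>' \<theta> d)"
proof -
  interpret finite_index_normal "congruence_subgroup (d + 1)" "Kgrp E" by (rule congruence_finite_index)
  have m: "mackey (ZUJ E d) (Omega d)"
    unfolding ZUJ_eq[OF d] using half_indices[OF d] by (rule Omega_mackey)
  note st = stable_char_space[OF m]
  have vs: "vector_space (\<lambda>c (f :: 'e mat2 \<Rightarrow> complex) x. c * f x)"
    by (rule vector_space_fun) (unfold_locales, auto simp: algebra_simps)
  note sub = subspace_iff[OF vs]
  have rep: "is_rep (S_rep E \<psi>' \<theta> d)"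
    unfolding S_rep_eq[OF d] is_rep_def rep.select_convs sub
    using st group_K vs
    by (auto simp: stable_def zero_fun_def plus_fun_def translate_def fun_eq_iff matrix_mul_assoc maxcpt_mult)
      (auto simp: char_space_def)
  have d0: "delta (ZUJ E d) (Omega d) (mat 1) = 1"
    using delta_in[OF m] m mackey_one[OF m] unfolding delta_def[OF m] mackey_def by (auto simp: subgroup_def)
  show ?thesis unfolding irreducible_rep_def
  proof (intro conjI allI impI rep)
    show "vs (S_rep E \<psi>' \<theta> d) \<noteq> {0}"
      using delta_in[OF m] d0 by (auto simp: S_rep_eq[OF d] zero_fun_def)
    fix W assume W: "module.subspace (scal (S_rep E \<psi>' \<theta> d)) W \<and> W \<subseteq> vs (S_rep E \<psi>' \<theta> d) \<and>
          (\<forall>g\<in>carrier (grp (S_rep E \<psi>' \<theta> d)). \<forall>x\<in>W. act (S_rep E \<psi>' \<theta> d) g x \<in> W)"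
    hence W': "stable W" "W \<subseteq> char_space (ZUJ E d) (Omega d)"
      unfolding S_rep_eq[OF d] rep.select_convs sub by (auto simp: stable_def zero_fun_def plus_fun_def)
    show "W = {0} \<or> W = vs (S_rep E \<psi>' \<theta> d)"
    proof (cases "\<exists>f\<in>W. f \<noteq> (\<lambda>x. 0)")
      case True
      thus ?thesis using mackey_irreducible[OF m W'] by (auto simp: S_rep_eq[OF d])
    next
      case False
      thus ?thesis using W'(1) by (auto simp: stable_def zero_fun_def)
    qed
  qed
qed

end

section \<open>Whittaker functionals of cuspidal representations\<close>

locale stable_subspace = vector_space sc
  for sc :: "complex \<Rightarrow> 'v::ab_group_add \<Rightarrow> 'v" +
  fixes W :: "'v set" and T :: "'v \<Rightarrow> 'v"
  assumes W: "subspace W" and T: "x \<in> W \<Longrightarrow> T x \<in> W"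
    and T_add: "x \<in> W \<Longrightarrow> y \<in> W \<Longrightarrow> T (x + y) = T x + T y"
    and T_scale: "x \<in> W \<Longrightarrow> T (sc c x) = sc c (T x)"
begin

definition poly_apply :: "'v \<Rightarrow> complex poly \<Rightarrow> 'v" where
  "poly_apply x p = (\<Sum>i\<le>degree p. sc (coeff p i) ((T ^^ i) x))"

lemma poly_apply_bound:
  assumes "degree p \<le> n"
  shows "poly_apply x p = (\<Sum>i\<le>n. sc (coeff p i) ((T ^^ i) x))"
  unfolding poly_apply_def
  by (rule sum.mono_neutral_left) (use assms in \<open>auto simp: coeff_eq_0\<close>)

lemma iterate_in: "x \<in> W \<Longrightarrow> (T ^^ i) x \<in> W"
  by (induction i) (simp_all add: T)

lemma T_sum: "finite S \<Longrightarrow> (\<And>i. i \<in> S \<Longrightarrow> f i \<in> W) \<Longrightarrow> T (\<Sum>i\<in>S. f i) = (\<Sum>i\<in>S. T (f i))"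
proof (induction S rule: finite_induct)
  case empty
  have "T (sc 0 0) = sc 0 (T 0)" using subspace_0[OF W] by (rule T_scale)
  thus ?case by simp
next
  case (insert i S) thus ?case using subspace_sum[OF W, of S f] by (simp add: T_add)
qed

lemma poly_apply_pCons:
  assumes "x \<in> W"
  shows "poly_apply x (pCons a p) = sc a x + T (poly_apply x p)"
proof -
  have "poly_apply x (pCons a p) = (\<Sum>i\<le>Suc (degree p). sc (coeff (pCons a p) i) ((T ^^ i) x))"
    by (rule poly_apply_bound) (rule degree_pCons_le)
  also have "\<dots> = sc a x + (\<Sum>i\<le>degree p. sc (coeff p i) (T ((T ^^ i) x)))"
    by (simp add: sum.atMost_Suc_shift del: sum.atMost_Suc)
  also have "(\<Sum>i\<le>degree p. sc (coeff p i) (T ((T ^^ i) x))) = (\<Sum>i\<le>degree p. T (sc (coeff p i) ((T ^^ i) x)))"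
    using iterate_in[OF assms] by (simp add: T_scale)
  also have "\<dots> = T (poly_apply x p)" unfolding poly_apply_def
    using iterate_in[OF assms] subspace_scale[OF W] by (intro T_sum[symmetric]) auto
  finally show ?thesis .
qed

lemma poly_apply_add: "poly_apply x (p + q) = poly_apply x p + poly_apply x q"
  unfolding poly_apply_bound[of "p + q" "max (degree p) (degree q)", OF degree_add_le_max]
    poly_apply_bound[of p "max (degree p) (degree q)", OF max.cobounded1]
    poly_apply_bound[of q "max (degree p) (degree q)", OF max.cobounded2]
  by (simp add: scale_left_distrib sum.distrib)

lemma poly_apply_zero [simp]: "poly_apply x 0 = 0"
  by (simp add: poly_apply_def)

lemma T_zero [simp]: "T 0 = 0"
  using T_sum[of "{}" "\<lambda>_. 0"] by simp

text \<open>A linear factor of the polynomial can be transferred to the vector, which allows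
  induction on the degree without composing operators.\<close>

lemma poly_apply_linear_factor:
  assumes x: "x \<in> W"
  shows "poly_apply x ([:- l, 1:] * q) = poly_apply (T x - sc l x) q"
proof (induction q)
  case (pCons a q)
  have y: "T x - sc l x \<in> W" using x W T by (simp add: subspace_diff subspace_scale)
  have "[:- l, 1:] * pCons a q = pCons 0 ([:- l, 1:] * q) + [:- (a * l), a:]" by (simp add: mult.commute)
  hence "poly_apply x ([:- l, 1:] * pCons a q) =
      T (poly_apply x ([:- l, 1:] * q)) + (sc a (T x) - sc (a * l) x)"
    using x W by (simp only: poly_apply_add poly_apply_pCons) (simp add: T_scale)
  also have "\<dots> = poly_apply (T x - sc l x) (pCons a q)"
    unfolding pCons poly_apply_pCons[OF y] by (simp add: scale_right_diff_distrib)
  finally show ?case .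
qed simp

text \<open>One iterate more than the number of spanning vectors must be linearly dependent, and the
  coefficients of the relation form the polynomial.\<close>

lemma dependent_iterates:
  assumes B: "finite B" and x: "\<And>i. (T ^^ i) x \<in> span B"
  shows "\<exists>p. p \<noteq> 0 \<and> poly_apply x p = 0"
proof (cases "inj_on (\<lambda>i. (T ^^ i) x) {..card B}")
  case True
  let ?S = "(\<lambda>i. (T ^^ i) x) ` {..card B}"
  have "card ?S = Suc (card B)" using card_image[OF True] by simp
  hence "dependent ?S" using independent_span_bound[OF B, of ?S] x by fastforce
  then obtain u v where u: "(\<Sum>v\<in>?S. sc (u v) v) = 0" "v \<in> ?S" "u v \<noteq> 0"
    using dependent_finite[of ?S] by auto
  define p where "p = (\<Sum>i\<le>card B. monom (u ((T ^^ i) x)) i)"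
  have c: "coeff p i = (if i \<le> card B then u ((T ^^ i) x) else 0)" for i
    by (simp add: p_def coeff_sum if_distrib cong: if_cong)
  have "degree p \<le> card B" by (rule degree_le) (simp add: c)
  hence "poly_apply x p = (\<Sum>i\<le>card B. sc (u ((T ^^ i) x)) ((T ^^ i) x))"
    by (simp add: poly_apply_bound c)
  also have "\<dots> = (\<Sum>v\<in>?S. sc (u v) v)" using sum.reindex[OF True, of "\<lambda>v. sc (u v) v"] by simp
  finally have "poly_apply x p = 0" using u by simp
  moreover obtain i where "i \<le> card B" "v = (T ^^ i) x" using u(2) by auto
  hence "coeff p i \<noteq> 0" using u(3) c by simp
  hence "p \<noteq> 0" by auto
  ultimately show ?thesis by blast
next
  case False
  \<comment> \<open>If iterates repeat, the set of iterates may be too small for the bound, but the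
    repetition is itself a relation.\<close>
  then obtain i j where ij: "i \<noteq> j" "(T ^^ i) x = (T ^^ j) x" by (auto simp: inj_on_def)
  let ?p = "monom 1 i - monom (1 :: complex) j"
  have "coeff ?p i \<noteq> 0" using ij by simp
  hence "?p \<noteq> 0" by (metis coeff_0)
  moreover have "poly_apply x ?p = 0"
  proof -
    have "degree ?p \<le> max i j" by (rule degree_diff_le) (auto simp: degree_monom_eq)
    hence "poly_apply x ?p = (\<Sum>k\<le>max i j. sc (coeff ?p k) ((T ^^ k) x))" by (rule poly_apply_bound)
    also have "\<dots> = (\<Sum>k\<le>max i j. (if k = i then (T ^^ i) x else 0)) - (\<Sum>k\<le>max i j. (if k = j then (T ^^ j) x else 0))"
      unfolding sum_subtractf[symmetric] by (rule sum.cong) (auto simp: scale_left_diff_distrib)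
    finally show ?thesis using ij by simp
  qed
  ultimately show ?thesis by blast
qed

text \<open>For a root l of p, either x is an eigenvector for l, or \<open>T x - sc l x\<close> is a
  nonzero vector annihilated by the quotient of p by the linear factor.\<close>

lemma eigenvector_of_annihilator:
  assumes "p \<noteq> 0" "x \<in> W" "x \<noteq> 0" "poly_apply x p = 0"
  shows "\<exists>l. \<exists>y\<in>W. y \<noteq> 0 \<and> T y = sc l y"
  using assms
proof (induction "degree p" arbitrary: p x)
  case 0
  then obtain c where c: "p = [:c:]" by (metis degree_eq_zeroE)
  have "sc c x = 0" using 0 poly_apply_pCons[of x c 0] by (simp add: c)
  thus ?case using 0 c by simp
next
  case (Suc n)
  have "\<not> constant (poly p)" using Suc(2) by (simp add: constant_degree)
  then obtain l where "poly p l = 0" using fundamental_theorem_of_algebra by blast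
  then obtain q where q: "p = [:- l, 1:] * q" using poly_eq_0_iff_dvd by blast
  have q0: "q \<noteq> 0" using Suc(3) q by auto
  have dq: "n = degree q" using Suc(2) q0 unfolding q by (subst (asm) degree_mult_eq) auto
  let ?y = "T x - sc l x"
  have y: "?y \<in> W" using Suc(4) W T by (simp add: subspace_diff subspace_scale)
  show ?case
  proof (cases "?y = 0")
    case True
    thus ?thesis using Suc(4,5) by auto
  next
    case False
    have "poly_apply ?y q = 0"
      using Suc(6) poly_apply_linear_factor[OF Suc(4)] unfolding q by simp
    thus ?thesis using Suc(1)[OF dq q0 y False] by blast
  qed
qed

lemma eigenvector_exists:
  assumes B: "finite B" "W \<subseteq> span B" and x: "x \<in> W" "x \<noteq> 0"
  shows "\<exists>l. \<exists>y\<in>W. y \<noteq> 0 \<and> T y = sc l y"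
proof -
  have "(T ^^ i) x \<in> span B" for i using iterate_in[OF x(1)] B by blast
  then obtain p where "p \<noteq> 0" "poly_apply x p = 0" using dependent_iterates[OF B(1)] by blast
  thus ?thesis using eigenvector_of_annihilator x by blast
qed

end

text \<open>The representation is viewed on K itself, with trivial action of the congruence subgroup
  of level 1. Cuspidality is stated for the lower unipotent radical alone, because the inducing
  characters depend on the lower left entry.\<close>

locale cuspidal_data = unramified_quad_ext E + vs: vector_space sc
  for E :: "('f::field, 'e::field) quad_ext" and sc :: "complex \<Rightarrow> 'w::ab_group_add \<Rightarrow> 'w" +
  fixes V :: "'w set" and \<rho> :: "'e mat2 \<Rightarrow> 'w \<Rightarrow> 'w" and \<psi>' :: "'f \<Rightarrow> complex" and \<theta> :: "'e \<Rightarrow> complex"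
  assumes level: "level_one_character E \<psi>'"
    and V: "vs.subspace V" and V_nonzero: "V \<noteq> {0}"
    and \<rho>_in: "k \<in> maxcpt E \<Longrightarrow> x \<in> V \<Longrightarrow> \<rho> k x \<in> V"
    and \<rho>_add: "k \<in> maxcpt E \<Longrightarrow> x \<in> V \<Longrightarrow> y \<in> V \<Longrightarrow> \<rho> k (x + y) = \<rho> k x + \<rho> k y"
    and \<rho>_scale: "k \<in> maxcpt E \<Longrightarrow> x \<in> V \<Longrightarrow> \<rho> k (sc c x) = sc c (\<rho> k x)"
    and \<rho>_one: "x \<in> V \<Longrightarrow> \<rho> (mat 1) x = x"
    and \<rho>_mult: "k \<in> maxcpt E \<Longrightarrow> h \<in> maxcpt E \<Longrightarrow> x \<in> V \<Longrightarrow> \<rho> (k ** h) x = \<rho> k (\<rho> h x)"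
    and \<rho>_trivial: "k \<in> congruence_subgroup 1 \<Longrightarrow> x \<in> V \<Longrightarrow> \<rho> k x = x"
    and \<rho>_irreducible: "vs.subspace U \<Longrightarrow> U \<subseteq> V \<Longrightarrow> (\<And>k x. k \<in> maxcpt E \<Longrightarrow> x \<in> U \<Longrightarrow> \<rho> k x \<in> U) \<Longrightarrow>
      U = {0} \<or> U = V"
    and \<rho>_cuspidal: "x \<in> V \<Longrightarrow> (\<And>s. s \<in> PF 0 \<Longrightarrow> \<rho> (mat22 1 0 (\<delta> * \<iota> s) 1) x = x) \<Longrightarrow> x = 0"
    and \<rho>_central: "z \<in> norm_one E \<Longrightarrow> x \<in> V \<Longrightarrow> \<rho> (mat z) x = sc (\<theta> z) x"
begin

lemma nonzero_vector: obtains x where "x \<in> V" "x \<noteq> 0"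
  using V_nonzero vs.subspace_0[OF V] by blast

lemma mat_mult: "mat z ** mat y = (mat (z * y) :: 'e mat2)"
  by (simp add: mat_mat22)

lemma \<theta>_hom:
  assumes "z \<in> norm_one E" "y \<in> norm_one E"
  shows "\<theta> (z * y) = \<theta> z * \<theta> y"
proof -
  obtain x where x: "x \<in> V" "x \<noteq> 0" by (rule nonzero_vector)
  have "sc (\<theta> (z * y)) x = \<rho> (mat z ** mat y) x"
    using \<rho>_central[of "z * y" x] assms x norm_one_closed by (simp add: mat_mult)
  also have "\<dots> = \<rho> (mat z) (sc (\<theta> y) x)"
    using assms x centre_maxcpt by (simp add: \<rho>_mult \<rho>_central)
  also have "\<dots> = sc (\<theta> z * \<theta> y) x"
    using assms x centre_maxcpt by (simp add: \<rho>_scale \<rho>_central mult.commute)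
  finally show ?thesis using x by simp
qed

lemma \<theta>_small:
  assumes "z \<in> norm_one E" "z - 1 \<in> PE 1"
  shows "\<theta> z = 1"
proof -
  obtain x where x: "x \<in> V" "x \<noteq> 0" by (rule nonzero_vector)
  have "mat z \<in> congruence_subgroup 1"
    using assms centre_maxcpt by (simp add: congruence_subgroup_def) (simp add: mcong_def mat_mat22)
  hence "sc (\<theta> z) x = sc 1 x" using \<rho>_trivial[OF _ x(1)] \<rho>_central[OF assms(1) x(1)] by simp
  thus ?thesis using x by (simp del: vs.scale_one)
qed

end

sublocale cuspidal_data \<subseteq> central_character_data E \<psi>' \<theta>
  using level \<theta>_hom \<theta>_small by unfold_locales

lemma (in nonarch_local_field) residues_sum_scale:
  assumes per: "\<And>x y. x \<in> pideal v 0 \<Longrightarrow> y \<in> pideal v 0 \<Longrightarrow> x - y \<in> pideal v 1 \<Longrightarrow> \<phi> x = \<phi> y"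
    and u: "u \<noteq> 0" "v u = 0"
  shows "(\<Sum>r\<in>residues. \<phi> (r * u)) = (\<Sum>r\<in>residues. \<phi> r)"
proof (rule sum.reindex_bij_witness[where j = "\<lambda>r. red (r * u)" and i = "\<lambda>r. red (r / u)"])
  fix r assume r: "r \<in> residues"
  hence rO: "r \<in> pideal v 0" "red r = r" by (simp_all add: residues_iff)
  have O: "r * u \<in> pideal v 0" "r / u \<in> pideal v 0" using rO u by (simp_all add: pideal_mult_iff pideal_divide_iff)
  show "red (r * u) \<in> residues" "red (r / u) \<in> residues" using O by (auto intro: red_in)
  have "(red (r * u) - r * u) / u \<in> pideal v 1" "(red (r / u) - r / u) * u \<in> pideal v 1"
    using red_close u by (simp_all add: pideal_mult_iff pideal_divide_iff)
  hence "red (r * u) / u - r \<in> pideal v 1" "red (r / u) * u - r \<in> pideal v 1"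
    using u by (simp_all add: diff_divide_distrib left_diff_distrib)
  thus "red (red (r * u) / u) = r" "red (red (r / u) * u) = r"
    using rO(2) red_eq_iff[of _ r] by metis+
  show "\<phi> (red (r * u)) = \<phi> (r * u)"
    using per[of "red (r * u)" "r * u"] red_close O by (simp add: red_integral)
qed

lemma (in nonarch_local_field) card_residues: "card residues \<noteq> 0"
  using red_in[of 0] finite_residues by (auto simp: card_eq_0_iff)

context cuspidal_data
begin

section \<open>The lower unipotent group and its Fourier projectors\<close>

definition low :: "'f \<Rightarrow> 'e mat2" where "low s = mat22 1 0 (\<delta> * \<iota> s) 1"

lemma low_K: "s \<in> PF 0 \<Longrightarrow> low s \<in> maxcpt E"
  by (simp add: low_def maxcpt_iff U11_iff integral_def mat_mat22)

lemma low_add: "low s ** low t = low (s + t)"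
  by (simp add: low_def algebra_simps)

lemma low_zero: "low 0 = mat 1"
  by (simp add: low_def mat_mat22)

lemma \<rho>_zero [simp]: "k \<in> maxcpt E \<Longrightarrow> \<rho> k 0 = 0"
  using \<rho>_scale[of k 0 0] vs.subspace_0[OF V] by simp

lemma \<rho>_sum:
  assumes "k \<in> maxcpt E" "finite S" "\<And>i. i \<in> S \<Longrightarrow> f i \<in> V"
  shows "\<rho> k (\<Sum>i\<in>S. f i) = (\<Sum>i\<in>S. \<rho> k (f i))"
  using assms(2,3)
proof (induction S rule: finite_induct)
  case (insert i S) thus ?case using vs.subspace_sum[OF V, of S f] assms(1) by (simp add: \<rho>_add)
qed (use assms in simp)

lemma \<rho>_cong:
  assumes "k \<in> maxcpt E" "h \<in> maxcpt E" "mcong 1 k h" "x \<in> V"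
  shows "\<rho> k x = \<rho> h x"
proof -
  have "mcong 1 (k ** star h) (h ** star h)"
    using assms by (intro mcong_mult_right) (auto simp: maxcpt_iff integral_star)
  hence n: "k ** star h \<in> congruence_subgroup 1"
    using assms by (simp add: congruence_subgroup_def maxcpt_mult maxcpt_star star_cancel maxcpt_U11)
  have "\<rho> ((k ** star h) ** h) x = \<rho> (k ** star h) (\<rho> h x)"
    using assms by (intro \<rho>_mult) (auto simp: maxcpt_mult maxcpt_star)
  thus ?thesis using \<rho>_trivial[OF n] \<rho>_in assms by (simp add: star_cancel maxcpt_U11)
qed

lemma low_cong:
  assumes "s \<in> PF 0" "t \<in> PF 0" "s - t \<in> PF 1" "x \<in> V"
  shows "\<rho> (low s) x = \<rho> (low t) x"
proof (rule \<rho>_cong)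
  have "\<delta> * \<iota> (s - t) \<in> PE 1" using assms by (simp only: rt_mult_PE incl_PE)
  thus "mcong 1 (low s) (low t)" by (simp add: mcong_def low_def algebra_simps)
qed (use assms low_K in auto)

lemma psi'_cong: "a - b \<in> PF 1 \<Longrightarrow> \<psi>' a = \<psi>' b"
  using psi'_add[of "a - b" b] psi'_trivial[of "a - b"] by simp

definition q :: complex where "q = of_nat (card F.residues)"

lemma q_nonzero [simp]: "q \<noteq> 0"
  using F.card_residues by (simp add: q_def)

text \<open>The Fourier projector for the character of parameter \<open>a\<close> of the lower
  unipotent group, taken over its quotient by \<open>PF 1\<close>. For integral \<open>a\<close> the
  summand depends only on the class of r.\<close>

definition proj :: "'f \<Rightarrow> 'w \<Rightarrow> 'w" where
  "proj a x = sc (1 / q) (\<Sum>r\<in>F.residues. sc (\<psi>' (- (a * r))) (\<rho> (low r) x))"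

lemma residues_integral: "r \<in> F.residues \<Longrightarrow> r \<in> PF 0"
  by (simp add: F.residues_iff)

lemma proj_in: "x \<in> V \<Longrightarrow> proj a x \<in> V"
  unfolding proj_def using V by (auto intro!: vs.subspace_scale vs.subspace_sum \<rho>_in low_K residues_integral)

lemma proj_add: "x \<in> V \<Longrightarrow> y \<in> V \<Longrightarrow> proj a (x + y) = proj a x + proj a y"
  unfolding proj_def by (simp add: \<rho>_add low_K residues_integral vs.scale_right_distrib sum.distrib)

lemma proj_scale: "x \<in> V \<Longrightarrow> proj a (sc c x) = sc c (proj a x)"
  unfolding proj_def by (simp add: \<rho>_scale low_K residues_integral vs.scale_sum_right mult_ac)

lemma term_periodic:
  assumes "a \<in> PF 0" "x \<in> V" "s \<in> PF 0" "t \<in> PF 0" "s - t \<in> PF 1"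
  shows "sc (\<psi>' (- (a * s))) (\<rho> (low s) x) = sc (\<psi>' (- (a * t))) (\<rho> (low t) x)"
proof -
  have "a * (t - s) \<in> PF 1" using assms by (intro F.pideal_mult_left) (auto simp: F.pideal_commute)
  hence "- (a * s) - - (a * t) \<in> PF 1" by (simp add: algebra_simps)
  from psi'_cong[OF this] show ?thesis using low_cong[OF assms(3-5,2)] by simp
qed

lemma proj_low:
  assumes a: "a \<in> PF 0" and x: "x \<in> V" and s: "s \<in> PF 0"
  shows "proj a (\<rho> (low s) x) = sc (\<psi>' (a * s)) (proj a x)"
proof -
  have "(\<Sum>r\<in>F.residues. sc (\<psi>' (- (a * r))) (\<rho> (low r) (\<rho> (low s) x))) =
      (\<Sum>r\<in>F.residues. sc (\<psi>' (a * s)) (sc (\<psi>' (- (a * (r + s)))) (\<rho> (low (r + s)) x)))"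
  proof (rule sum.cong[OF refl])
    fix r assume r: "r \<in> F.residues"
    have "- (a * r) = a * s + - (a * (r + s))" by (simp add: algebra_simps)
    hence "\<psi>' (- (a * r)) = \<psi>' (a * s) * \<psi>' (- (a * (r + s)))" using psi'_add by metis
    moreover have "\<rho> (low r) (\<rho> (low s) x) = \<rho> (low (r + s)) x"
      using \<rho>_mult[of "low r" "low s" x] low_K residues_integral[OF r] s x by (simp add: low_add)
    ultimately show "sc (\<psi>' (- (a * r))) (\<rho> (low r) (\<rho> (low s) x)) =
        sc (\<psi>' (a * s)) (sc (\<psi>' (- (a * (r + s)))) (\<rho> (low (r + s)) x))" by simp
  qed
  also have "\<dots> = sc (\<psi>' (a * s)) (\<Sum>r\<in>F.residues. sc (\<psi>' (- (a * (r + s)))) (\<rho> (low (r + s)) x))"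
    by (rule vs.scale_sum_right[symmetric])
  also have "(\<Sum>r\<in>F.residues. sc (\<psi>' (- (a * (r + s)))) (\<rho> (low (r + s)) x)) =
      (\<Sum>r\<in>F.residues. sc (\<psi>' (- (a * r))) (\<rho> (low r) x))"
    using term_periodic[OF a x] s by (rule F.residues_sum_translate)
  finally show ?thesis by (simp add: proj_def mult.commute)
qed

lemma low_proj:
  assumes a: "a \<in> PF 0" and x: "x \<in> V" and s: "s \<in> PF 0"
  shows "\<rho> (low s) (proj a x) = sc (\<psi>' (a * s)) (proj a x)"
proof -
  have c: "\<rho> (low s) (\<rho> (low r) x) = \<rho> (low r) (\<rho> (low s) x)" if "r \<in> F.residues" for r
    using \<rho>_mult[of "low r" "low s" x] \<rho>_mult[of "low s" "low r" x] low_K residues_integral[OF that] s x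
    by (simp add: low_add add.commute)
  have "\<rho> (low s) (proj a x) = proj a (\<rho> (low s) x)"
    unfolding proj_def using s x V F.finite_residues c
    by (simp add: \<rho>_scale \<rho>_sum low_K residues_integral \<rho>_in vs.subspace_scale vs.subspace_sum)
  thus ?thesis using proj_low[OF assms] by simp
qed

lemma proj_eigen:
  assumes "x \<in> V" "\<And>s. s \<in> PF 0 \<Longrightarrow> \<rho> (low s) x = sc (\<psi>' (a * s)) x"
  shows "proj a x = x"
proof -
  have "sc (\<psi>' (- (a * r))) (\<rho> (low r) x) = x" if "r \<in> F.residues" for r
    using assms(2)[OF residues_integral[OF that]] psi'_add[of "- (a * r)" "a * r"] by simp
  hence "(\<Sum>r\<in>F.residues. sc (\<psi>' (- (a * r))) (\<rho> (low r) x)) = sc q x"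
    by (simp add: q_def vs.sum_constant_scale)
  thus ?thesis by (simp add: proj_def)
qed

text \<open>Fourier inversion on the residue field: summing the characters over the parameter leaves
  only the class of r = 0, where \<open>low r\<close> acts trivially.\<close>

lemma proj_sum:
  assumes x: "x \<in> V"
  shows "(\<Sum>a\<in>F.residues. proj a x) = x"
proof -
  have orth: "(\<Sum>a\<in>F.residues. \<psi>' (- (a * r))) = (if r = F.red 0 then q else 0)" if r: "r \<in> F.residues" for r
  proof (cases "r = F.red 0")
    case True
    hence "r \<in> PF 1" using F.red_close[of 0] by simp
    hence "\<psi>' (- (a * r)) = 1" if "a \<in> F.residues" for a
      using F.pideal_mult_left[OF residues_integral[OF that], of r 1] by (simp add: psi'_trivial)
    thus ?thesis using True by (simp add: q_def)
  next
    case False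
    have rO: "r \<in> PF 0" using residues_integral[OF r] .
    have "r \<notin> PF 1" using False r F.red_eq_iff[of r 0] by (auto simp: F.residues_iff)
    hence ru: "r \<noteq> 0" "valF E r = 0" using F.unit_val rO by blast+
    obtain x0 where x0: "x0 \<in> PF 0" "\<psi>' x0 \<noteq> 1" by (rule level_one_witness)
    \<comment> \<open>Translating the summation variable by this s multiplies the sum by
      \<open>\<psi>' x0\<close>, which is not 1, so the sum vanishes.\<close>
    define s where "s = - x0 / r"
    have s: "s \<in> PF 0" using x0 ru by (simp add: s_def F.pideal_divide_iff del: minus_divide_left)
    have "(\<Sum>a\<in>F.residues. \<psi>' (- (a * r))) = (\<Sum>a\<in>F.residues. \<psi>' (- ((a + s) * r)))"
    proof (rule F.residues_sum_translate[symmetric, where \<phi> = "\<lambda>a. \<psi>' (- (a * r))", OF _ s])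
      fix a b assume "a - b \<in> PF 1"
      hence "(b - a) * r \<in> PF 1" using rO by (intro F.pideal_mult_right) (simp_all add: F.pideal_commute)
      thus "\<psi>' (- (a * r)) = \<psi>' (- (b * r))" by (intro psi'_cong) (simp add: algebra_simps)
    qed
    also have "\<dots> = (\<Sum>a\<in>F.residues. \<psi>' x0 * \<psi>' (- (a * r)))"
    proof -
      have "- ((a + s) * r) = x0 + - (a * r)" for a using ru by (simp add: s_def algebra_simps)
      thus ?thesis by (simp only: psi'_add)
    qed
    finally have "(\<Sum>a\<in>F.residues. \<psi>' (- (a * r))) = \<psi>' x0 * (\<Sum>a\<in>F.residues. \<psi>' (- (a * r)))"
      unfolding sum_distrib_left .
    thus ?thesis using x0 False by simp
  qed
  have "(\<Sum>a\<in>F.residues. proj a x) =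
      sc (1 / q) (\<Sum>r\<in>F.residues. \<Sum>a\<in>F.residues. sc (\<psi>' (- (a * r))) (\<rho> (low r) x))"
    unfolding proj_def vs.scale_sum_right[symmetric] by (subst sum.swap) simp
  also have "\<dots> = sc (1 / q) (\<Sum>r\<in>F.residues. if r = F.red 0 then sc q (\<rho> (low r) x) else 0)"
    unfolding vs.scale_sum_left[symmetric] by (intro arg_cong[where f = "sc (1 / q)"] sum.cong) (simp_all add: orth)
  also have "\<dots> = \<rho> (low (F.red 0)) x" using F.finite_residues F.red_in[of 0] by simp
  also have "\<dots> = \<rho> (low 0) x"
    using x F.red_close[of 0] by (intro low_cong) (simp_all add: F.red_integral)
  finally show ?thesis using x by (simp add: low_zero \<rho>_one)
qed

definition torus :: "'e \<Rightarrow> 'e mat2" where "torus y = mat22 y 0 0 (1 / bar y)"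

lemma torus_K: "y \<noteq> 0 \<Longrightarrow> valE E y = 0 \<Longrightarrow> torus y \<in> maxcpt E"
  by (simp add: torus_def maxcpt_iff U11_iff integral_def mat_mat22 pideal_def E.val_divide)

text \<open>The diagonal torus permutes the nontrivial characters of the unipotent radical transitively.\<close>

lemma proj_torus:
  assumes y: "y \<noteq> 0" "valE E y = 0" and x: "x \<in> V" and a: "a \<in> PF 0" and N: "y * bar y = \<iota> n"
  shows "proj (a * n) (\<rho> (torus y) x) = \<rho> (torus y) (proj a x)"
proof -
  have "\<iota> n \<noteq> 0" unfolding N[symmetric] using y by simp
  hence n: "n \<noteq> 0" "valF E n = 0"
    using N y E.val_mult[of y "bar y"] valE_incl[of n] by auto
  have dK: "torus y \<in> maxcpt E" using torus_K y by blast
  have c: "\<rho> (low r) (\<rho> (torus y) x) = \<rho> (torus y) (\<rho> (low (r * n)) x)" if "r \<in> F.residues" for r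
  proof -
    have rO: "r \<in> PF 0" "r * n \<in> PF 0" using residues_integral[OF that] n by (simp_all add: F.pideal_mult_iff)
    have "\<iota> r * y = 1 / bar y * (\<iota> r * \<iota> n)" unfolding N[symmetric] using y by simp
    hence "\<delta> * \<iota> r * y = 1 / bar y * (\<delta> * (\<iota> r * \<iota> n))" by (metis mult.assoc mult.left_commute)
    hence "low r ** torus y = torus y ** low (r * n)" by (simp add: low_def torus_def)
    thus ?thesis using \<rho>_mult[of "low r" "torus y" x] \<rho>_mult[of "torus y" "low (r * n)" x] low_K rO dK x by simp
  qed
  have O: "r * n \<in> PF 0" if "r \<in> PF 0" for r using that n by (simp add: F.pideal_mult_iff)
  have "\<rho> (torus y) (proj a x) = sc (1 / q) (\<Sum>r\<in>F.residues. \<rho> (torus y) (sc (\<psi>' (- (a * r))) (\<rho> (low r) x)))"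
    unfolding proj_def using dK x V F.finite_residues
    by (simp add: \<rho>_scale \<rho>_sum low_K residues_integral \<rho>_in vs.subspace_scale vs.subspace_sum)
  also have "(\<Sum>r\<in>F.residues. \<rho> (torus y) (sc (\<psi>' (- (a * r))) (\<rho> (low r) x))) =
      (\<Sum>r\<in>F.residues. \<rho> (torus y) (sc (\<psi>' (- (a * (r * n)))) (\<rho> (low (r * n)) x)))"
    by (rule F.residues_sum_scale[symmetric, where \<phi> = "\<lambda>r. \<rho> (torus y) (sc (\<psi>' (- (a * r))) (\<rho> (low r) x))", OF _ n])
      (intro arg_cong[where f = "\<rho> (torus y)"] term_periodic[OF a x])
  also have "\<dots> = (\<Sum>r\<in>F.residues. sc (\<psi>' (- (a * n * r))) (\<rho> (low r) (\<rho> (torus y) x)))"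
    using c x dK by (intro sum.cong refl) (simp add: \<rho>_scale \<rho>_in low_K O residues_integral mult_ac)
  finally show ?thesis by (simp add: proj_def)
qed

lemma proj_cong:
  assumes "a - b \<in> PF 1"
  shows "proj a x = proj b x"
proof -
  have "\<psi>' (- (a * r)) = \<psi>' (- (b * r))" if "r \<in> F.residues" for r
  proof (rule psi'_cong)
    have "(b - a) * r \<in> PF 1" using assms residues_integral[OF that]
      by (intro F.pideal_mult_right) (simp_all add: F.pideal_commute)
    thus "- (a * r) - - (b * r) \<in> PF 1" by (simp add: algebra_simps)
  qed
  thus ?thesis by (simp add: proj_def)
qed

text \<open>Some Fourier component of x is nonzero, and cuspidality excludes the trivial character,
  so its parameter a is a unit. A torus element whose norm is \<open>\<epsilon> / a\<close> modulo p
  carries this component to the parameter \<open>\<epsilon>\<close>.\<close>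

lemma proj_eps_nonzero:
  assumes x: "x \<in> V" "x \<noteq> 0"
  shows "\<exists>y. y \<noteq> 0 \<and> valE E y = 0 \<and> proj \<epsilon> (\<rho> (torus y) x) \<noteq> 0"
proof -
  have "\<exists>a\<in>F.residues. proj a x \<noteq> 0" using proj_sum[OF x(1)] x(2) by (metis sum.neutral)
  then obtain a where a: "a \<in> F.residues" "proj a x \<noteq> 0" by blast
  have aO: "a \<in> PF 0" using residues_integral[OF a(1)] .
  have "a \<notin> PF 1"
  proof
    assume a1: "a \<in> PF 1"
    have "\<rho> (low s) (proj a x) = proj a x" if "s \<in> PF 0" for s
      using low_proj[OF aO x(1) that] F.pideal_mult_right[OF a1 that] by (simp add: psi'_trivial)
    hence "proj a x = 0" using proj_in[OF x(1)] by (intro \<rho>_cuspidal) (simp_all add: low_def)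
    with a show False by simp
  qed
  hence au: "a \<noteq> 0" "valF E a = 0" using F.unit_val aO by blast+
  have "\<epsilon> / a \<in> PF 0" using au eps_unit by (simp add: pideal_def F.val_divide)
  then obtain y where y: "y \<in> PE 0" "y * bar y - \<iota> (\<epsilon> / a) \<in> PE 1" using norm_surjective by blast
  define n where "n = re (y * bar y)"
  have n: "y * bar y = \<iota> n" unfolding n_def by (rule bar_fixed) (simp add: mult.commute)
  have "\<iota> (n - \<epsilon> / a) \<in> PE 1" using y(2) by (simp add: n del: incl_divide)
  hence n1: "n - \<epsilon> / a \<in> PF 1" by (simp only: incl_PE)
  have "y \<notin> PE 1"
  proof
    assume "y \<in> PE 1"
    hence "y * bar y \<in> PE 1" using y(1) by (intro E.pideal_mult_right) simp_all
    hence "n \<in> PF 1" unfolding n by simp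
    hence "\<epsilon> / a \<in> PF 1" using F.pideal_diff[OF _ n1, of n] by simp
    thus False using au eps_unit by (simp add: pideal_def F.val_divide)
  qed
  hence yu: "y \<noteq> 0" "valE E y = 0" using E.unit_val y(1) by blast+
  have "a * (n - \<epsilon> / a) \<in> PF 1" using n1 aO by (intro F.pideal_mult_left)
  hence "a * n - \<epsilon> \<in> PF 1" using au by (simp add: algebra_simps)
  hence "proj \<epsilon> (\<rho> (torus y) x) = \<rho> (torus y) (proj a x)"
    using proj_torus[OF yu x(1) aO n] proj_cong[of "a * n" \<epsilon>] by simp
  moreover have "\<rho> (torus y) (proj a x) \<noteq> 0"
  proof
    assume z: "\<rho> (torus y) (proj a x) = 0"
    have K: "torus y \<in> maxcpt E" using torus_K yu by blast
    have "\<rho> (star (torus y) ** torus y) (proj a x) = 0"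
      using \<rho>_mult[of "star (torus y)" "torus y"] K maxcpt_star proj_in[OF x(1)] z by simp
    thus False using K proj_in[OF x(1)] a(2) by (simp add: star_cancel maxcpt_U11 \<rho>_one)
  qed
  ultimately show ?thesis using yu by auto
qed

text \<open>The parameter is \<open>\<epsilon>\<close> because \<open>\<kappa> 0 * (\<delta> *
  \<iota> s) = \<iota> (\<epsilon> * s)\<close>: with this choice the character is the restriction
  of \<open>Omega 0\<close> to the matrices \<open>low s\<close>.\<close>

definition whittaker_space :: "'w set" where
  "whittaker_space = {x \<in> V. \<forall>s\<in>PF 0. \<rho> (low s) x = sc (\<psi>' (\<epsilon> * s)) x}"

text \<open>Since \<open>proj \<epsilon>\<close> is the identity on \<open>whittaker_space\<close>,
  this restricts there to the operator of g in the Hecke algebra of the Whittaker character.\<close>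

definition hecke :: "'e mat2 \<Rightarrow> 'w \<Rightarrow> 'w" where
  "hecke g x = proj \<epsilon> (\<rho> g x)"

lemma eps_PF: "\<epsilon> \<in> PF 0"
  using eps_unit by (simp add: pideal_def)

lemma proj_whittaker_space: "x \<in> V \<Longrightarrow> proj \<epsilon> x \<in> whittaker_space"
  using proj_in low_proj[OF eps_PF] by (simp add: whittaker_space_def)

lemma whittaker_space_V: "x \<in> whittaker_space \<Longrightarrow> x \<in> V"
  by (simp add: whittaker_space_def)

lemma whittaker_space_low: "x \<in> whittaker_space \<Longrightarrow> s \<in> PF 0 \<Longrightarrow> \<rho> (low s) x = sc (\<psi>' (\<epsilon> * s)) x"
  by (simp add: whittaker_space_def)

lemma whittaker_space_proj: "x \<in> whittaker_space \<Longrightarrow> proj \<epsilon> x = x"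
  by (rule proj_eigen) (auto simp: whittaker_space_def)

lemma whittaker_space_subspace: "vs.subspace whittaker_space"
  unfolding vs.subspace_def whittaker_space_def
  using V by (auto simp: vs.subspace_add vs.subspace_0 vs.subspace_scale \<rho>_add \<rho>_scale low_K
      vs.scale_right_distrib mult.commute)

lemma hecke_in: "g \<in> maxcpt E \<Longrightarrow> x \<in> V \<Longrightarrow> hecke g x \<in> whittaker_space"
  by (simp add: hecke_def proj_whittaker_space \<rho>_in)

lemma hecke_add: "g \<in> maxcpt E \<Longrightarrow> x \<in> V \<Longrightarrow> y \<in> V \<Longrightarrow> hecke g (x + y) = hecke g x + hecke g y"
  by (simp add: hecke_def \<rho>_add \<rho>_in proj_add)

lemma hecke_scale: "g \<in> maxcpt E \<Longrightarrow> x \<in> V \<Longrightarrow> hecke g (sc c x) = sc c (hecke g x)"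
  by (simp add: hecke_def \<rho>_scale \<rho>_in proj_scale)

lemma hecke_sum:
  assumes "g \<in> maxcpt E" "finite S" "\<And>i. i \<in> S \<Longrightarrow> f i \<in> V"
  shows "hecke g (\<Sum>i\<in>S. f i) = (\<Sum>i\<in>S. hecke g (f i))"
  using assms(2,3)
proof (induction S rule: finite_induct)
  case empty
  thus ?case using hecke_scale[OF assms(1) vs.subspace_0[OF V], of 0] by simp
next
  case (insert i S) thus ?case using vs.subspace_sum[OF V, of S f] assms(1) by (simp add: hecke_add)
qed

lemma hecke_low_left:
  assumes "s \<in> PF 0" "g \<in> maxcpt E" "x \<in> V"
  shows "hecke (low s ** g) x = sc (\<psi>' (\<epsilon> * s)) (hecke g x)"
  using assms proj_low[OF eps_PF] low_K by (simp add: hecke_def \<rho>_mult \<rho>_in)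

lemma hecke_low_right:
  assumes "s \<in> PF 0" "g \<in> maxcpt E" "x \<in> whittaker_space"
  shows "hecke (g ** low s) x = sc (\<psi>' (\<epsilon> * s)) (hecke g x)"
  using assms low_K whittaker_space_V by (simp add: hecke_def \<rho>_mult whittaker_space_low \<rho>_scale \<rho>_in proj_scale)

text \<open>Transposition conjugated by the antidiagonal Weyl element: an anti-automorphism that
  fixes every lower unipotent matrix.\<close>

definition flip :: "'e mat2 \<Rightarrow> 'e mat2" where
  "flip g = mat22 (g $ 2 $ 2) (g $ 1 $ 2) (g $ 2 $ 1) (g $ 1 $ 1)"

lemma flip_mat22 [simp]: "flip (mat22 a b c d) = mat22 d b c a"
  by (simp add: flip_def)

lemma flip_mult: "flip (g ** h) = flip h ** flip g"
  by (simp add: flip_def mat2_eq_iff matrix_matrix_mult_def sum_2 algebra_simps)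

lemma flip_low [simp]: "flip (low s) = low s"
  by (simp add: low_def)

lemma flip_K:
  assumes "g \<in> maxcpt E" shows "flip g \<in> maxcpt E"
proof -
  obtain a b c d where g: "g = mat22 a b c d" by (cases g)
  note r = relations[OF maxcpt_U11[OF assms[unfolded g]]]
  have "flip g \<in> U11 E" unfolding g flip_mat22 U11_iff
    using r by (simp add: mat_mat22 algebra_simps)
  thus ?thesis using assms by (simp add: maxcpt_iff integral_def flip_def)
qed

text \<open>Modulo p such a g is lower triangular and its diagonal part changes the Whittaker
  character. Equivariance of the operator on the left and on the right then yields two different
  scalars.\<close>

lemma hecke_zero:
  assumes g: "g \<in> maxcpt E" and b: "g $ 1 $ 2 \<in> PE 1" and d: "g $ 2 $ 2 * bar (g $ 2 $ 2) - 1 \<notin> PE 1"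
    and x: "x \<in> whittaker_space"
  shows "hecke g x = 0"
proof -
  obtain a b c e where ge: "g = mat22 a b c e" by (cases g)
  note O = maxcpt_entries[OF g[unfolded ge]] and r = relations[OF maxcpt_U11[OF g[unfolded ge]]]
  define n where "n = re (e * bar e)"
  have n: "e * bar e = \<iota> n" unfolding n_def by (rule bar_fixed) (simp add: mult.commute)
  have "\<iota> (n - 1) \<notin> PE 1" using d n by (simp add: ge)
  hence n1: "n - 1 \<notin> PF 1" unfolding incl_PE .
  have "e * bar e \<in> PE 0" using O by (simp add: E.pideal_mult_left)
  hence nO: "n \<in> PF 0" unfolding n by simp
  have "n - 1 \<in> PF 0" using nO by (simp add: F.pideal_diff)
  hence nu: "n - 1 \<noteq> 0" "valF E (n - 1) = 0" using F.unit_val n1 by blast+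
  obtain x0 where x0: "x0 \<in> PF 0" "\<psi>' x0 \<noteq> 1" by (rule level_one_witness)
  \<comment> \<open>Chosen so that the two arguments \<open>\<epsilon> * s\<close> and
    \<open>\<epsilon> * (s * n)\<close> differ by x0.\<close>
  define s where "s = x0 / (\<epsilon> * (n - 1))"
  have s: "s \<in> PF 0" using x0 nu eps_unit by (simp add: s_def F.pideal_divide_iff F.val_mult)
  have sn: "s * n \<in> PF 0" using s nO by (simp add: F.pideal_mult_left)
  have b1: "b \<in> PE 1" using b ge by simp
  have ds: "\<delta> * \<iota> s \<in> PE 0" using s by simp
  \<comment> \<open>Conjugation by g multiplies the parameter of a lower unipotent by the norm n, up
    to terms containing b, which vanish modulo p.\<close>
  have "mcong 1 (g ** low s ** star g) (low (s * n))"
  proof -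
    have "b * bar e \<in> PE 1" "b * bar b \<in> PE 1" "e * bar b \<in> PE 1"
      using b1 O by (simp_all add: E.pideal_mult_right E.pideal_mult_left)
    hence 1: "\<delta> * \<iota> s * (b * bar e) \<in> PE 1" "\<delta> * \<iota> s * (b * bar b) \<in> PE 1" "\<delta> * \<iota> s * (e * bar b) \<in> PE 1"
      using E.pideal_mult_left[OF ds] by blast+
    have "g ** low s ** star g = mat22 ((a * bar e + b * bar c) + \<delta> * \<iota> s * (b * bar e))
        ((a * bar b + b * bar a) + \<delta> * \<iota> s * (b * bar b)) ((c * bar e + e * bar c) + \<delta> * \<iota> s * (e * bar e))
        ((e * bar a + c * bar b) + \<delta> * \<iota> s * (e * bar b))"
      by (simp add: ge low_def algebra_simps)
    thus ?thesis unfolding r n using 1 by (simp add: mcong_def low_def)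
  qed
  moreover have K: "g ** low s ** star g \<in> maxcpt E" using g low_K[OF s] maxcpt_mult maxcpt_star by blast
  moreover have y: "\<rho> g x \<in> V" using g x \<rho>_in whittaker_space_V by blast
  ultimately have "\<rho> (g ** low s ** star g) (\<rho> g x) = \<rho> (low (s * n)) (\<rho> g x)"
    using low_K[OF sn] by (intro \<rho>_cong)
  moreover have "\<rho> (g ** low s ** star g) (\<rho> g x) = \<rho> (g ** low s) x"
    using \<rho>_mult[OF K g whittaker_space_V[OF x]] g by (simp add: star_cancel maxcpt_U11)
  ultimately have "hecke (g ** low s) x = hecke (low (s * n) ** g) x"
    unfolding hecke_def using \<rho>_mult[OF low_K[OF sn] g whittaker_space_V[OF x]] by simp
  hence "sc (\<psi>' (\<epsilon> * s)) (hecke g x) = sc (\<psi>' (\<epsilon> * (s * n))) (hecke g x)"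
    using hecke_low_left[OF sn g whittaker_space_V[OF x]] hecke_low_right[OF s g x] by simp
  moreover have "\<epsilon> * (s * n) = x0 + \<epsilon> * s" using nu by (simp add: s_def field_simps)
  ultimately have "sc (\<psi>' (\<epsilon> * s)) (hecke g x) = sc (\<psi>' x0 * \<psi>' (\<epsilon> * s)) (hecke g x)" by (simp only: psi'_add)
  thus ?thesis using x0 by simp
qed

text \<open>By the Bruhat decomposition, the anti-involution acts trivially on the Hecke algebra of the Whittaker character;
  hence this algebra is commutative.\<close>

lemma hecke_flip:
  assumes g: "g \<in> maxcpt E" and x: "x \<in> whittaker_space"
  shows "hecke (flip g) x = hecke g x"
proof -
  obtain a b c e where ge: "g = mat22 a b c e" by (cases g)
  note O = maxcpt_entries[OF g[unfolded ge]] and r = relations[OF maxcpt_U11[OF g[unfolded ge]]]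
  show ?thesis
  proof (cases "b \<in> PE 1")
    case True
    have "bar a * e - 1 = - (bar c * b)" using r(1) by (simp add: algebra_simps)
    hence ae: "bar a * e - 1 \<in> PE 1" using True O by (simp add: E.pideal_mult_left)
    have "bar (bar a * e - 1) \<in> PE 1" using ae unfolding bar_PE .
    hence "(bar a * e) * (a * bar e) - 1 \<in> PE 1" by (intro E.one_plus_mult[OF ae]) simp_all
    hence N: "(a * bar a) * (e * bar e) - 1 \<in> PE 1" by (simp add: mult_ac)
    show ?thesis
    proof (cases "a * bar a - 1 \<in> PE 1")
      case aa: True
      have au: "a \<noteq> 0" "valE E a = 0"
        using E.one_plus_unit[OF aa] E.val_mult[of a "bar a"] by auto
      \<comment> \<open>For a lower triangular g modulo p with a of norm one, both diagonal entries
        agree modulo p, so \<open>flip g\<close> and g have the same action.\<close>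
      have "(bar a * e - 1) - (a * bar a - 1) \<in> PE 1" using ae aa by (rule E.pideal_diff)
      hence "bar a * (e - a) \<in> PE 1" by (simp add: algebra_simps)
      hence "e - a \<in> PE 1" using au by (simp add: E.pideal_mult_iff')
      hence "mcong 1 (flip g) g" by (simp add: ge mcong_def E.pideal_commute)
      thus ?thesis using \<rho>_cong[OF flip_K[OF g] g] whittaker_space_V[OF x] by (simp add: hecke_def)
    next
      case False
      have ee: "e * bar e - 1 \<notin> PE 1"
      proof
        assume e1: "e * bar e - 1 \<in> PE 1"
        note u = E.one_plus_unit[OF e1]
        have "((a * bar a) * (e * bar e) - 1) - (e * bar e - 1) \<in> PE 1" using N e1 by (rule E.pideal_diff)
        hence "(a * bar a - 1) * (e * bar e) \<in> PE 1" by (simp add: algebra_simps)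
        thus False using False E.pideal_mult_iff[OF u(1)] u by simp
      qed
      \<comment> \<open>Otherwise neither diagonal entry has norm one modulo p, and both operators
        vanish.\<close>
      have "hecke g x = 0" using hecke_zero[OF g _ _ x] True ee by (simp add: ge)
      moreover have "hecke (flip g) x = 0" using hecke_zero[OF flip_K[OF g] _ _ x] True False by (simp add: ge)
      ultimately show ?thesis by simp
    qed
  next
    case False
    hence bu: "b \<noteq> 0" "valE E b = 0" using E.unit_val O by blast+
    have "bar (a / b) = - (a / b)" using r(7) bu by (simp add: field_simps eq_neg_iff_add_eq_0)
    then obtain s where s: "a / b = \<delta> * \<iota> s" using bar_antifixed by blast
    have "bar (e / b) = - (e / b)" using r(4) bu by (simp add: field_simps eq_neg_iff_add_eq_0)
    then obtain t where t: "e / b = \<delta> * \<iota> t" using bar_antifixed by blast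
    have "a / b \<in> PE 0" "e / b \<in> PE 0" using O bu by (simp_all add: E.pideal_divide_iff)
    hence st: "s \<in> PF 0" "t \<in> PF 0" unfolding s t by simp_all
    hence st': "- s \<in> PF 0" "- t \<in> PF 0" by simp_all
    \<comment> \<open>In the big cell the lower unipotents on both sides clear the diagonal. The
      remaining m is antidiagonal, hence fixed by \<open>flip\<close>, and exchanging s and t does
      not matter because both act by scalars.\<close>
    define m where "m = low (- t) ** g ** low (- s)"
    have mK: "m \<in> maxcpt E" unfolding m_def using low_K st' g maxcpt_mult by blast
    have ab: "a = b * (\<delta> * \<iota> s)" "e = b * (\<delta> * \<iota> t)" using s t bu by (simp_all add: field_simps)
    have "m $ 1 $ 1 = 0" "m $ 2 $ 2 = 0" by (simp_all add: m_def ge low_def ab)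
    hence fm: "flip m = m" by (simp add: flip_def mat2_eq_iff)
    have "low t ** m ** low s = (low t ** low (- t)) ** g ** (low (- s) ** low s)"
      unfolding m_def by (simp only: matrix_mul_assoc)
    hence gm: "g = low t ** m ** low s" by (simp add: low_add low_zero)
    hence "flip g = flip (low t ** m ** low s)" by simp
    also have "\<dots> = low s ** m ** low t" by (simp add: flip_mult fm matrix_mul_assoc)
    finally have fg: "flip g = low s ** m ** low t" .
    have "hecke g x = sc (\<psi>' (\<epsilon> * s)) (sc (\<psi>' (\<epsilon> * t)) (hecke m x))"
      unfolding gm using hecke_low_right[OF st(1) _ x] hecke_low_left[OF st(2) mK whittaker_space_V[OF x]] low_K st mK maxcpt_mult
      by simp
    moreover have "hecke (flip g) x = sc (\<psi>' (\<epsilon> * t)) (sc (\<psi>' (\<epsilon> * s)) (hecke m x))"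
      unfolding fg using hecke_low_right[OF st(2) _ x] hecke_low_left[OF st(1) mK whittaker_space_V[OF x]] low_K st mK maxcpt_mult
      by simp
    ultimately show ?thesis by (simp add: mult.commute)
  qed
qed

lemma hecke_hecke:
  assumes g: "g \<in> maxcpt E" and h: "h \<in> maxcpt E" and x: "x \<in> V"
  shows "hecke g (hecke h x) =
    sc (1 / q) (\<Sum>r\<in>F.residues. sc (\<psi>' (- (\<epsilon> * r))) (hecke (g ** low r ** h) x))"
proof -
  have hx: "\<rho> h x \<in> V" using h x \<rho>_in by blast
  have t: "\<rho> (low r) (\<rho> h x) \<in> V" if "r \<in> F.residues" for r
    using that hx \<rho>_in low_K residues_integral by blast
  have "hecke g (hecke h x) = hecke g (sc (1 / q) (\<Sum>r\<in>F.residues. sc (\<psi>' (- (\<epsilon> * r))) (\<rho> (low r) (\<rho> h x))))"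
    by (simp add: hecke_def[of h] proj_def)
  also have "\<dots> = sc (1 / q) (\<Sum>r\<in>F.residues. sc (\<psi>' (- (\<epsilon> * r))) (hecke g (\<rho> (low r) (\<rho> h x))))"
    using g t V F.finite_residues
    by (simp add: hecke_scale hecke_sum vs.subspace_scale vs.subspace_sum)
  also have "hecke g (\<rho> (low r) (\<rho> h x)) = hecke (g ** low r ** h) x" if "r \<in> F.residues" for r
    using that g h x low_K residues_integral by (simp add: hecke_def \<rho>_mult maxcpt_mult \<rho>_in)
  hence "(\<Sum>r\<in>F.residues. sc (\<psi>' (- (\<epsilon> * r))) (hecke g (\<rho> (low r) (\<rho> h x)))) =
      (\<Sum>r\<in>F.residues. sc (\<psi>' (- (\<epsilon> * r))) (hecke (g ** low r ** h) x))" by (intro sum.cong) simp_all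
  finally show ?thesis .
qed

text \<open>The product is a sum of operators of \<open>g ** low r ** h\<close>. Applying
  \<open>flip\<close> to each term reverses the order of the factors and keeps \<open>low r\<close>,
  which gives the sum for the opposite product.\<close>

lemma hecke_commute:
  assumes g: "g \<in> maxcpt E" and h: "h \<in> maxcpt E" and x: "x \<in> whittaker_space"
  shows "hecke g (hecke h x) = hecke h (hecke g x)"
proof -
  have "hecke g (hecke h x) =
      sc (1 / q) (\<Sum>r\<in>F.residues. sc (\<psi>' (- (\<epsilon> * r))) (hecke (flip h ** low r ** flip g) x))"
  proof -
    have "hecke (g ** low r ** h) x = hecke (flip h ** low r ** flip g) x" if "r \<in> F.residues" for r
    proof -
      have "g ** low r ** h \<in> maxcpt E" using that g h low_K residues_integral maxcpt_mult by blast
      moreover have "flip (g ** low r ** h) = flip h ** low r ** flip g" by (simp add: flip_mult matrix_mul_assoc)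
      ultimately show ?thesis using hecke_flip[OF _ x] by metis
    qed
    thus ?thesis unfolding hecke_hecke[OF g h whittaker_space_V[OF x]] by (intro arg_cong[where f = "sc (1 / q)"] sum.cong) simp_all
  qed
  also have "\<dots> = hecke (flip h) (hecke (flip g) x)"
    using hecke_hecke[OF flip_K[OF h] flip_K[OF g] whittaker_space_V[OF x]] by simp
  also have "\<dots> = hecke h (hecke g x)"
    using hecke_flip[OF g x] hecke_flip[OF h hecke_in[OF g whittaker_space_V[OF x]]] by simp
  finally show ?thesis .
qed

section \<open>Uniqueness of the Whittaker vector\<close>

lemma span_orbit:
  assumes x: "x \<in> V" "x \<noteq> 0"
  shows "vs.span ((\<lambda>k. \<rho> k x) ` maxcpt E) = V"
proof -
  let ?O = "(\<lambda>k. \<rho> k x) ` maxcpt E"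
  have sub: "vs.span ?O \<subseteq> V" using x \<rho>_in V by (intro vs.span_minimal) auto
  have inv: "y \<in> V \<and> \<rho> k y \<in> vs.span ?O" if k: "k \<in> maxcpt E" and y: "y \<in> vs.span ?O" for k y
    using y
  proof (induction y rule: vs.span_induct_alt)
    case base thus ?case using k vs.span_zero vs.subspace_0[OF V] by simp
  next
    case (step c y z)
    then obtain h where h: "h \<in> maxcpt E" "y = \<rho> h x" by blast
    have yV: "y \<in> V" using h x \<rho>_in by blast
    have "\<rho> k y = \<rho> (k ** h) x" using h k x \<rho>_mult by simp
    hence "\<rho> k y \<in> vs.span ?O" using h k maxcpt_mult by (auto intro: vs.span_base)
    moreover have "\<rho> k (sc c y + z) = sc c (\<rho> k y) + \<rho> k z"
      using yV step k V by (simp add: \<rho>_add \<rho>_scale vs.subspace_scale)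
    ultimately show ?case using step yV V
      by (simp add: vs.span_add vs.span_scale vs.subspace_add vs.subspace_scale)
  qed
  have "\<rho> (mat 1) x \<in> ?O" by (rule imageI) simp
  hence "x \<in> vs.span ?O" using \<rho>_one[OF x(1)] by (simp add: vs.span_base)
  hence "vs.span ?O \<noteq> {0}" using x by auto
  moreover have "vs.span ?O = {0} \<or> vs.span ?O = V"
    using inv by (intro \<rho>_irreducible vs.subspace_span sub) blast
  ultimately show ?thesis by simp
qed

text \<open>The congruence subgroup of level 1 acts trivially and has finite index. Together with
  \<open>span_orbit\<close> this supplies the finite spanning set needed for an eigenvector.\<close>

lemma finite_orbit:
  assumes x: "x \<in> V"
  shows "finite ((\<lambda>k. \<rho> k x) ` maxcpt E)"
proof -
  interpret finite_index_normal "congruence_subgroup 1" "Kgrp E" by (rule congruence_finite_index)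
  have "(\<lambda>k. \<rho> k x) ` maxcpt E \<subseteq> (\<lambda>C. \<rho> (rep C) x) ` (rcosets\<^bsub>Kgrp E\<^esub> congruence_subgroup 1)"
  proof
    fix y assume "y \<in> (\<lambda>k. \<rho> k x) ` maxcpt E"
    then obtain k where k: "k \<in> maxcpt E" "y = \<rho> k x" by blast
    obtain n where n: "n \<in> congruence_subgroup 1" "rep (congruence_subgroup 1 #>\<^bsub>Kgrp E\<^esub> k) = n ** k"
      using rep_eq[of k] k by auto
    have "\<rho> (n ** k) x = y" using n k x \<rho>_in \<rho>_trivial \<rho>_mult[of n k x] by (simp add: congruence_subgroup_def)
    moreover have "congruence_subgroup 1 #>\<^bsub>Kgrp E\<^esub> k \<in> rcosets\<^bsub>Kgrp E\<^esub> congruence_subgroup 1"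
      using rcosetsI[OF subset, of k] k by simp
    ultimately show "y \<in> (\<lambda>C. \<rho> (rep C) x) ` (rcosets\<^bsub>Kgrp E\<^esub> congruence_subgroup 1)" using n by force
  qed
  thus ?thesis using finite_rcosets finite_surj by blast
qed

text \<open>The orbit of x spans V, so its projections, the vectors \<open>hecke g x\<close>, span
  the Whittaker space.\<close>

lemma whittaker_space_generated:
  assumes S: "vs.subspace S" and x: "x \<in> whittaker_space" "x \<noteq> 0" and orbit: "\<And>g. g \<in> maxcpt E \<Longrightarrow> hecke g x \<in> S"
  shows "whittaker_space \<subseteq> S"
proof
  fix w assume w: "w \<in> whittaker_space"
  have span: "vs.span ((\<lambda>k. \<rho> k x) ` maxcpt E) = V" using span_orbit[OF whittaker_space_V[OF x(1)] x(2)] .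
  have "y \<in> V \<and> proj \<epsilon> y \<in> S" if "y \<in> vs.span ((\<lambda>k. \<rho> k x) ` maxcpt E)" for y
    using that
  proof (induction y rule: vs.span_induct_alt)
    case base
    have "proj \<epsilon> 0 = 0" using proj_scale[of 0 \<epsilon> 0] vs.subspace_0[OF V] by simp
    thus ?case using vs.subspace_0[OF S] vs.subspace_0[OF V] by simp
  next
    case (step c y z)
    then obtain h where h: "h \<in> maxcpt E" "y = \<rho> h x" by blast
    have yV: "y \<in> V" using h whittaker_space_V[OF x(1)] \<rho>_in by blast
    have "proj \<epsilon> y \<in> S" using orbit[OF h(1)] h(2) by (simp add: hecke_def)
    thus ?case using step yV V S by (simp add: proj_add proj_scale vs.subspace_scale vs.subspace_add)
  qed
  hence "proj \<epsilon> w \<in> S" using whittaker_space_V[OF w] span by blast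
  thus "w \<in> S" using whittaker_space_proj[OF w] by simp
qed

text \<open>Schur's argument: an eigenvector y of \<open>hecke g\<close> exists, the operators
  commute, so all \<open>hecke h y\<close> lie in the same eigenspace, which is therefore the whole
  Whittaker space.\<close>

lemma hecke_scalar:
  assumes g: "g \<in> maxcpt E"
  shows "\<exists>l. \<forall>x\<in>whittaker_space. hecke g x = sc l x"
proof (cases "\<exists>x\<in>whittaker_space. x \<noteq> 0")
  case True
  then obtain x where x: "x \<in> whittaker_space" "x \<noteq> 0" by blast
  interpret T: stable_subspace sc whittaker_space "hecke g"
    using whittaker_space_subspace hecke_in[OF g whittaker_space_V] hecke_add[OF g whittaker_space_V whittaker_space_V] hecke_scale[OF g whittaker_space_V]
    by unfold_locales auto
  have "whittaker_space \<subseteq> vs.span ((\<lambda>k. \<rho> k x) ` maxcpt E)"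
    using span_orbit[OF whittaker_space_V[OF x(1)] x(2)] whittaker_space_V by blast
  then obtain l y where y: "y \<in> whittaker_space" "y \<noteq> 0" "hecke g y = sc l y"
    using T.eigenvector_exists[OF finite_orbit[OF whittaker_space_V[OF x(1)]] _ x] by blast
  define S where "S = {w \<in> whittaker_space. hecke g w = sc l w}"
  have "hecke g 0 = 0" using hecke_scale[OF g vs.subspace_0[OF V], of 0] by simp
  hence S: "vs.subspace S" unfolding S_def vs.subspace_def
    using whittaker_space_subspace whittaker_space_V g by (auto simp: vs.subspace_add vs.subspace_0 vs.subspace_scale hecke_add hecke_scale
        vs.scale_right_distrib mult.commute)
  have "hecke h y \<in> S" if h: "h \<in> maxcpt E" for h
    using hecke_commute[OF g h y(1)] y hecke_in[OF h whittaker_space_V] hecke_scale[OF h whittaker_space_V[OF y(1)]] by (simp add: S_def)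
  hence "whittaker_space \<subseteq> S" by (rule whittaker_space_generated[OF S y(1,2)])
  thus ?thesis by (auto simp: S_def)
next
  case False
  have z: "hecke g 0 = 0" using hecke_scale[OF g vs.subspace_0[OF V], of 0] by simp
  have "hecke g x = sc 0 x" if "x \<in> whittaker_space" for x
  proof -
    have "x = 0" using False that by blast
    thus ?thesis using z by simp
  qed
  thus ?thesis by blast
qed

text \<open>A nonzero vector comes from \<open>proj_eps_nonzero\<close>. As all Hecke operators are
  scalars, the vectors it generates stay on its line.\<close>

lemma whittaker_space_line:
  obtains v where "v \<in> whittaker_space" "v \<noteq> 0" "\<And>w. w \<in> whittaker_space \<Longrightarrow> \<exists>!c. w = sc c v"
proof -
  obtain x where x: "x \<in> V" "x \<noteq> 0" by (rule nonzero_vector)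
  obtain y where y: "y \<noteq> 0" "valE E y = 0" "proj \<epsilon> (\<rho> (torus y) x) \<noteq> 0" using proj_eps_nonzero[OF x] by blast
  define v where "v = proj \<epsilon> (\<rho> (torus y) x)"
  have v: "v \<in> whittaker_space" "v \<noteq> 0" using proj_whittaker_space \<rho>_in torus_K x y by (simp_all add: v_def)
  have "vs.subspace (range (\<lambda>c. sc c v))" unfolding vs.subspace_def
    by (auto simp flip: vs.scale_left_distrib intro: range_eqI[of _ _ 0])
  moreover have "hecke g v \<in> range (\<lambda>c. sc c v)" if "g \<in> maxcpt E" for g
    using hecke_scalar[OF that] v by blast
  ultimately have "whittaker_space \<subseteq> range (\<lambda>c. sc c v)" using whittaker_space_generated v by blast
  hence "\<exists>!c. w = sc c v" if "w \<in> whittaker_space" for w using that v by auto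
  thus ?thesis using that v by blast
qed

section \<open>The Whittaker functional and its equivariance\<close>

definition whittaker_vector :: 'w where
  "whittaker_vector = (SOME v. v \<in> whittaker_space \<and> v \<noteq> 0 \<and> (\<forall>w\<in>whittaker_space. \<exists>!c. w = sc c v))"

lemma whittaker_vector: "whittaker_vector \<in> whittaker_space" "whittaker_vector \<noteq> 0" "w \<in> whittaker_space \<Longrightarrow> \<exists>!c. w = sc c whittaker_vector"
proof -
  have "\<exists>v. v \<in> whittaker_space \<and> v \<noteq> 0 \<and> (\<forall>w\<in>whittaker_space. \<exists>!c. w = sc c v)" using whittaker_space_line by metis
  from someI_ex[OF this, folded whittaker_vector_def]
  show "whittaker_vector \<in> whittaker_space" "whittaker_vector \<noteq> 0" "w \<in> whittaker_space \<Longrightarrow> \<exists>!c. w = sc c whittaker_vector" by blast+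
qed

definition whittaker :: "'w \<Rightarrow> complex" where
  "whittaker x = (THE c. proj \<epsilon> x = sc c whittaker_vector)"

lemma whittaker_eq: "x \<in> V \<Longrightarrow> proj \<epsilon> x = sc (whittaker x) whittaker_vector"
  unfolding whittaker_def by (rule theI') (rule whittaker_vector(3)[OF proj_whittaker_space])

lemma whittaker_eqI: "x \<in> V \<Longrightarrow> proj \<epsilon> x = sc c whittaker_vector \<Longrightarrow> whittaker x = c"
  using whittaker_eq[of x] whittaker_vector(2) by simp

lemma whittaker_base: "whittaker whittaker_vector = 1"
  using whittaker_vector whittaker_space_V whittaker_space_proj by (intro whittaker_eqI) auto

lemma whittaker_add: "x \<in> V \<Longrightarrow> y \<in> V \<Longrightarrow> whittaker (x + y) = whittaker x + whittaker y"
  using V by (intro whittaker_eqI) (simp_all add: proj_add whittaker_eq vs.scale_left_distrib vs.subspace_add)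

lemma whittaker_scale: "x \<in> V \<Longrightarrow> whittaker (sc c x) = c * whittaker x"
  using V by (intro whittaker_eqI) (simp_all add: proj_scale whittaker_eq vs.subspace_scale)

lemma whittaker_zero [simp]: "whittaker 0 = 0"
  using whittaker_scale[of 0 0] vs.subspace_0[OF V] by simp

text \<open>A vector is detected by the values of the functional along its torus orbit. This yields
  injectivity when the values of a function on K are replaced by their images under the
  functional.\<close>

lemma whittaker_faithful:
  assumes "x \<in> V" "x \<noteq> 0"
  shows "\<exists>y. y \<noteq> 0 \<and> valE E y = 0 \<and> whittaker (\<rho> (torus y) x) \<noteq> 0"
proof -
  obtain y where y: "y \<noteq> 0" "valE E y = 0" "proj \<epsilon> (\<rho> (torus y) x) \<noteq> 0" using proj_eps_nonzero[OF assms] by blast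
  thus ?thesis using whittaker_eq[of "\<rho> (torus y) x"] \<rho>_in torus_K assms by force
qed

text \<open>Modulo p such a k is a scalar z in E^1 times some \<open>low s\<close>: b vanishes, and
  unitarity makes the second diagonal entry congruent to z. Both factors change the functional by a
  scalar.\<close>

lemma whittaker_borel:
  assumes k: "k \<in> maxcpt E" and k12: "k $ 1 $ 2 \<in> PE 1" and k11: "k $ 1 $ 1 * bar (k $ 1 $ 1) - 1 \<in> PE 1" and x: "x \<in> V"
  shows "whittaker (\<rho> k x) = Omega 0 k * whittaker x"
proof -
  obtain a b c e where ke: "k = mat22 a b c e" by (cases k)
  note O = maxcpt_entries[OF k[unfolded ke]] and r = relations[OF maxcpt_U11[OF k[unfolded ke]]]
  have aN: "a * bar a - 1 \<in> PE 1" and b1: "b \<in> PE 1" using k11 k12 by (simp_all add: ke)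
  obtain z where z: "z \<in> norm_one E" "a - z \<in> PE 1" using norm_near_one[OF aN] by auto
  note zu = norm_one_unit[OF z(1)]
  have au: "a \<noteq> 0" "valE E a = 0" using E.one_plus_unit[OF aN] E.val_mult[of a "bar a"] by auto
  have "bar (c / a) = - (c / a)" using r(3) au by (simp add: field_simps eq_neg_iff_add_eq_0)
  then obtain s where s: "c / a = \<delta> * \<iota> s" using bar_antifixed by blast
  have "c / a \<in> PE 0" using O au by (simp add: E.pideal_divide_iff)
  hence sO: "s \<in> PF 0" unfolding s by simp
  have c: "c = a * (\<delta> * \<iota> s)" using s au by (simp add: field_simps)
  have bz: "bar z * z = 1" using z(1) by (simp add: norm_one_def mult.commute)
  have "mcong 1 k (mat z ** low s)"
  proof -
    have "bar a * e - 1 = - (bar c * b)" using r(1) by (simp add: algebra_simps)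
    hence ae: "bar a * e - 1 \<in> PE 1" using b1 O by (simp add: E.pideal_mult_left)
    have "bar (a - z) \<in> PE 1" using z(2) unfolding bar_PE .
    hence "bar (a - z) * e \<in> PE 1" using O by (intro E.pideal_mult_right)
    hence "(bar a * e - 1) - bar (a - z) * e \<in> PE 1" by (rule E.pideal_diff[OF ae])
    moreover have "(bar a * e - 1) - bar (a - z) * e = bar z * (e - z)" using bz by (simp add: algebra_simps)
    ultimately have "bar z * (e - z) \<in> PE 1" by simp
    hence "e - z \<in> PE 1" using zu by (simp add: E.pideal_mult_iff')
    moreover have "\<delta> * \<iota> s \<in> PE 0" using sO by simp
    hence "(a - z) * (\<delta> * \<iota> s) \<in> PE 1" using z(2) by (intro E.pideal_mult_right[of "a - z"]) simp_all
    ultimately show ?thesis using z(2) b1 by (simp add: mcong_def ke low_def mat_mat22 c algebra_simps)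
  qed
  hence "\<rho> k x = \<rho> (mat z ** low s) x"
    using k x centre_maxcpt[OF z(1)] low_K[OF sO] maxcpt_mult by (intro \<rho>_cong)
  also have "\<dots> = sc (\<theta> z) (\<rho> (low s) x)"
    using centre_maxcpt[OF z(1)] low_K[OF sO] x z(1) by (simp add: \<rho>_mult \<rho>_central \<rho>_in)
  finally have "\<rho> k x = sc (\<theta> z) (\<rho> (low s) x)" .
  hence "whittaker (\<rho> k x) = \<theta> z * (\<psi>' (\<epsilon> * s) * whittaker x)"
    using x sO low_K \<rho>_in proj_low[OF eps_PF x sO] whittaker_eq[OF x] whittaker_eqI[of "\<rho> (low s) x" "\<psi>' (\<epsilon> * s) * whittaker x"]
    by (simp add: whittaker_scale)
  moreover have "Omega 0 k = \<theta> z * \<psi>' (\<epsilon> * s)"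
    unfolding Omega_def ke mat22_nth s kappa_rt psi_incl theta_ext_eq[OF z] by simp
  ultimately show ?thesis by simp
qed

end

section \<open>The pieces of the restriction\<close>

context cuspidal_data
begin

text \<open>Conjugation by \<open>diag(\<pi>^m, \<pi>^n)\<close> with \<open>m - n = d\<close>.\<close>

definition beta_conj :: "nat \<Rightarrow> 'e mat2 \<Rightarrow> 'e mat2" where
  "beta_conj d h = mat22 (h $ 1 $ 1) (\<iota> (\<pi> ^ d) * h $ 1 $ 2) (h $ 2 $ 1 / \<iota> (\<pi> ^ d)) (h $ 2 $ 2)"

text \<open>The subgroup of K on which \<open>beta_conj d\<close> remains integral; it describes the
  ambiguity in factorisations through \<open>beta d\<close>.\<close>

definition Hgrp :: "nat \<Rightarrow> 'e mat2 set" where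
  "Hgrp d = {h \<in> maxcpt E. h $ 2 $ 1 \<in> PE (int d)}"

lemma val_iota_unif: "valE E (\<iota> (\<pi> ^ d)) = int d"
  using val_unif_power[of d] valE_incl[of "\<pi> ^ d"] by simp

lemma unif_PE: "\<iota> (\<pi> ^ d) \<in> PE (int d)"
  using val_unif_power[of d] by (simp only: incl_PE) (simp add: pideal_def)

lemma beta_conj_K:
  assumes "h \<in> Hgrp d"
  shows "beta_conj d h \<in> maxcpt E"
proof -
  obtain a b c e where h: "h = mat22 a b c e" by (cases h)
  have K: "mat22 a b c e \<in> maxcpt E" and c: "c \<in> PE (int d)" using assms by (simp_all add: Hgrp_def h)
  note O = maxcpt_entries[OF K] and r = relations[OF maxcpt_U11[OF K]]
  have "c / \<iota> (\<pi> ^ d) \<in> PE 0" using c val_iota_unif[of d] by (subst E.pideal_divide_iff) simp_all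
  moreover have "\<iota> (\<pi> ^ d) * b \<in> PE 0" using E.pideal_mult_le[OF unif_PE O(2), of 0 d] by simp
  moreover have "beta_conj d h \<in> U11 E"
  proof -
    define p where "p = \<iota> (\<pi> ^ d)"
    have p: "p \<noteq> 0" "bar p = p" by (simp_all add: p_def)
    have hp: "beta_conj d h = mat22 a (p * b) (c / p) e" by (simp add: beta_conj_def h p_def)
    have 1: "bar e * a + (p * bar b) * (c / p) = 1" using r(2) p by (simp add: field_simps)
    have 2: "bar e * (p * b) + (p * bar b) * e = 0"
    proof -
      have "bar e * (p * b) + (p * bar b) * e = p * (bar b * e + bar e * b)" by (simp add: algebra_simps)
      thus ?thesis using r(4) by simp
    qed
    have 3: "(bar c / p) * a + bar a * (c / p) = 0"
    proof -
      have "(bar c / p) * a + bar a * (c / p) = (bar a * c + bar c * a) / p" by (simp add: add_divide_distrib mult.commute)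
      thus ?thesis using r(3) by simp
    qed
    have 4: "(bar c / p) * (p * b) + bar a * e = 1" using r(1) p by (simp add: field_simps)
    show ?thesis unfolding U11_iff hp by (simp only: star_mat22 bar_mult bar_divide p(2) mat22_mult 1 2 3 4 mat_mat22)
  qed
  ultimately show ?thesis using O by (simp add: maxcpt_iff integral_def beta_conj_def h)
qed

lemma beta_conj_mult: "beta_conj d (g ** h) = beta_conj d g ** beta_conj d h"
  by (simp add: beta_conj_def mat2_eq_iff matrix_matrix_mult_def sum_2) (simp add: field_simps)

lemma Hgrp_mult: "g \<in> Hgrp d \<Longrightarrow> h \<in> Hgrp d \<Longrightarrow> g ** h \<in> Hgrp d"
  using maxcpt_mult[of g h]
  by (auto simp: Hgrp_def matrix_matrix_mult_def sum_2 maxcpt_iff integral_def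
      intro!: E.pideal_add intro: E.pideal_mult_left E.pideal_mult_right)

lemma Hgrp_star: "h \<in> Hgrp d \<Longrightarrow> star h \<in> Hgrp d"
  using maxcpt_star[of h] by (simp add: Hgrp_def) (simp add: star_def)

lemma Hgrp_K: "h \<in> Hgrp d \<Longrightarrow> h \<in> maxcpt E"
  by (simp add: Hgrp_def)

lemma Hgrp_cancel:
  assumes h: "h \<in> Hgrp d" and k: "k \<in> maxcpt E"
  shows "h ** k \<in> Hgrp d \<longleftrightarrow> k \<in> Hgrp d"
proof
  assume "h ** k \<in> Hgrp d"
  from Hgrp_mult[OF Hgrp_star[OF h] this] show "k \<in> Hgrp d"
    using h by (simp add: Hgrp_K star_cancel maxcpt_U11)
qed (use Hgrp_mult h in blast)

text \<open>The contribution of one double coset: the representation of K induced from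
  \<open>Hgrp d\<close>, which acts on V through conjugation by \<open>beta d\<close>.\<close>

definition pieces :: "nat \<Rightarrow> ('e mat2 \<Rightarrow> 'w) set" where
  "pieces d = {F. (\<forall>x. x \<notin> maxcpt E \<longrightarrow> F x = 0) \<and> (\<forall>x\<in>maxcpt E. F x \<in> V) \<and>
     (\<forall>h\<in>Hgrp d. \<forall>x\<in>maxcpt E. F (h ** x) = \<rho> (beta_conj d h) (F x))}"

lemma pieces_V: "F \<in> pieces d \<Longrightarrow> F x \<in> V"
  using vs.subspace_0[OF V] by (cases "x \<in> maxcpt E") (auto simp: pieces_def)

lemma pieces_add: "F \<in> pieces d \<Longrightarrow> F' \<in> pieces d \<Longrightarrow> (\<lambda>x. F x + F' x) \<in> pieces d"
  using beta_conj_K V by (auto simp: pieces_def \<rho>_add vs.subspace_add)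

lemma pieces_scale: "F \<in> pieces d \<Longrightarrow> (\<lambda>x. sc c (F x)) \<in> pieces d"
  using beta_conj_K V by (auto simp: pieces_def \<rho>_scale vs.subspace_scale)

lemma pieces_zero: "(\<lambda>x. 0) \<in> pieces d"
  using beta_conj_K vs.subspace_0[OF V] by (auto simp: pieces_def)

definition translateK :: "'e mat2 \<Rightarrow> ('e mat2 \<Rightarrow> 'w) \<Rightarrow> 'e mat2 \<Rightarrow> 'w" where
  "translateK g F x = (if x \<in> maxcpt E then F (x ** g) else 0)"

lemma pieces_translate: "F \<in> pieces d \<Longrightarrow> g \<in> maxcpt E \<Longrightarrow> translateK g F \<in> pieces d"
  using maxcpt_mult Hgrp_K by (auto simp: pieces_def translateK_def simp flip: matrix_mul_assoc)

lemma Dgrp_Hgrp: "h \<in> Dgrp 1 d \<Longrightarrow> h \<in> Hgrp d"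
  by (simp add: Dgrp_def Hgrp_def)

lemma Omega_beta_conj: "Omega d h = Omega 0 (beta_conj d h)"
proof -
  have "\<kappa> d * (h $ 2 $ 1 / h $ 1 $ 1) = \<kappa> 0 * (h $ 2 $ 1 / \<iota> (\<pi> ^ d) / h $ 1 $ 1)"
    by (simp add: \<kappa>_def)
  thus ?thesis by (simp add: Omega_def beta_conj_def)
qed

text \<open>This is induction in stages, in disguise: the functional turns equivariance under V into
  equivariance under a character of the smaller group. Injectivity uses the torus, and surjectivity
  the irreducibility of the target, so the restriction of the representation to a Borel subgroup
  need not be described.\<close>

lemma whittaker_bij:
  assumes d: "0 < d"
  shows "bij_betw (\<lambda>F x. whittaker (F x)) (pieces d) (finite_index_normal.char_space (Kgrp E) (Dgrp 1 d) (Omega d))"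
proof -
  interpret finite_index_normal "congruence_subgroup (d + 1)" "Kgrp E" by (rule congruence_finite_index)
  have m: "mackey (Dgrp 1 d) (Omega d)" using d by (intro Omega_mackey) simp_all
  let ?L = "\<lambda>F x. whittaker (F x)"
  have into: "?L F \<in> char_space (Dgrp 1 d) (Omega d)" if F: "F \<in> pieces d" for F
  proof -
    have "whittaker (F (h ** x)) = Omega d h * whittaker (F x)" if h: "h \<in> Dgrp 1 d" and x: "x \<in> maxcpt E" for h x
    proof -
      have H: "h \<in> Hgrp d" using Dgrp_Hgrp h by blast
      have "h $ 1 $ 2 \<in> PE 0" using Hgrp_K[OF H] by (simp add: maxcpt_iff integral_def)
      \<comment> \<open>Here d > 0 matters: the factor \<open>\<pi>^d\<close> makes the conjugated
        element lower triangular modulo p.\<close>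
      hence 12: "beta_conj d h $ 1 $ 2 \<in> PE 1" using E.pideal_mult_le[OF unif_PE, of "h $ 1 $ 2" 0 1 d] d by (simp add: beta_conj_def)
      have "h $ 1 $ 1 * bar (h $ 1 $ 1) - 1 \<in> PE (int 1)" using h by (simp add: Dgrp_def)
      hence 11: "beta_conj d h $ 1 $ 1 * bar (beta_conj d h $ 1 $ 1) - 1 \<in> PE 1" by (simp add: beta_conj_def)
      have "F (h ** x) = \<rho> (beta_conj d h) (F x)" using F H x by (simp add: pieces_def)
      thus ?thesis using whittaker_borel[OF beta_conj_K[OF H] 12 11 pieces_V[OF F]] by (simp add: Omega_beta_conj[of d h])
    qed
    thus ?thesis using F by (simp add: char_space_def) (simp add: pieces_def)
  qed
  have faithful: "F = (\<lambda>x. 0)" if F: "F \<in> pieces d" and z: "\<And>x. whittaker (F x) = 0" for F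
  proof (rule ccontr)
    assume "F \<noteq> (\<lambda>x. 0)"
    then obtain x where x: "F x \<noteq> 0" by blast
    hence xK: "x \<in> maxcpt E" using F by (auto simp: pieces_def)
    obtain y where y: "y \<noteq> 0" "valE E y = 0" "whittaker (\<rho> (torus y) (F x)) \<noteq> 0"
      using whittaker_faithful[OF pieces_V[OF F] x] by blast
    have "torus y \<in> Hgrp d" using torus_K[OF y(1,2)] by (simp add: Hgrp_def) (simp add: torus_def)
    \<comment> \<open>Diagonal matrices commute with \<open>beta d\<close>, so left translation of
      the argument realises every torus action on the value at x.\<close>
    moreover have "beta_conj d (torus y) = torus y" by (simp add: beta_conj_def torus_def)
    ultimately have "F (torus y ** x) = \<rho> (torus y) (F x)" using F xK by (simp add: pieces_def)
    thus False using z y by metis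
  qed
  have inj: "inj_on ?L (pieces d)"
  proof (rule inj_onI)
    fix F F' assume F: "F \<in> pieces d" "F' \<in> pieces d" "?L F = ?L F'"
    have "(\<lambda>x. F x + sc (- 1) (F' x)) = (\<lambda>x. 0)"
    proof (rule faithful)
      show "(\<lambda>x. F x + sc (- 1) (F' x)) \<in> pieces d" using F pieces_add pieces_scale by blast
      show "whittaker (F x + sc (- 1) (F' x)) = 0" for x
        using fun_cong[OF F(3), of x] whittaker_add[OF pieces_V[OF F(1)] pieces_V[OF pieces_scale[OF F(2)]], of x "- 1" x]
          whittaker_scale[OF pieces_V[OF F(2)], of "- 1" x] by (simp del: vs.scale_minus_left)
    qed
    thus "F = F'" by (simp add: fun_eq_iff)
  qed
  \<comment> \<open>Supported on \<open>Hgrp d\<close>, with the Whittaker vector as its value at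
    the identity; this shows that the image is nonzero.\<close>
  define F0 where "F0 x = (if x \<in> Hgrp d then \<rho> (beta_conj d x) whittaker_vector else 0)" for x
  have bV: "whittaker_vector \<in> V" using whittaker_vector whittaker_space_V by blast
  have F0: "F0 \<in> pieces d"
    using bV beta_conj_K Hgrp_K Hgrp_cancel vs.subspace_0[OF V]
    by (auto simp: pieces_def F0_def \<rho>_in beta_conj_mult \<rho>_mult)
  have F01: "whittaker (F0 (mat 1)) = 1"
  proof -
    have "mat 1 \<in> Hgrp d" by (simp add: Hgrp_def) (simp add: mat_def)
    moreover have "beta_conj d (mat 1) = mat 1" by (simp add: beta_conj_def mat_mat22)
    ultimately show ?thesis by (simp add: F0_def \<rho>_one bV whittaker_base)
  qed
  have "?L ` pieces d = char_space (Dgrp 1 d) (Omega d)"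
  proof (rule mackey_irreducible[OF m])
    show "stable (?L ` pieces d)" unfolding stable_def
    proof (intro conjI ballI allI)
      show "(\<lambda>x. 0) \<in> ?L ` pieces d" using pieces_zero by (rule image_eqI[rotated]) simp
      fix f assume "f \<in> ?L ` pieces d"
      then obtain F where F: "F \<in> pieces d" "f = ?L F" by blast
      show "(\<lambda>x. c * f x) \<in> ?L ` pieces d" for c
        using pieces_scale[OF F(1)] by (rule image_eqI[rotated]) (simp add: F whittaker_scale pieces_V[OF F(1)])
      show "translate g f \<in> ?L ` pieces d" if "g \<in> carrier (Kgrp E)" for g
        using pieces_translate[OF F(1)] that
        by (intro image_eqI[where x = "translateK g F"]) (auto simp: F translate_def translateK_def fun_eq_iff)
      fix f' assume "f' \<in> ?L ` pieces d"
      then obtain F' where F': "F' \<in> pieces d" "f' = ?L F'" by blast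
      show "(\<lambda>x. f x + f' x) \<in> ?L ` pieces d"
        using pieces_add[OF F(1) F'(1)]
        by (rule image_eqI[rotated]) (simp add: F F' whittaker_add pieces_V[OF F(1)] pieces_V[OF F'(1)])
    qed
    show "?L F0 \<in> ?L ` pieces d" using F0 by blast
    show "?L F0 \<noteq> (\<lambda>x. 0)" using F01 by (metis zero_neq_one)
  qed (use into in blast)
  thus ?thesis using inj by (simp add: bij_betw_def)
qed

section \<open>The isomorphisms from the pieces to the representations \<open>S_rep\<close>\<close>

definition to_S :: "nat \<Rightarrow> ('e mat2 \<Rightarrow> 'w) \<Rightarrow> 'e mat2 \<Rightarrow> complex" where
  "to_S d F = finite_index_normal.intertwiner (congruence_subgroup (d + 1)) (Kgrp E) (ZUJ E d) (Omega d)
     (\<lambda>x. whittaker (F x))"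

lemma to_S_bij:
  assumes d: "0 < d"
  shows "bij_betw (to_S d) (pieces d) (vs (S_rep E \<psi>' \<theta> d))"
proof -
  interpret finite_index_normal "congruence_subgroup (d + 1)" "Kgrp E" by (rule congruence_finite_index)
  have m: "mackey (Dgrp 1 d) (Omega d)" using d by (intro Omega_mackey) simp_all
  have m': "mackey (ZUJ E d) (Omega d)"
    unfolding ZUJ_eq[OF d] using half_indices[OF d] by (rule Omega_mackey)
  have "bij_betw (intertwiner (ZUJ E d) (Omega d) \<circ> (\<lambda>F x. whittaker (F x))) (pieces d) (char_space (ZUJ E d) (Omega d))"
    by (rule bij_betw_trans[OF whittaker_bij[OF d] intertwiner_bij[OF m m']]) simp
  thus ?thesis by (simp add: S_rep_eq[OF d] to_S_def[abs_def] comp_def)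
qed

lemma to_S_add:
  assumes "F \<in> pieces d" "F' \<in> pieces d"
  shows "to_S d (\<lambda>x. F x + F' x) = (\<lambda>x. to_S d F x + to_S d F' x)"
proof -
  interpret finite_index_normal "congruence_subgroup (d + 1)" "Kgrp E" by (rule congruence_finite_index)
  show ?thesis unfolding to_S_def
    by (simp only: whittaker_add[OF pieces_V[OF assms(1)] pieces_V[OF assms(2)]] intertwiner_add)
qed

lemma to_S_scale:
  assumes "F \<in> pieces d"
  shows "to_S d (\<lambda>x. sc c (F x)) = (\<lambda>x. c * to_S d F x)"
proof -
  interpret finite_index_normal "congruence_subgroup (d + 1)" "Kgrp E" by (rule congruence_finite_index)
  show ?thesis unfolding to_S_def by (simp only: whittaker_scale[OF pieces_V[OF assms]] intertwiner_scale)
qed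

lemma to_S_translate:
  assumes "g \<in> maxcpt E"
  shows "to_S d (translateK g F) = (\<lambda>x. if x \<in> maxcpt E then to_S d F (x ** g) else 0)"
proof -
  interpret finite_index_normal "congruence_subgroup (d + 1)" "Kgrp E" by (rule congruence_finite_index)
  have "(\<lambda>x. whittaker (translateK g F x)) = translate g (\<lambda>x. whittaker (F x))"
    by (auto simp: translateK_def translate_def)
  hence "to_S d (translateK g F) = translate g (to_S d F)"
    unfolding to_S_def using intertwiner_translate[of g] assms by (simp only: matgrp_simps)
  thus ?thesis by (simp add: translate_def cong: if_cong)
qed

section \<open>The Cartan decomposition\<close>

text \<open>The coset of the unitary group consisting of the similitudes with multiplier \<open>\<pi>^(-e)\<close>.\<close>

definition simil :: "nat \<Rightarrow> 'e mat2 set" where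
  "simil e = {y. star y ** y = mat (\<iota> (1 / \<pi> ^ e))}"

text \<open>The exponents are the floor and the ceiling of d/2, up to sign. They differ by the
  parity of d, so a single family covers both multipliers.\<close>

definition beta :: "nat \<Rightarrow> 'e mat2" where
  "beta d = mat22 (\<iota> (\<pi> ^ (d div 2))) 0 0 (\<iota> (1 / \<pi> ^ ((d + 1) div 2)))"

text \<open>A measure of size invariant under K on both sides; it separates the double cosets and
  expresses compactness of supports.\<close>

definition pole_le :: "nat \<Rightarrow> 'e mat2 \<Rightarrow> bool" where
  "pole_le M y \<longleftrightarrow> y $ 1 $ 1 \<in> PE (- int M) \<and> y $ 1 $ 2 \<in> PE (- int M) \<and> y $ 2 $ 1 \<in> PE (- int M) \<and> y $ 2 $ 2 \<in> PE (- int M)"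

lemma mat_commute: "mat z ** g = g ** mat z" for g :: "'e mat2"
  by (cases g) (simp add: mat_mat22 mult.commute)

lemma simil_mult_left: "k \<in> maxcpt E \<Longrightarrow> y \<in> simil e \<Longrightarrow> k ** y \<in> simil e"
  by (simp add: simil_def star_mult star_cancel maxcpt_U11 flip: matrix_mul_assoc)

lemma simil_mult_right:
  assumes k: "k \<in> maxcpt E" and y: "y \<in> simil e"
  shows "y ** k \<in> simil e"
proof -
  have "star (y ** k) ** (y ** k) = star k ** (star y ** y) ** k" by (simp add: star_mult matrix_mul_assoc)
  also have "\<dots> = mat (\<iota> (1 / \<pi> ^ e)) ** (star k ** k)"
    using y by (simp add: simil_def mat_commute[symmetric] matrix_mul_assoc del: incl_divide incl_power)
  finally show ?thesis using k by (simp add: simil_def star_cancel maxcpt_U11)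
qed

lemma simil_right:
  assumes "y \<in> simil e" shows "y ** star y = mat (\<iota> (1 / \<pi> ^ e))"
proof -
  have m: "mat (\<iota> (\<pi> ^ e)) ** mat (\<iota> (1 / \<pi> ^ e)) = (mat 1 :: 'e mat2)" by (simp add: mat_mult)
  hence "(mat (\<iota> (\<pi> ^ e)) ** star y) ** y = mat 1"
    using assms by (simp add: simil_def del: incl_divide incl_power flip: matrix_mul_assoc)
  hence "y ** (mat (\<iota> (\<pi> ^ e)) ** star y) = mat 1" by (simp only: matrix_left_right_inverse)
  moreover have "mat (\<iota> (\<pi> ^ e)) ** (y ** star y) = y ** (mat (\<iota> (\<pi> ^ e)) ** star y)"
    unfolding matrix_mul_assoc mat_commute[of "\<iota> (\<pi> ^ e)" y] ..
  ultimately have "mat (\<iota> (\<pi> ^ e)) ** (y ** star y) = mat 1" by simp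
  hence "(mat (\<iota> (1 / \<pi> ^ e)) ** mat (\<iota> (\<pi> ^ e))) ** (y ** star y) = mat (\<iota> (1 / \<pi> ^ e)) ** mat 1"
    by (simp only: matrix_mul_assoc[symmetric])
  thus ?thesis using m by (simp add: mat_commute[of "\<iota> (1 / \<pi> ^ e)" "mat (\<iota> (\<pi> ^ e))"] del: incl_divide incl_power)
qed

lemma beta_simil: "beta d \<in> simil (d mod 2)"
proof -
  have "(d + 1) div 2 = d div 2 + d mod 2" by presburger
  thus ?thesis by (simp add: simil_def beta_def mat_mat22 power_add)
qed

lemma beta_mult: "beta d ** h = beta_conj d h ** beta d"
proof -
  have "d div 2 + (d + 1) div 2 = d" by presburger
  hence "\<pi> ^ d = \<pi> ^ (d div 2) * \<pi> ^ ((d + 1) div 2)" by (metis power_add)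
  thus ?thesis by (cases h) (simp add: beta_def beta_conj_def)
qed

lemma beta_cancel: "g ** beta d = h ** beta d \<longleftrightarrow> g = h" for g h :: "'e mat2"
  by (cases g; cases h) (auto simp: beta_def)

lemma pole_le_mult:
  assumes "integral k" "pole_le M y"
  shows "pole_le M (k ** y)" "pole_le M (y ** k)"
  using assms by (auto simp: pole_le_def integral_def matrix_matrix_mult_def sum_2
      intro!: E.pideal_add intro: E.pideal_mult_left E.pideal_mult_right)

lemma pole_le_iff:
  assumes "k \<in> maxcpt E"
  shows "pole_le M (k ** y) \<longleftrightarrow> pole_le M y" "pole_le M (y ** k) \<longleftrightarrow> pole_le M y"
proof -
  have i: "integral k" "integral (star k)" using assms by (simp_all add: maxcpt_iff integral_star)
  have c: "star k ** (k ** y) = y" "(y ** k) ** star k = y" using assms by (simp_all add: star_cancel maxcpt_U11)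
  show "pole_le M (k ** y) \<longleftrightarrow> pole_le M y" using pole_le_mult(1)[OF i(1), of M y] pole_le_mult(1)[OF i(2), of M "k ** y"] c by metis
  show "pole_le M (y ** k) \<longleftrightarrow> pole_le M y" using pole_le_mult(2)[OF i(1), of M y] pole_le_mult(2)[OF i(2), of M "y ** k"] c by metis
qed

lemma pole_le_beta: "pole_le M (beta d) \<longleftrightarrow> (d + 1) div 2 \<le> M"
proof -
  have "\<pi> ^ (d div 2) \<in> PF (- int M)" using val_unif_power[of "d div 2"] by (simp add: pideal_def)
  moreover have "1 / \<pi> ^ ((d + 1) div 2) \<in> PF (- int M) \<longleftrightarrow> (d + 1) div 2 \<le> M"
    using val_unif_power[of "(d + 1) div 2"] by (simp add: pideal_def F.val_divide)
  ultimately show ?thesis unfolding pole_le_def beta_def mat22_nth by (simp only: incl_PE) simp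
qed

section \<open>Double cosets of K in the similitudes: existence and uniqueness\<close>

definition in_cell :: "nat \<Rightarrow> 'e mat2 \<Rightarrow> bool" where
  "in_cell d y \<longleftrightarrow> (\<exists>k\<in>maxcpt E. \<exists>h\<in>maxcpt E. y = k ** (beta d ** h))"

lemma in_cell_left: "g \<in> maxcpt E \<Longrightarrow> in_cell d (g ** y) \<longleftrightarrow> in_cell d y"
proof -
  have "in_cell d (g ** y)" if "g \<in> maxcpt E" "in_cell d y" for g y
    using that maxcpt_mult unfolding in_cell_def by (metis matrix_mul_assoc)
  thus "g \<in> maxcpt E \<Longrightarrow> in_cell d (g ** y) \<longleftrightarrow> in_cell d y"
    using maxcpt_star[of g] star_cancel(3)[OF maxcpt_U11] by metis
qed

lemma in_cell_right: "g \<in> maxcpt E \<Longrightarrow> in_cell d (y ** g) \<longleftrightarrow> in_cell d y"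
proof -
  have "in_cell d (y ** g)" if "g \<in> maxcpt E" "in_cell d y" for g y
    using that maxcpt_mult unfolding in_cell_def by (metis matrix_mul_assoc)
  thus "g \<in> maxcpt E \<Longrightarrow> in_cell d (y ** g) \<longleftrightarrow> in_cell d y"
    using maxcpt_star[of g] star_cancel(5)[OF maxcpt_U11] by metis
qed

text \<open>With an entry of least valuation at the lower right, the relations put
  \<open>b / f\<close> and \<open>c / f\<close> in \<open>\<delta>\<close> times integers of F, so
  unipotents in K clear b and c. The multiplier then fixes the product of the remaining diagonal
  entries up to conjugation.\<close>

lemma cartan_pivot:
  assumes y: "mat22 a b c f \<in> simil e" and e: "e \<le> 1" and f: "f \<noteq> 0"
    and min: "a \<in> PE (valE E f)" "b \<in> PE (valE E f)" "c \<in> PE (valE E f)"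
  shows "\<exists>d. d mod 2 = e \<and> in_cell d (mat22 a b c f)"
proof -
  let ?y = "mat22 a b c f"
  have r: "bar f * b + bar b * f = 0" "bar f * a + bar b * c = \<iota> (1 / \<pi> ^ e)" "c * bar f + f * bar c = 0"
    using y simil_right[OF y] by (simp_all add: simil_def mat_mat22 del: incl_divide incl_power)
  have "bar (b / f) = - (b / f)" using r(1) f by (simp add: field_simps eq_neg_iff_add_eq_0)
  then obtain s where s: "b / f = \<delta> * \<iota> s" using bar_antifixed by blast
  have "bar (c / f) = - (c / f)" using r(3) f by (simp add: field_simps eq_neg_iff_add_eq_0)
  then obtain t where t: "c / f = \<delta> * \<iota> t" using bar_antifixed by blast
  have "b / f \<in> PE 0" "c / f \<in> PE 0" using min f by (simp_all add: E.pideal_divide_iff)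
  hence st: "s \<in> PF 0" "t \<in> PF 0" unfolding s t by simp_all
  have bc: "b = f * (\<delta> * \<iota> s)" "c = f * (\<delta> * \<iota> t)" using s t f by (simp_all add: field_simps)
  define a' where "a' = a - \<delta> * \<iota> s * c"
  define u where "u = mat22 1 (\<delta> * \<iota> s) 0 1"
  have u: "u \<in> maxcpt E" using st unip_maxcpt[of u] by (auto simp: u_def unip_def)
  have yd: "?y = u ** mat22 a' 0 0 f ** low t"
    by (simp add: u_def low_def a'_def bc algebra_simps)
  have "u ** (mat22 a' 0 0 f ** low t) \<in> simil e" using y yd by (simp add: matrix_mul_assoc)
  have a'f: "bar f * a' = \<iota> (1 / \<pi> ^ e)"
  proof -
    have "bar f * a' = (bar f * a + bar b * c) - (bar f * b + bar b * f) * (\<delta> * \<iota> t)"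
      unfolding a'_def by (simp add: bc algebra_simps)
    thus ?thesis using r by simp
  qed
  have a'0: "a' \<noteq> 0" using a'f by auto
  have va: "valE E a' = - int e - valE E f"
  proof -
    have "valE E (bar f * a') = - int e"
      unfolding a'f using val_unif_power[of e] by (simp add: valE_incl F.val_divide del: incl_divide incl_power)
    thus ?thesis using E.val_mult[of "bar f" a'] f a'0 by simp
  qed
  have "a' \<in> PE (valE E f)" unfolding a'_def
    by (rule E.pideal_diff[OF min(1)], rule E.pideal_mult_left[OF _ min(3)]) (use st in simp)
  \<comment> \<open>The valuations of \<open>a'\<close> and f add up to -e, and f still has the
    smaller one after the elimination. This makes n and n - e nonnegative below.\<close>
  hence vf: "2 * valE E f \<le> - int e" using va a'0 by (simp add: pideal_def)
  define n where "n = nat (- valE E f)"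
  define d where "d = 2 * n - e"
  have n: "int n = - valE E f" "e \<le> n" using vf e unfolding n_def by linarith+
  have dd: "d mod 2 = e" "(d + 1) div 2 = n" "d div 2 = n - e"
  proof -
    have "d mod 2 = e \<and> (d + 1) div 2 = n \<and> d div 2 = n - e"
    proof (cases "e = 0")
      case False
      then obtain m where "n = Suc m" "e = 1" using n(2) e by (cases n) auto
      thus ?thesis by (simp add: d_def)
    qed (simp add: d_def)
    thus "d mod 2 = e" "(d + 1) div 2 = n" "d div 2 = n - e" by blast+
  qed
  \<comment> \<open>The unit by which f differs from the entry \<open>\<pi>^(-n)\<close> of
    \<open>beta d\<close>, arranged so that \<open>torus z\<close> has \<open>\<pi>^n * f\<close> as
    its second entry.\<close>
  define z where "z = 1 / (\<iota> (\<pi> ^ n) * bar f)"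
  have zu: "z \<noteq> 0" "valE E z = 0"
    using f n(1) val_iota_unif[of n] by (simp_all add: z_def E.val_divide E.val_mult del: incl_power)
  have "mat22 a' 0 0 f = torus z ** beta d"
  proof -
    have "a' = \<iota> (1 / \<pi> ^ e) / bar f" using a'f f by (simp add: field_simps)
    moreover have "\<pi> ^ n = \<pi> ^ (n - e) * \<pi> ^ e" using n(2) by (simp flip: power_add)
    ultimately show ?thesis unfolding beta_def dd using f by (simp add: torus_def z_def)
  qed
  hence "?y = (u ** torus z) ** (beta d ** low t)" using yd by (simp add: matrix_mul_assoc)
  moreover have "u ** torus z \<in> maxcpt E" using u torus_K[OF zu] maxcpt_mult by blast
  ultimately have "in_cell d ?y" using low_K[OF st(2)] unfolding in_cell_def by blast
  thus ?thesis using dd(1) by blast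
qed

text \<open>Multiplication by the Weyl element w, which lies in K, on the left or on the right moves
  the entry of least valuation to the lower right corner without changing the double coset.\<close>

lemma cartan:
  assumes y: "y \<in> simil e" and e: "e \<le> 1"
  shows "\<exists>d. d mod 2 = e \<and> in_cell d y"
proof -
  obtain a b c f where ye: "y = mat22 a b c f" by (cases y)
  define w where "w = (mat22 0 1 1 0 :: 'e mat2)"
  have w: "w \<in> maxcpt E" by (simp add: w_def maxcpt_iff U11_iff integral_def mat_mat22)
  define T where "T = {a, b, c, f} - {0}"
  have "T \<noteq> {}"
  proof
    assume "T = {}"
    hence "a = 0 \<and> b = 0 \<and> c = 0 \<and> f = 0" by (auto simp: T_def)
    thus False using y by (simp add: ye simil_def mat_mat22)
  qed
  hence "\<exists>x\<in>T. \<forall>z\<in>T. valE E x \<le> valE E z"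
    using ex_min_if_finite[of "valE E ` T"] by (force simp: T_def not_less)
  then obtain x where x: "x \<noteq> 0" "x \<in> {a, b, c, f}" "\<And>z. z \<in> {a, b, c, f} \<Longrightarrow> z \<in> PE (valE E x)"
    by (auto simp: T_def pideal_def)
  have wy: "w ** y = mat22 c f a b" "y ** w = mat22 b a f c" "w ** y ** w = mat22 f c b a"
    by (simp_all add: w_def ye)
  have S: "w ** y \<in> simil e" "y ** w \<in> simil e" "w ** y ** w \<in> simil e"
    using y w simil_mult_left simil_mult_right by blast+
  consider "x = f" | "x = b" | "x = c" | "x = a" using x(2) by auto
  thus ?thesis
  proof cases
    case 1
    thus ?thesis using cartan_pivot[OF y[unfolded ye] e] x by (simp add: ye)
  next
    case 2
    have "\<exists>d. d mod 2 = e \<and> in_cell d (w ** y)"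
      unfolding wy by (rule cartan_pivot[OF S(1)[unfolded wy] e]) (use x 2 in auto)
    thus ?thesis using in_cell_left[OF w] by simp
  next
    case 3
    have "\<exists>d. d mod 2 = e \<and> in_cell d (y ** w)"
      unfolding wy by (rule cartan_pivot[OF S(2)[unfolded wy] e]) (use x 3 in auto)
    thus ?thesis using in_cell_right[OF w] by simp
  next
    case 4
    have "\<exists>d. d mod 2 = e \<and> in_cell d (w ** y ** w)"
      unfolding wy(3) by (rule cartan_pivot[OF S(3)[unfolded wy(3)] e]) (use x 4 in auto)
    thus ?thesis using in_cell_left[OF w] in_cell_right[OF w] by simp
  qed
qed

text \<open>The least pole bound of an element of the cell is the ceiling of d/2, and the parity is
  given.\<close>

lemma cell_unique:
  assumes "k \<in> maxcpt E" "h \<in> maxcpt E" "k' \<in> maxcpt E" "h' \<in> maxcpt E" "d mod 2 = d' mod 2"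
    and eq: "k ** (beta d ** h) = k' ** (beta d' ** h')"
  shows "d = d'"
proof -
  have "pole_le M (k ** (beta d ** h)) \<longleftrightarrow> (d + 1) div 2 \<le> M" "pole_le M (k' ** (beta d' ** h')) \<longleftrightarrow> (d' + 1) div 2 \<le> M" for M
    using assms(1-4) by (simp_all add: pole_le_iff pole_le_beta)
  hence le: "(d + 1) div 2 \<le> M \<longleftrightarrow> (d' + 1) div 2 \<le> M" for M using eq by simp
  have "(d + 1) div 2 = (d' + 1) div 2" using le[of "(d + 1) div 2"] le[of "(d' + 1) div 2"] by (intro order_antisym) simp_all
  moreover have "n = 2 * ((n + 1) div 2) - n mod 2" for n :: nat by presburger
  ultimately show ?thesis using assms(5) by metis
qed

text \<open>Two factorisations differ by some x with \<open>beta d ** x = g ** beta d\<close>.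
  Integrality of g puts x in \<open>Hgrp d\<close>, where equivariance of F compensates the change
  from k to k'.\<close>

lemma cell_value:
  assumes K: "k \<in> maxcpt E" "h \<in> maxcpt E" "k' \<in> maxcpt E" "h' \<in> maxcpt E"
    and eq: "k ** (beta d ** h) = k' ** (beta d ** h')" and F: "F \<in> pieces d"
  shows "\<rho> k (F h) = \<rho> k' (F h')"
proof -
  define x where "x = h ** star h'"
  define g where "g = star k ** k'"
  have xK: "x \<in> maxcpt E" and gK: "g \<in> maxcpt E" using K maxcpt_mult maxcpt_star by (auto simp: x_def g_def)
  have "star k ** (k ** (beta d ** h)) ** star h' = star k ** (k' ** (beta d ** h')) ** star h'" by (simp add: eq)
  hence "beta d ** x = g ** beta d"
    using K by (simp add: star_cancel maxcpt_U11 x_def g_def matrix_mul_assoc)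
  hence c: "beta_conj d x = g" unfolding beta_mult beta_cancel .
  have "beta_conj d x $ 2 $ 1 \<in> PE 0" using gK c by (simp add: maxcpt_iff integral_def)
  hence "x $ 2 $ 1 / \<iota> (\<pi> ^ d) \<in> PE 0" by (simp add: beta_conj_def)
  hence "x $ 2 $ 1 \<in> PE (int d)" using E.pideal_divide_iff[of "\<iota> (\<pi> ^ d)"] val_iota_unif[of d] by simp
  hence x: "x \<in> Hgrp d" using xK by (simp add: Hgrp_def)
  have "F h = F (x ** h')" using K by (simp add: x_def star_cancel maxcpt_U11)
  also have "\<dots> = \<rho> g (F h')" using F x K c by (simp add: pieces_def)
  finally have "\<rho> k (F h) = \<rho> (k ** g) (F h')" using \<rho>_mult[OF K(1) gK pieces_V[OF F]] by simp
  thus ?thesis using K by (simp add: g_def star_cancel maxcpt_U11)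
qed

end

section \<open>Restriction of the compactly induced representations\<close>

lemma bij_betw_finite_support:
  fixes f :: "'i \<Rightarrow> 'a::zero \<Rightarrow> 'b::zero"
  assumes f: "\<And>i. i \<in> I \<Longrightarrow> bij_betw (f i) (A i) (B i)" "\<And>i. i \<in> I \<Longrightarrow> f i 0 = 0" "\<And>i. i \<in> I \<Longrightarrow> 0 \<in> A i"
  shows "bij_betw (\<lambda>\<phi> i. if i \<in> I then f i (\<phi> i) else 0)
    {\<phi>. finite {i. \<phi> i \<noteq> 0} \<and> (\<forall>i\<in>I. \<phi> i \<in> A i) \<and> (\<forall>i. i \<notin> I \<longrightarrow> \<phi> i = 0)}
    {\<phi>. finite {i. \<phi> i \<noteq> 0} \<and> (\<forall>i\<in>I. \<phi> i \<in> B i) \<and> (\<forall>i. i \<notin> I \<longrightarrow> \<phi> i = 0)}"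
    (is "bij_betw ?T ?P ?Q")
proof (rule bij_betw_byWitness[where f' = "\<lambda>\<phi> i. if i \<in> I then inv_into (A i) (f i) (\<phi> i) else 0"])
  have inv0: "inv_into (A i) (f i) 0 = 0" if "i \<in> I" for i
    using f[OF that] by (metis bij_betw_imp_inj_on inv_into_f_f)
  show "\<forall>\<phi>\<in>?P. (\<lambda>i. if i \<in> I then inv_into (A i) (f i) (?T \<phi> i) else 0) = \<phi>"
    by (auto simp: fun_eq_iff bij_betw_inv_into_left[OF f(1)])
  show "\<forall>\<phi>\<in>?Q. ?T (\<lambda>i. if i \<in> I then inv_into (A i) (f i) (\<phi> i) else 0) = \<phi>"
    by (auto simp: fun_eq_iff bij_betw_inv_into_right[OF f(1)])
  show "?T ` ?P \<subseteq> ?Q"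
  proof (rule image_subsetI, rule CollectI, intro conjI ballI allI impI)
    fix \<phi> assume \<phi>: "\<phi> \<in> ?P"
    have "{i. ?T \<phi> i \<noteq> 0} \<subseteq> {i. \<phi> i \<noteq> 0}" using f(2) by auto
    thus "finite {i. ?T \<phi> i \<noteq> 0}" using \<phi> finite_subset by blast
    show "?T \<phi> i \<in> B i" if "i \<in> I" for i using \<phi> that bij_betwE[OF f(1)[OF that]] by simp
  qed simp
  show "(\<lambda>\<phi> i. if i \<in> I then inv_into (A i) (f i) (\<phi> i) else 0) ` ?Q \<subseteq> ?P"
  proof (rule image_subsetI, rule CollectI, intro conjI ballI allI impI)
    fix \<phi> assume \<phi>: "\<phi> \<in> ?Q"
    have "{i. (if i \<in> I then inv_into (A i) (f i) (\<phi> i) else 0) \<noteq> 0} \<subseteq> {i. \<phi> i \<noteq> 0}" using inv0 by auto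
    thus "finite {i. (if i \<in> I then inv_into (A i) (f i) (\<phi> i) else 0) \<noteq> 0}" using \<phi> finite_subset by blast
    show "(if i \<in> I then inv_into (A i) (f i) (\<phi> i) else 0) \<in> A i" if "i \<in> I" for i
      using \<phi> that bij_betwE[OF bij_betw_inv_into[OF f(1)[OF that]]] by simp
  qed simp
qed

lemma is_rep_direct_sum:
  assumes "group G" "\<And>i. vector_space (scal (R i))" "\<And>i. i \<in> I \<Longrightarrow> is_rep (R i) \<and> grp (R i) = G"
  shows "is_rep (rep_direct_sum G I R)"
proof -
  have vs: "vector_space (\<lambda>c \<phi> i. scal (R i) c (\<phi> i))"
    using assms(2) unfolding vector_space_def by (auto simp: fun_eq_iff)
  have sub: "0 \<in> vs (R i)" "x \<in> vs (R i) \<Longrightarrow> y \<in> vs (R i) \<Longrightarrow> x + y \<in> vs (R i)" "x \<in> vs (R i) \<Longrightarrow> scal (R i) c x \<in> vs (R i)"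
    if "i \<in> I" for i x y c using assms(3)[OF that] subspace_iff[OF assms(2)] by (auto simp: is_rep_def)
  have z: "scal (R i) c 0 = 0" for i c
  proof -
    interpret vector_space "scal (R i)" by (rule assms)
    show ?thesis by simp
  qed
  have az: "act (R i) g 0 = 0" if "i \<in> I" "g \<in> carrier G" for i g
  proof -
    have "act (R i) g (0 + 0) = act (R i) g 0 + act (R i) g 0"
      using assms(3)[OF that(1)] sub(1)[OF that(1)] that(2) unfolding is_rep_def by blast
    thus ?thesis by simp
  qed
  have fin: "finite {i. \<phi> i + \<phi>' i \<noteq> 0}" if "finite {i. \<phi> i \<noteq> 0}" "finite {i. \<phi>' i \<noteq> 0}" for \<phi> \<phi>' :: "'b \<Rightarrow> 'c"
    by (rule finite_subset[OF _ finite_UnI[OF that]]) auto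
  have fin': "finite {i. g i (\<phi> i) \<noteq> 0}" if "finite {i. \<phi> i \<noteq> 0}" "\<And>i. g i 0 = 0" for g and \<phi> :: "'b \<Rightarrow> 'c"
    by (rule finite_subset[OF _ that(1)]) (use that(2) in auto)
  have S: "module.subspace (\<lambda>c \<phi> i. scal (R i) c (\<phi> i)) (vs (rep_direct_sum G I R))"
    unfolding subspace_iff[OF vs] rep_direct_sum_def rep.select_convs
    using sub z fin fin'[of _ "\<lambda>i. scal (R i) c" for c] by (simp add: zero_fun_def plus_fun_def)
  have A: "act (rep_direct_sum G I R) g \<phi> \<in> vs (rep_direct_sum G I R)"
    if "g \<in> carrier G" "\<phi> \<in> vs (rep_direct_sum G I R)" for g \<phi>
    using that fin'[of \<phi> "\<lambda>i x. if i \<in> I then act (R i) g x else 0"] assms(3) az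
    unfolding rep_direct_sum_def rep.select_convs is_rep_def by auto
  have R: "y \<in> vs (R i) \<Longrightarrow> act (R i) g (x + y) = act (R i) g x + act (R i) g y"
      "act (R i) g (scal (R i) c x) = scal (R i) c (act (R i) g x)" "act (R i) \<one>\<^bsub>G\<^esub> x = x"
      "h \<in> carrier G \<Longrightarrow> act (R i) (g \<otimes>\<^bsub>G\<^esub> h) x = act (R i) g (act (R i) h x)"
    if "i \<in> I" "g \<in> carrier G" "x \<in> vs (R i)" for i g h x y c
  proof -
    have R': "is_rep (R i)" "grp (R i) = G" using assms(3) that(1) by blast+
    show "y \<in> vs (R i) \<Longrightarrow> act (R i) g (x + y) = act (R i) g x + act (R i) g y"
      "act (R i) g (scal (R i) c x) = scal (R i) c (act (R i) g x)" "act (R i) \<one>\<^bsub>G\<^esub> x = x"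
      "h \<in> carrier G \<Longrightarrow> act (R i) (g \<otimes>\<^bsub>G\<^esub> h) x = act (R i) g (act (R i) h x)"
      using R'(1)[unfolded is_rep_def R'(2)] that(2,3) by blast+
  qed
  have one: "act (R i) \<one>\<^bsub>G\<^esub> x = x" if "i \<in> I" "x \<in> vs (R i)" for i x
    using R(3)[OF that(1) _ that(2)] group.is_monoid[OF assms(1)] monoid.one_closed by blast
  show ?thesis
    unfolding is_rep_def
  proof (intro conjI ballI allI)
    show "group (grp (rep_direct_sum G I R))" using assms(1) by (simp add: rep_direct_sum_def)
    show "vector_space (scal (rep_direct_sum G I R))" using vs by (simp add: rep_direct_sum_def)
    show "module.subspace (scal (rep_direct_sum G I R)) (vs (rep_direct_sum G I R))"
      using S by (simp add: rep_direct_sum_def)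
    show "act (rep_direct_sum G I R) g \<phi> \<in> vs (rep_direct_sum G I R)"
      if "g \<in> carrier (grp (rep_direct_sum G I R))" "\<phi> \<in> vs (rep_direct_sum G I R)" for g \<phi>
      using A that by (simp add: rep_direct_sum_def)
  qed (auto simp: rep_direct_sum_def fun_eq_iff R one z)
qed

lemma is_rep_sum:
  assumes R: "is_rep R" and S: "is_rep S" "grp S = grp R"
  shows "is_rep (R \<oplus>\<^sub>r S)"
proof -
  have vs: "vector_space (\<lambda>c (x, y). (scal R c x, scal S c y))"
    using R S unfolding is_rep_def vector_space_def by auto
  have vR: "vector_space (scal R)" "vector_space (scal S)" using R S by (simp_all add: is_rep_def)
  have "module.subspace (\<lambda>c (x, y). (scal R c x, scal S c y)) (vs R \<times> vs S)"
    using R S unfolding subspace_iff[OF vs] is_rep_def subspace_iff[OF vR(1)] subspace_iff[OF vR(2)]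
    by (auto simp: zero_prod_def)
  thus ?thesis using R S vs unfolding is_rep_def rep_sum_def by auto
qed

context cuspidal_data
begin

definition \<sigma>\<^sub>K :: "('e mat2, 'w) rep" where
  "\<sigma>\<^sub>K = \<lparr>grp = Kgrp E, scal = sc, vs = V, act = \<rho>\<rparr>"

lemma \<sigma>\<^sub>K_simps: "grp \<sigma>\<^sub>K = Kgrp E" "scal \<sigma>\<^sub>K = sc" "vs \<sigma>\<^sub>K = V" "act \<sigma>\<^sub>K = \<rho>"
  by (simp_all add: \<sigma>\<^sub>K_def)

lemma \<sigma>\<^sub>K_irreducible: "irreducible_rep \<sigma>\<^sub>K"
proof -
  have "is_rep \<sigma>\<^sub>K" unfolding is_rep_def \<sigma>\<^sub>K_def
    using group_K V vs.vector_space_axioms by (auto simp: \<rho>_in \<rho>_add \<rho>_scale \<rho>_one \<rho>_mult)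
  thus ?thesis unfolding irreducible_rep_def using V_nonzero \<rho>_irreducible by (auto simp: \<sigma>\<^sub>K_def)
qed

text \<open>The similitude \<open>a\<close> stands for the identity (\<open>e = 0\<close>) or \<open>eta E\<close> (\<open>e = 1\<close>).\<close>

definition admissible :: "'e mat2 \<Rightarrow> nat \<Rightarrow> bool" where
  "admissible a e \<longleftrightarrow> e \<le> 1 \<and> integral a \<and> star a ** a = mat (\<iota> (\<pi> ^ e))"

lemma admissible_one: "admissible (mat 1) 0"
  by (simp add: admissible_def integral_def) (simp add: mat_def)

lemma admissible_eta: "admissible (eta E) 1"
proof -
  have "\<pi> \<in> PF 0" using unif by (simp add: pideal_def)
  thus ?thesis by (simp add: admissible_def integral_def eta_def mat_mat22)
qed

section \<open>Valuations of matrix entries and compact sets\<close>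

definition entries_in :: "int \<Rightarrow> 'e mat2 \<Rightarrow> bool" where
  "entries_in n g \<longleftrightarrow> g $ 1 $ 1 \<in> PE n \<and> g $ 1 $ 2 \<in> PE n \<and> g $ 2 $ 1 \<in> PE n \<and> g $ 2 $ 2 \<in> PE n"

lemma entries_in_mult: "entries_in m g \<Longrightarrow> entries_in n h \<Longrightarrow> entries_in (m + n) (g ** h)"
  by (auto simp: entries_in_def matrix_matrix_mult_def sum_2 intro!: E.pideal_add E.pideal_mult)

lemma entries_in_mono: "entries_in m g \<Longrightarrow> n \<le> m \<Longrightarrow> entries_in n g"
  unfolding entries_in_def using E.pideal_mono by blast

lemma entries_in_star: "entries_in n g \<Longrightarrow> entries_in n (star g)"
  by (simp add: entries_in_def star_def)

lemma pole_le_entries: "pole_le M = entries_in (- int M)"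
  by (simp add: pole_le_def entries_in_def fun_eq_iff)

lemma integral_entries: "integral = entries_in 0"
  by (simp add: integral_def entries_in_def fun_eq_iff)

lemma mcong_entries: "mcong n g h \<longleftrightarrow> entries_in n (g - h)"
  by (simp add: mcong_def entries_in_def)

lemma entries_in_mat: "entries_in n (mat z) \<longleftrightarrow> z \<in> PE n"
  by (simp add: entries_in_def mat_mat22)

lemma pole_le_exists: "\<exists>M. pole_le M g"
proof -
  have m: "x \<in> PE (- int (nat (\<bar>valE E (g $ 1 $ 1)\<bar> + \<bar>valE E (g $ 1 $ 2)\<bar> + \<bar>valE E (g $ 2 $ 1)\<bar> + \<bar>valE E (g $ 2 $ 2)\<bar>)))"
    if "x \<in> {g $ 1 $ 1, g $ 1 $ 2, g $ 2 $ 1, g $ 2 $ 2}" for x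
    using that by (auto simp: pideal_def)
  show ?thesis unfolding pole_le_def using m by blast
qed

lemma pole_le_mono: "pole_le M g \<Longrightarrow> M \<le> N \<Longrightarrow> pole_le N g"
  unfolding pole_le_entries using entries_in_mono by force

lemma pole_le_open: "openin (mat_top E) {g. pole_le M g}"
proof (rule mat_openI[of _ 0])
  fix g h assume g: "g \<in> {g. pole_le M g}" and h: "mcong 0 h g"
  have "h $ i $ j \<in> PE (- int M)" if "h $ i $ j - g $ i $ j \<in> PE 0" "g $ i $ j \<in> PE (- int M)" for i j
    using E.pideal_add[OF E.pideal_mono[OF that(1), of "- int M"] that(2)] by simp
  thus "h \<in> {g. pole_le M g}" using g h by (auto simp: pole_le_def mcong_def)
qed

text \<open>The sets with a bounded pole form an increasing open cover of all matrices.\<close>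

lemma compact_pole_le:
  assumes C: "compactin (mat_top E) C"
  shows "\<exists>N. \<forall>x\<in>C. pole_le N x"
proof -
  let ?U = "range (\<lambda>M. {g. pole_le M g})"
  have "C \<subseteq> \<Union>?U" using pole_le_exists by blast
  moreover have "\<forall>u\<in>?U. openin (mat_top E) u" using pole_le_open by blast
  ultimately obtain \<F> where \<F>: "finite \<F>" "\<F> \<subseteq> ?U" "C \<subseteq> \<Union>\<F>"
    using C unfolding compactin_def by metis
  then obtain S where S: "finite S" "\<F> = (\<lambda>M. {g. pole_le M g}) ` S"
    using finite_subset_image[OF \<F>(1,2)] by blast
  have "pole_le (Max S) x" if "x \<in> C" for x
    using that \<F>(3) S Max_ge[OF S(1)] pole_le_mono by blast
  thus ?thesis by blast
qed

text \<open>Multiplication by \<open>a\<close> carries \<open>simil e\<close> onto G, so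
  equivariance under the conjugate of K by \<open>a\<close> becomes equivariance under K in the
  variable y. The pole bound stands for both local constancy and compact support.\<close>

definition cInd_functions :: "'e mat2 \<Rightarrow> nat \<Rightarrow> ('e mat2 \<Rightarrow> 'w) set" where
  "cInd_functions a e = {f. (\<forall>x. x \<notin> U11 E \<longrightarrow> f x = 0) \<and> (\<forall>x\<in>U11 E. f x \<in> V) \<and>
     (\<forall>k\<in>maxcpt E. \<forall>y\<in>simil e. f (a ** (k ** y)) = \<rho> k (f (a ** y))) \<and>
     (\<exists>M. \<forall>y\<in>simil e. f (a ** y) \<noteq> 0 \<longrightarrow> pole_le M y)}"

definition translateG :: "'e mat2 \<Rightarrow> ('e mat2 \<Rightarrow> 'w) \<Rightarrow> 'e mat2 \<Rightarrow> 'w" where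
  "translateG g f x = (if x \<in> U11 E then f (x ** g) else 0)"

definition cell_families :: "nat \<Rightarrow> (nat \<Rightarrow> 'e mat2 \<Rightarrow> 'w) set" where
  "cell_families e = {\<phi>. finite {d. \<phi> d \<noteq> 0} \<and> (\<forall>d\<in>{d. d mod 2 = e}. \<phi> d \<in> pieces d) \<and> (\<forall>d. d \<notin> {d. d mod 2 = e} \<longrightarrow> \<phi> d = 0)}"

definition cells :: "'e mat2 \<Rightarrow> nat \<Rightarrow> ('e mat2 \<Rightarrow> 'w) \<Rightarrow> nat \<Rightarrow> 'e mat2 \<Rightarrow> 'w" where
  "cells a e f d k = (if d mod 2 = e \<and> k \<in> maxcpt E then f (a ** (beta d ** k)) else 0)"

context
  fixes a e assumes a: "admissible a e"
begin

definition ainv :: "'e mat2" where "ainv = mat (\<iota> (1 / \<pi> ^ e)) ** star a"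

lemma e_le: "e \<le> 1"
  using a by (simp add: admissible_def)

lemma mat_unif: "mat (\<iota> (1 / \<pi> ^ n)) ** mat (\<iota> (\<pi> ^ n)) = (mat 1 :: 'e mat2)"
  "mat (\<iota> (\<pi> ^ n)) ** mat (\<iota> (1 / \<pi> ^ n)) = (mat 1 :: 'e mat2)"
  by (simp_all add: mat_mult)

lemma ainv: "ainv ** a = mat 1" "a ** ainv = mat 1"
proof -
  show "ainv ** a = mat 1" using a mat_unif[of e]
    by (simp add: ainv_def admissible_def del: incl_divide incl_power flip: matrix_mul_assoc)
  thus "a ** ainv = mat 1" by (simp add: matrix_left_right_inverse)
qed

lemma ainv_cancel: "ainv ** (a ** g) = g" "a ** (ainv ** g) = g"
  using ainv by (simp_all add: matrix_mul_assoc)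

lemma matrix_inv_a: "matrix_inv a = ainv"
proof -
  have "a ** matrix_inv a = mat 1 \<and> matrix_inv a ** a = mat 1"
    unfolding matrix_inv_def by (rule someI[of _ ainv]) (simp add: ainv)
  hence "ainv ** (a ** matrix_inv a) = ainv" by simp
  thus ?thesis by (simp add: ainv_cancel)
qed

lemma simil_U11: "y \<in> simil e \<Longrightarrow> a ** y \<in> U11 E"
proof -
  assume y: "y \<in> simil e"
  have "star (a ** y) ** (a ** y) = star y ** (star a ** a) ** y" by (simp add: star_mult matrix_mul_assoc)
  also have "\<dots> = mat (\<iota> (\<pi> ^ e)) ** (star y ** y)"
    using a by (simp add: admissible_def mat_commute[symmetric] matrix_mul_assoc del: incl_power)
  also have "\<dots> = mat 1" using y mat_unif[of e] by (simp add: simil_def del: incl_divide incl_power)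
  finally show ?thesis by (simp add: U11_iff)
qed

lemma U11_simil: "x \<in> U11 E \<Longrightarrow> ainv ** x \<in> simil e"
proof -
  assume x: "x \<in> U11 E"
  let ?s = "mat (\<iota> (1 / \<pi> ^ e))"
  have "star ainv = a ** ?s" by (simp add: ainv_def star_mult)
  hence "star ainv ** ainv = (?s ** a) ** ainv" by (simp only: mat_commute[of _ a])
  also have "\<dots> = ?s" using ainv(2) by (simp del: incl_divide incl_power flip: matrix_mul_assoc)
  finally have "star ainv ** ainv = ?s" .
  hence "star (ainv ** x) ** (ainv ** x) = star x ** ?s ** x"
    by (simp add: star_mult del: incl_divide incl_power) (metis matrix_mul_assoc)
  also have "\<dots> = ?s ** (star x ** x)" unfolding mat_commute[symmetric] by (simp add: matrix_mul_assoc)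
  finally show ?thesis using x by (simp add: simil_def U11_iff del: incl_divide incl_power)
qed

lemma cInd_functions_V: "f \<in> cInd_functions a e \<Longrightarrow> f x \<in> V"
  using vs.subspace_0[OF V] by (cases "x \<in> U11 E") (auto simp: cInd_functions_def)

lemma cInd_functions_equivariant: "f \<in> cInd_functions a e \<Longrightarrow> k \<in> maxcpt E \<Longrightarrow> y \<in> simil e \<Longrightarrow> f (a ** (k ** y)) = \<rho> k (f (a ** y))"
  by (simp add: cInd_functions_def)

lemma beta_h_simil: "d mod 2 = e \<Longrightarrow> h \<in> maxcpt E \<Longrightarrow> beta d ** h \<in> simil e"
  using simil_mult_right beta_simil by blast

lemma cell_coordinates:
  assumes "x \<in> U11 E"
  obtains d k h where "d mod 2 = e" "k \<in> maxcpt E" "h \<in> maxcpt E" "x = a ** (k ** (beta d ** h))"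
proof -
  obtain d k h where "d mod 2 = e" "k \<in> maxcpt E" "h \<in> maxcpt E" "ainv ** x = k ** (beta d ** h)"
    using cartan[OF U11_simil[OF assms] e_le] unfolding in_cell_def by blast
  thus ?thesis using that[of d k h] ainv_cancel(2)[of x] by simp
qed

lemma cells_families:
  assumes f: "f \<in> cInd_functions a e"
  shows "cells a e f \<in> cell_families e"
proof -
  obtain M where M: "\<And>y. y \<in> simil e \<Longrightarrow> f (a ** y) \<noteq> 0 \<Longrightarrow> pole_le M y" using f unfolding cInd_functions_def by blast
  have "{d. cells a e f d \<noteq> 0} \<subseteq> {..2 * M}"
  proof
    fix d assume "d \<in> {d. cells a e f d \<noteq> 0}"
    then obtain k where "cells a e f d k \<noteq> 0" by (auto simp: zero_fun_def)
    hence k: "d mod 2 = e" "k \<in> maxcpt E" "f (a ** (beta d ** k)) \<noteq> 0" by (auto simp: cells_def split: if_splits)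
    have "pole_le M (beta d ** k)" using M[OF beta_h_simil[OF k(1,2)] k(3)] .
    hence "(d + 1) div 2 \<le> M" using pole_le_iff[OF k(2)] pole_le_beta by blast
    \<comment> \<open>The pole of \<open>beta d\<close> has order the ceiling of d/2, so a bound M
      on poles is a bound 2M on d.\<close>
    thus "d \<in> {..2 * M}" by simp
  qed
  hence "finite {d. cells a e f d \<noteq> 0}" by (rule finite_subset) simp
  moreover have "cells a e f d \<in> pieces d" if d: "d mod 2 = e" for d
    unfolding pieces_def
  proof (rule CollectI, intro conjI allI ballI impI)
    show "cells a e f d x = 0" if "x \<notin> maxcpt E" for x using that by (simp add: cells_def)
    show "cells a e f d x \<in> V" for x using cInd_functions_V[OF f] vs.subspace_0[OF V] by (simp add: cells_def)
    fix h x assume h: "h \<in> Hgrp d" and x: "x \<in> maxcpt E"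
    have "beta d ** (h ** x) = (beta d ** h) ** x" by (rule matrix_mul_assoc)
    also have "\<dots> = (beta_conj d h ** beta d) ** x" by (simp only: beta_mult)
    also have "\<dots> = beta_conj d h ** (beta d ** x)" by (rule matrix_mul_assoc[symmetric])
    finally have "beta d ** (h ** x) = beta_conj d h ** (beta d ** x)" .
    thus "cells a e f d (h ** x) = \<rho> (beta_conj d h) (cells a e f d x)"
      using cInd_functions_equivariant[OF f beta_conj_K[OF h] beta_h_simil[OF d x]] d x Hgrp_K[OF h] by (simp add: cells_def maxcpt_mult)
  qed
  ultimately show ?thesis by (auto simp: cell_families_def cells_def fun_eq_iff)
qed

text \<open>Equivariance determines a function by its values on \<open>beta d ** h\<close>, and
  conversely these can be prescribed by any family of pieces; finite support of the family
  corresponds to the pole bound.\<close>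

lemma cells_bij: "bij_betw (cells a e) (cInd_functions a e) (cell_families e)"
proof (rule bij_betw_imageI)
  show "inj_on (cells a e) (cInd_functions a e)"
  proof (rule inj_onI, rule ext)
    fix f g x assume fg: "f \<in> cInd_functions a e" "g \<in> cInd_functions a e" "cells a e f = cells a e g"
    show "f x = g x"
    proof (cases "x \<in> U11 E")
      case True
      then obtain d k h where x: "d mod 2 = e" "k \<in> maxcpt E" "h \<in> maxcpt E" "x = a ** (k ** (beta d ** h))"
        by (rule cell_coordinates)
      have "f (a ** (beta d ** h)) = g (a ** (beta d ** h))"
        using fun_cong[OF fun_cong[OF fg(3)], of d h] x by (simp add: cells_def)
      thus ?thesis using cInd_functions_equivariant[OF fg(1) x(2) beta_h_simil[OF x(1,3)]]
          cInd_functions_equivariant[OF fg(2) x(2) beta_h_simil[OF x(1,3)]] x(4) by simp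
    qed (use fg in \<open>simp add: cInd_functions_def\<close>)
  qed
  have "\<phi> \<in> cells a e ` cInd_functions a e" if \<phi>: "\<phi> \<in> cell_families e" for \<phi>
  proof -
    \<comment> \<open>The value that equivariance forces for a given factorisation of x;
      \<open>cell_unique\<close> and \<open>cell_value\<close> show that all factorisations
      agree.\<close>
    define val where "val x v \<longleftrightarrow> (\<exists>d k h. d mod 2 = e \<and> k \<in> maxcpt E \<and> h \<in> maxcpt E \<and>
      x = a ** (k ** (beta d ** h)) \<and> v = \<rho> k (\<phi> d h))" for x v
    define f where "f x = (if x \<in> U11 E then THE v. val x v else 0)" for x
    have \<phi>p: "\<phi> d \<in> pieces d" if "d mod 2 = e" for d using \<phi> that by (simp add: cell_families_def)
    have unique: "v = w" if v: "val x v" "val x w" for x v w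
    proof -
      obtain d k h where 1: "d mod 2 = e" "k \<in> maxcpt E" "h \<in> maxcpt E" "x = a ** (k ** (beta d ** h))" "v = \<rho> k (\<phi> d h)"
        using v(1) unfolding val_def by blast
      obtain d' k' h' where 2: "d' mod 2 = e" "k' \<in> maxcpt E" "h' \<in> maxcpt E" "x = a ** (k' ** (beta d' ** h'))"
          "w = \<rho> k' (\<phi> d' h')"
        using v(2) unfolding val_def by blast
      have eq: "k ** (beta d ** h) = k' ** (beta d' ** h')" using 1(4) 2(4) ainv_cancel(1) by metis
      have "d = d'" using cell_unique[OF 1(2,3) 2(2,3) _ eq] 1(1) 2(1) by simp
      thus ?thesis using cell_value[OF 1(2,3) 2(2,3) _ \<phi>p] eq 1 2 by simp
    qed
    have f_val: "f (a ** (k ** (beta d ** h))) = \<rho> k (\<phi> d h)"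
      if "d mod 2 = e" "k \<in> maxcpt E" "h \<in> maxcpt E" for d k h
    proof -
      have v: "val (a ** (k ** (beta d ** h))) (\<rho> k (\<phi> d h))" using that unfolding val_def by blast
      have "a ** (k ** (beta d ** h)) \<in> U11 E" using that beta_h_simil simil_mult_left simil_U11 by blast
      moreover have "(THE v. val (a ** (k ** (beta d ** h))) v) = \<rho> k (\<phi> d h)"
        by (rule the_equality) (use v unique in blast)+
      ultimately show ?thesis by (simp add: f_def)
    qed
    have "f \<in> cInd_functions a e" unfolding cInd_functions_def
    proof (rule CollectI, intro conjI allI ballI impI)
      show "f x = 0" if "x \<notin> U11 E" for x using that by (simp add: f_def)
      show "f x \<in> V" if "x \<in> U11 E" for x
        using cell_coordinates[OF that] f_val \<rho>_in pieces_V[OF \<phi>p] by metis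
      show "f (a ** (k ** y)) = \<rho> k (f (a ** y))" if k: "k \<in> maxcpt E" and y: "y \<in> simil e" for k y
      proof -
        obtain d k' h where x: "d mod 2 = e" "k' \<in> maxcpt E" "h \<in> maxcpt E" "a ** y = a ** (k' ** (beta d ** h))"
          using cell_coordinates[OF simil_U11[OF y]] by blast
        hence yy: "y = k' ** (beta d ** h)" using ainv_cancel(1) by metis
        have "k ** y = (k ** k') ** (beta d ** h)" unfolding yy by (rule matrix_mul_assoc)
        hence "f (a ** (k ** y)) = \<rho> (k ** k') (\<phi> d h)" using f_val[OF x(1) maxcpt_mult[OF k x(2)] x(3)] by simp
        also have "\<dots> = \<rho> k (f (a ** y))"
          using \<rho>_mult[OF k x(2) pieces_V[OF \<phi>p[OF x(1)]]] f_val[OF x(1-3)] yy by simp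
        finally show ?thesis .
      qed
      have "finite {d. \<phi> d \<noteq> 0}" using \<phi> by (simp add: cell_families_def)
      then obtain N where N: "\<And>d. \<phi> d \<noteq> 0 \<Longrightarrow> d \<le> N" using finite_nat_set_iff_bounded_le by auto
      show "\<exists>M. \<forall>y\<in>simil e. f (a ** y) \<noteq> 0 \<longrightarrow> pole_le M y"
      proof (intro exI ballI impI)
        fix y assume y: "y \<in> simil e" "f (a ** y) \<noteq> 0"
        obtain d k h where x: "d mod 2 = e" "k \<in> maxcpt E" "h \<in> maxcpt E" "a ** y = a ** (k ** (beta d ** h))"
          using cell_coordinates[OF simil_U11[OF y(1)]] by blast
        hence yy: "y = k ** (beta d ** h)" using ainv_cancel(1) by metis
        have "\<rho> k (\<phi> d h) \<noteq> 0" using y(2) f_val[OF x(1-3)] yy by simp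
        hence "\<phi> d h \<noteq> 0" using \<rho>_zero[OF x(2)] by metis
        hence "\<phi> d \<noteq> 0" by (metis zero_fun_apply)
        hence "d \<le> N" by (rule N)
        hence "(d + 1) div 2 \<le> N" by simp
        thus "pole_le N y" unfolding yy using pole_le_iff x(2,3) pole_le_beta by simp
      qed
    qed
    moreover have "cells a e f = \<phi>"
    proof (intro ext)
      fix d k
      show "cells a e f d k = \<phi> d k"
      proof (cases "d mod 2 = e \<and> k \<in> maxcpt E")
        case True
        hence "f (a ** (mat 1 ** (beta d ** k))) = \<rho> (mat 1) (\<phi> d k)" by (intro f_val) auto
        thus ?thesis using True \<rho>_one[OF pieces_V[OF \<phi>p]] by (simp add: cells_def)
      next
        case False
        thus ?thesis using \<phi> by (cases "d mod 2 = e") (auto simp: cells_def cell_families_def pieces_def)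
      qed
    qed
    ultimately show ?thesis by blast
  qed
  thus "cells a e ` cInd_functions a e = cell_families e" using cells_families by blast
qed

lemma conj_group: "carrier (grp (conj_rep a \<sigma>\<^sub>K)) = (\<lambda>k. a ** k ** ainv) ` maxcpt E"
  by (simp add: conj_rep_def \<sigma>\<^sub>K_def matrix_inv_a)

lemma conj_act: "act (conj_rep a \<sigma>\<^sub>K) (a ** k ** ainv) = \<rho> k"
proof -
  have "ainv ** (a ** k ** ainv) ** a = k" using ainv ainv_cancel by (simp flip: matrix_mul_assoc)
  thus ?thesis by (simp add: conj_rep_def \<sigma>\<^sub>K_def matrix_inv_a)
qed

lemma conj_mult: "(a ** k ** ainv) ** (a ** y) = a ** (k ** y)"
  by (simp add: ainv_cancel flip: matrix_mul_assoc)

section \<open>Smoothness and compact support in terms of poles\<close>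

lemma congruence_subgroup_G: "subgroup (congruence_subgroup m) (Ggrp E)"
proof (rule group.subgroupI[OF group_G])
  interpret normal "congruence_subgroup m" "Kgrp E" by (rule congruence_subgroup_normal)
  show "congruence_subgroup m \<subseteq> carrier (Ggrp E)" by (auto simp: congruence_subgroup_def maxcpt_iff)
  have "mat 1 \<in> congruence_subgroup m" by (simp add: congruence_subgroup_def)
  thus "congruence_subgroup m \<noteq> {}" by blast
  show "inv\<^bsub>Ggrp E\<^esub> g \<in> congruence_subgroup m" if "g \<in> congruence_subgroup m" for g
    using m_inv_closed[OF that] that by (simp add: inv_G inv_K congruence_subgroup_def maxcpt_U11)
  show "g \<otimes>\<^bsub>Ggrp E\<^esub> h \<in> congruence_subgroup m" if "g \<in> congruence_subgroup m" "h \<in> congruence_subgroup m" for g h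
    using subgroup.m_closed[OF subgroup_axioms that] by simp
qed

lemma conjugate_small:
  assumes y: "y \<in> simil e" "pole_le M y" and l: "l \<in> congruence_subgroup (2 * M + 2)"
  shows "\<exists>g\<in>congruence_subgroup 1. y ** l = g ** y"
proof -
  \<comment> \<open>The multiplier relation gives the inverse of y as a multiple of its adjoint, so
    it satisfies the same pole bound as y.\<close>
  define yi where "yi = mat (\<iota> (\<pi> ^ e)) ** star y"
  have yy: "yi ** y = mat 1" using y mat_unif[of e]
    by (simp add: yi_def simil_def del: incl_divide incl_power flip: matrix_mul_assoc)
  hence yy': "y ** yi = mat 1" by (simp add: matrix_left_right_inverse)
  define g where "g = y ** l ** yi"
  have gy: "g ** y = y ** l" using yy by (simp add: g_def flip: matrix_mul_assoc)
  have lU: "l \<in> U11 E" using l by (simp add: congruence_subgroup_def maxcpt_U11)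
  have "g ** star g = mat 1"
  proof -
    have sg: "star g = y ** star l ** yi"
    proof -
      have "star yi = y ** mat (\<iota> (\<pi> ^ e))" by (simp add: yi_def star_mult)
      hence "star g = (y ** mat (\<iota> (\<pi> ^ e))) ** (star l ** star y)" by (simp add: g_def star_mult del: incl_power)
      also have "\<dots> = y ** (mat (\<iota> (\<pi> ^ e)) ** star l) ** star y" by (simp only: matrix_mul_assoc)
      also have "\<dots> = y ** (star l ** mat (\<iota> (\<pi> ^ e))) ** star y" by (simp only: mat_commute[of _ "star l"])
      finally show ?thesis by (simp only: yi_def matrix_mul_assoc)
    qed
    have "g ** star g = (y ** l ** yi) ** (y ** star l ** yi)" unfolding sg by (simp only: g_def)
    also have "\<dots> = y ** (l ** ((yi ** y) ** (star l ** yi)))" by (simp only: matrix_mul_assoc)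
    finally have "g ** star g = y ** (l ** ((yi ** y) ** (star l ** yi)))" .
    thus ?thesis using yy yy' lU by (simp add: star_cancel)
  qed
  hence gU: "g \<in> U11 E" by (simp add: U11_iff')
  have "g - mat 1 = y ** (l - mat 1) ** yi"
  proof -
    have "y ** (l - mat 1) ** yi = y ** l ** yi - y ** mat 1 ** yi"
      by (simp add: mat2_eq_iff matrix_matrix_mult_def sum_2 algebra_simps)
    thus ?thesis using yy' by (simp add: g_def)
  qed
  \<comment> \<open>Poles of order M on either side cost 2M powers of p; level 2M + 2 leaves entries
    in p^2, which lies in p.\<close>
  moreover have "entries_in (- int M + (int (2 * M + 2)) + (0 + - int M)) (y ** (l - mat 1) ** yi)"
    unfolding yi_def
  proof (intro entries_in_mult entries_in_star)
    show "entries_in (- int M) y" "entries_in (- int M) y" using y by (simp_all add: pole_le_entries)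
    show "entries_in (int (2 * M + 2)) (l - mat 1)" using l by (simp only: congruence_subgroup_def mcong_entries mem_Collect_eq)
    show "entries_in 0 (mat (\<iota> (\<pi> ^ e)))" using E.pideal_mono[OF unif_PE[of e], of 0] by (simp add: entries_in_mat)
  qed
  ultimately have g1: "mcong 1 g (mat 1)" unfolding mcong_entries using entries_in_mono by force
  have "integral g"
  proof -
    have "g $ i $ j \<in> PE 0" if "g $ i $ j - (mat 1 :: 'e mat2) $ i $ j \<in> PE 1" for i j
      using E.pideal_add[OF E.pideal_mono[OF that, of 0], of "(mat 1 :: 'e mat2) $ i $ j"] by (simp add: mat_def split: if_splits)
    thus ?thesis using g1 by (simp add: mcong_def integral_def)
  qed
  hence "g \<in> congruence_subgroup 1" using gU g1 by (simp add: congruence_subgroup_def maxcpt_iff)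
  thus ?thesis using gy by metis
qed

lemma cInd_subset:
  assumes f: "f \<in> vs (cInd (mat_top E) (Ggrp E) (conj_rep a \<sigma>\<^sub>K))"
  shows "f \<in> cInd_functions a e"
proof -
  have f1: "\<And>x. x \<notin> U11 E \<Longrightarrow> f x = 0" "\<And>x. x \<in> U11 E \<Longrightarrow> f x \<in> V"
    and f2: "\<And>h x. h \<in> carrier (grp (conj_rep a \<sigma>\<^sub>K)) \<Longrightarrow> x \<in> U11 E \<Longrightarrow> f (h ** x) = act (conj_rep a \<sigma>\<^sub>K) h (f x)"
    using f by (auto simp: cInd_def Ind_space_def) (auto simp: conj_rep_def \<sigma>\<^sub>K_def)
  obtain C where C: "compactin (mat_top E) C" "{x. f x \<noteq> 0} \<subseteq> carrier (grp (conj_rep a \<sigma>\<^sub>K)) <#>\<^bsub>Ggrp E\<^esub> C"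
    using f by (auto simp: cInd_def)
  obtain N where N: "\<And>x. x \<in> C \<Longrightarrow> pole_le N x" using compact_pole_le[OF C(1)] by blast
  \<comment> \<open>As e is at most 1, passing from x to \<open>ainv ** x\<close> raises the pole
    order by at most one, whence N + 1 below.\<close>
  have ai: "entries_in (-1) ainv"
  proof -
    have "1 / \<pi> ^ e \<in> PF (-1)" using val_unif_power[of e] e_le by (simp add: pideal_def F.val_divide)
    hence "entries_in (-1) (mat (\<iota> (1 / \<pi> ^ e)))" by (simp only: entries_in_mat incl_PE)
    from entries_in_mult[OF this, of 0 "star a"] show ?thesis
      using a by (simp add: ainv_def admissible_def integral_entries entries_in_star)
  qed
  show ?thesis unfolding cInd_functions_def
  proof (rule CollectI, intro conjI allI ballI impI f1)
    show "f (a ** (k ** y)) = \<rho> k (f (a ** y))" if k: "k \<in> maxcpt E" and y: "y \<in> simil e" for k y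
      using f2[of "a ** k ** ainv" "a ** y"] k simil_U11[OF y] unfolding conj_group conj_mult conj_act by blast
    show "\<exists>M. \<forall>y\<in>simil e. f (a ** y) \<noteq> 0 \<longrightarrow> pole_le M y"
    proof (intro exI ballI impI)
      fix y assume y: "y \<in> simil e" "f (a ** y) \<noteq> 0"
      hence "a ** y \<in> carrier (grp (conj_rep a \<sigma>\<^sub>K)) <#>\<^bsub>Ggrp E\<^esub> C" using C by blast
      then obtain k x where k: "k \<in> maxcpt E" "x \<in> C" "a ** y = a ** k ** ainv ** x"
        unfolding conj_group by (auto simp: set_mult_def)
      have "y = ainv ** (a ** y)" by (simp add: ainv_cancel)
      also have "\<dots> = k ** (ainv ** x)" unfolding k(3) by (simp add: ainv_cancel flip: matrix_mul_assoc)
      finally have yk: "y = k ** (ainv ** x)" .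
      have "entries_in (- 1 + - int N) (ainv ** x)" using ai N[OF k(2)] by (intro entries_in_mult) (simp_all add: pole_le_entries)
      hence "pole_le (N + 1) (ainv ** x)" by (simp add: pole_le_entries)
      thus "pole_le (N + 1) y" unfolding yk using pole_le_iff(1)[OF k(1)] by blast
    qed
  qed
qed

text \<open>Below the pole bound, right translation by a deep congruence subgroup becomes left
  translation by elements that act trivially; above it, both values vanish. Modulo the inducing
  group the support is then covered by finitely many points.\<close>

lemma cInd_functions_subset:
  assumes f: "f \<in> cInd_functions a e"
  shows "f \<in> vs (cInd (mat_top E) (Ggrp E) (conj_rep a \<sigma>\<^sub>K))"
proof -
  obtain M where M: "\<And>y. y \<in> simil e \<Longrightarrow> f (a ** y) \<noteq> 0 \<Longrightarrow> pole_le M y" using f unfolding cInd_functions_def by blast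
  have eq: "f (h ** x) = act (conj_rep a \<sigma>\<^sub>K) h (f x)" if hc: "h \<in> carrier (grp (conj_rep a \<sigma>\<^sub>K))" and xU: "x \<in> U11 E" for h x
  proof -
    obtain k where k: "k \<in> maxcpt E" "h = a ** k ** ainv" using hc unfolding conj_group by blast
    have x: "a ** (ainv ** x) = x" by (simp add: ainv_cancel)
    show ?thesis using cInd_functions_equivariant[OF f k(1) U11_simil[OF xU]] conj_mult[of k "ainv ** x"]
      unfolding k(2) conj_act x by simp
  qed
  have smooth: "f (x ** l) = f x" if x: "x \<in> U11 E" and l: "l \<in> congruence_subgroup (2 * M + 2)" for x l
  proof -
    define y where "y = ainv ** x"
    have y: "y \<in> simil e" "x = a ** y" using U11_simil[OF x] by (simp_all add: y_def ainv_cancel)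
    have lK: "l \<in> maxcpt E" using l by (simp add: congruence_subgroup_def)
    have xl: "x ** l = a ** (y ** l)" by (simp add: y(2) matrix_mul_assoc)
    show ?thesis
    proof (cases "pole_le M y")
      case True
      then obtain g where g: "g \<in> congruence_subgroup 1" "y ** l = g ** y" using conjugate_small[OF y(1) _ l] by blast
      have "f (x ** l) = \<rho> g (f x)"
        unfolding xl using cInd_functions_equivariant[OF f _ y(1), of g] g by (simp add: y(2) congruence_subgroup_def)
      thus ?thesis using \<rho>_trivial[OF g(1)] cInd_functions_V[OF f] by simp
    next
      case False
      hence "\<not> pole_le M (y ** l)" using pole_le_iff(2)[OF lK] by blast
      hence "f (a ** (y ** l)) = 0" using M simil_mult_right[OF lK y(1)] by blast
      moreover have "f (a ** y) = 0" using M y(1) False by blast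
      ultimately show ?thesis unfolding xl by (simp add: y(2))
    qed
  qed
  interpret K: finite_index_normal "congruence_subgroup (2 * M + 2)" "Kgrp E" by (rule congruence_finite_index)
  \<comment> \<open>Finitely many d satisfy the bound, and for each one representatives modulo the
    congruence subgroup suffice; a finite set is compact.\<close>
  define C where "C = (\<lambda>(d, B). a ** (beta d ** K.rep B)) ` ({d. d \<le> 2 * M \<and> d mod 2 = e} \<times> rcosets\<^bsub>Kgrp E\<^esub> congruence_subgroup (2 * M + 2))"
  have finC: "finite C" unfolding C_def using K.finite_rcosets by simp
  have repK: "K.rep B \<in> maxcpt E" if "B \<in> rcosets\<^bsub>Kgrp E\<^esub> congruence_subgroup (2 * M + 2)" for B
    using K.rep_carrier[OF that] by simp
  have CU: "C \<subseteq> U11 E" unfolding C_def using repK beta_h_simil simil_U11 by auto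
  have supp: "{x. f x \<noteq> 0} \<subseteq> carrier (grp (conj_rep a \<sigma>\<^sub>K)) <#>\<^bsub>Ggrp E\<^esub> C"
  proof
    fix x assume "x \<in> {x. f x \<noteq> 0}"
    hence fx: "f x \<noteq> 0" by simp
    hence "x \<in> U11 E" using f by (auto simp: cInd_functions_def)
    then obtain d k h where x: "d mod 2 = e" "k \<in> maxcpt E" "h \<in> maxcpt E" "x = a ** (k ** (beta d ** h))"
      by (rule cell_coordinates)
    have "pole_le M (k ** (beta d ** h))"
      using M[OF simil_mult_left[OF x(2) beta_h_simil[OF x(1,3)]]] fx x(4) by simp
    hence "(d + 1) div 2 \<le> M" using pole_le_iff x(2,3) pole_le_beta by simp
    hence d: "d \<le> 2 * M" by simp
    let ?B = "congruence_subgroup (2 * M + 2) #>\<^bsub>Kgrp E\<^esub> h"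
    have B: "?B \<in> rcosets\<^bsub>Kgrp E\<^esub> congruence_subgroup (2 * M + 2)" using K.rcosetsI[OF K.subset, of h] x(3) by simp
    obtain n where n: "n \<in> congruence_subgroup (2 * M + 2)" "K.rep ?B = n ** h"
      using K.rep_eq[of h] x(3) by auto
    have nK: "n \<in> maxcpt E" using n by (simp add: congruence_subgroup_def)
    have "n $ 2 $ 1 \<in> PE (int (2 * M + 2))" using n(1) by (simp add: congruence_subgroup_def mcong_def mat_mat22)
    \<comment> \<open>Since d is at most 2M, the difference between h and its representative lies in
      \<open>Hgrp d\<close> and can be moved across \<open>beta d\<close> into K.\<close>
    hence "n $ 2 $ 1 \<in> PE (int d)" by (rule E.pideal_mono) (use d in simp)
    hence nH: "star n \<in> Hgrp d" using nK by (intro Hgrp_star) (simp add: Hgrp_def)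
    have "h = star n ** K.rep ?B" using n(2) nK by (simp add: star_cancel maxcpt_U11)
    hence "beta d ** h = beta_conj d (star n) ** (beta d ** K.rep ?B)" by (metis matrix_mul_assoc beta_mult)
    hence "x = a ** ((k ** beta_conj d (star n)) ** (beta d ** K.rep ?B))" using x(4) by (simp add: matrix_mul_assoc)
    hence "x = (a ** (k ** beta_conj d (star n)) ** ainv) ** (a ** (beta d ** K.rep ?B))" by (simp only: conj_mult)
    moreover have "a ** (k ** beta_conj d (star n)) ** ainv \<in> carrier (grp (conj_rep a \<sigma>\<^sub>K))"
      unfolding conj_group using maxcpt_mult[OF x(2) beta_conj_K[OF nH]] by blast
    moreover have "a ** (beta d ** K.rep ?B) \<in> C" unfolding C_def using d x(1) B by force
    ultimately show "x \<in> carrier (grp (conj_rep a \<sigma>\<^sub>K)) <#>\<^bsub>Ggrp E\<^esub> C" by (auto simp: set_mult_def)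
  qed
  have "openin (subtopology (mat_top E) (carrier (Ggrp E))) (congruence_subgroup (2 * M + 2))"
    by (rule congruence_subgroup_open) (auto simp: maxcpt_iff)
  hence "\<exists>L. subgroup L (Ggrp E) \<and> openin (subtopology (mat_top E) (carrier (Ggrp E))) L \<and>
      (\<forall>x\<in>carrier (Ggrp E). \<forall>l\<in>L. f (x \<otimes>\<^bsub>Ggrp E\<^esub> l) = f x)"
    using congruence_subgroup_G smooth by (intro exI[of _ "congruence_subgroup (2 * M + 2)"]) simp
  moreover have "vs (conj_rep a \<sigma>\<^sub>K) = V" by (simp add: conj_rep_def \<sigma>\<^sub>K_def)
  ultimately have "f \<in> Ind_space (mat_top E) (Ggrp E) (conj_rep a \<sigma>\<^sub>K)"
    unfolding Ind_space_def using f eq by (simp add: cInd_functions_def)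
  moreover have "compactin (mat_top E) C" using finC by (simp add: finite_imp_compactin)
  ultimately show ?thesis using supp CU by (auto simp: cInd_def)
qed

lemma cInd_eq: "Res (Kgrp E) (cInd (mat_top E) (Ggrp E) (conj_rep a \<sigma>\<^sub>K)) =
   \<lparr>grp = Kgrp E, scal = (\<lambda>c f x. sc c (f x)), vs = cInd_functions a e, act = translateG\<rparr>"
proof -
  have "vs (cInd (mat_top E) (Ggrp E) (conj_rep a \<sigma>\<^sub>K)) = cInd_functions a e" using cInd_subset cInd_functions_subset by blast
  moreover have "act (cInd (mat_top E) (Ggrp E) (conj_rep a \<sigma>\<^sub>K)) = translateG"
    by (simp add: cInd_def Ind_def translateG_def fun_eq_iff)
  moreover have "scal (cInd (mat_top E) (Ggrp E) (conj_rep a \<sigma>\<^sub>K)) = (\<lambda>c f x. sc c (f x))"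
    by (simp add: cInd_def Ind_def conj_rep_def \<sigma>\<^sub>K_def)
  ultimately show ?thesis by (simp add: Res_def)
qed

lemma cells_translate:
  assumes g: "g \<in> maxcpt E"
  shows "cells a e (translateG g f) d = translateK g (cells a e f d)"
proof
  fix k
  show "cells a e (translateG g f) d k = translateK g (cells a e f d) k"
    using g maxcpt_mult[of k g] simil_U11[OF beta_h_simil, of d k]
    by (auto simp: cells_def translateG_def translateK_def matrix_mul_assoc)
qed

lemma cInd_rep: "is_rep (Res (Kgrp E) (cInd (mat_top E) (Ggrp E) (conj_rep a \<sigma>\<^sub>K)))"
proof -
  have vsf: "vector_space (\<lambda>c f x. sc c (f x))" using vs.vector_space_axioms by (rule vector_space_fun)
  have sub: "module.subspace (\<lambda>c f x. sc c (f x)) (cInd_functions a e)"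
    unfolding subspace_iff[OF vsf]
  proof (intro conjI ballI allI)
    show "0 \<in> cInd_functions a e" using vs.subspace_0[OF V] by (simp add: cInd_functions_def)
    fix f assume f: "f \<in> cInd_functions a e"
    obtain M where M: "\<And>y. y \<in> simil e \<Longrightarrow> f (a ** y) \<noteq> 0 \<Longrightarrow> pole_le M y" using f unfolding cInd_functions_def by blast
    have "\<exists>M. \<forall>y\<in>simil e. sc c (f (a ** y)) \<noteq> 0 \<longrightarrow> pole_le M y" for c using M by (metis vs.scale_zero_right)
    thus "(\<lambda>x. sc c (f x)) \<in> cInd_functions a e" for c
      using f V simil_U11 by (simp add: cInd_functions_def vs.subspace_scale \<rho>_scale)
    fix g assume g: "g \<in> cInd_functions a e"
    obtain N where N: "\<And>y. y \<in> simil e \<Longrightarrow> g (a ** y) \<noteq> 0 \<Longrightarrow> pole_le N y" using g unfolding cInd_functions_def by blast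
    have "pole_le (max M N) y" if "y \<in> simil e" "f (a ** y) + g (a ** y) \<noteq> 0" for y
    proof -
      have "f (a ** y) \<noteq> 0 \<or> g (a ** y) \<noteq> 0" using that(2) by auto
      thus ?thesis using M N that(1) pole_le_mono by (meson max.cobounded1 max.cobounded2)
    qed
    hence "\<exists>M. \<forall>y\<in>simil e. f (a ** y) + g (a ** y) \<noteq> 0 \<longrightarrow> pole_le M y" by blast
    thus "f + g \<in> cInd_functions a e"
      using f g V simil_U11 by (simp add: cInd_functions_def vs.subspace_add \<rho>_add)
  qed
  have tr: "translateG g f \<in> cInd_functions a e" if g: "g \<in> maxcpt E" and f: "f \<in> cInd_functions a e" for g f
  proof -
    obtain M where M: "\<And>y. y \<in> simil e \<Longrightarrow> f (a ** y) \<noteq> 0 \<Longrightarrow> pole_le M y" using f unfolding cInd_functions_def by blast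
    have t: "translateG g f (a ** y) = f (a ** (y ** g))" if "y \<in> simil e" for y
      using simil_U11[OF that] by (simp add: translateG_def matrix_mul_assoc)
    show ?thesis unfolding cInd_functions_def
    proof (rule CollectI, intro conjI allI ballI impI)
      show "translateG g f x = 0" if "x \<notin> U11 E" for x using that by (simp add: translateG_def)
      show "translateG g f x \<in> V" if "x \<in> U11 E" for x using cInd_functions_V[OF f] that by (simp add: translateG_def)
      show "translateG g f (a ** (k ** y)) = \<rho> k (translateG g f (a ** y))" if "k \<in> maxcpt E" "y \<in> simil e" for k y
        using cInd_functions_equivariant[OF f that(1) simil_mult_right[OF g that(2)]] t[OF that(2)] t[OF simil_mult_left[OF that]]
        by (simp add: matrix_mul_assoc)
      have "pole_le M y" if "y \<in> simil e" "translateG g f (a ** y) \<noteq> 0" for y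
        using M[OF simil_mult_right[OF g that(1)]] that(2) t[OF that(1)] pole_le_iff(2)[OF g] by simp
      thus "\<exists>M. \<forall>y\<in>simil e. translateG g f (a ** y) \<noteq> 0 \<longrightarrow> pole_le M y" by blast
    qed
  qed
  have mult: "translateG (g ** h) f = translateG g (translateG h f)" if "g \<in> maxcpt E" for g h f
    using that U11_mult maxcpt_U11 by (auto simp: translateG_def fun_eq_iff matrix_mul_assoc)
  have one: "translateG (mat 1) f = f" if "f \<in> cInd_functions a e" for f
    using that by (auto simp: translateG_def fun_eq_iff cInd_functions_def)
  show ?thesis unfolding is_rep_def cInd_eq rep.select_convs
    using group_K vsf sub tr mult one by (auto simp: translateG_def fun_eq_iff)
qed

end

section \<open>Assembling the cells into the direct sums\<close>

lemma pieces_zero_fun: "0 \<in> pieces d"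
  using pieces_zero by (simp add: zero_fun_def)

lemma to_S_zero: "to_S d 0 = 0"
  using to_S_scale[OF pieces_zero_fun, of d 0] by (simp add: zero_fun_def)

lemma S_sum_rep: "is_rep (rep_direct_sum (Kgrp E) I (S_rep E \<psi>' \<theta>))" if "\<And>d. d \<in> I \<Longrightarrow> 0 < d"
proof (rule is_rep_direct_sum[OF group_K])
  have "vector_space ((*) :: complex \<Rightarrow> complex \<Rightarrow> complex)" by unfold_locales (auto simp: algebra_simps)
  thus "vector_space (scal (S_rep E \<psi>' \<theta> d))" for d
    using vector_space_fun by (simp add: S_rep_def Ind_def char_rep_def)
  show "is_rep (S_rep E \<psi>' \<theta> d) \<and> grp (S_rep E \<psi>' \<theta> d) = Kgrp E" if "d \<in> I" for d
    using S_rep_irreducible S_rep_eq \<open>d \<in> I\<close> \<open>\<And>d. d \<in> I \<Longrightarrow> 0 < d\<close> by (simp add: irreducible_rep_def)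
qed

definition S_part :: "nat set \<Rightarrow> (nat \<Rightarrow> 'e mat2 \<Rightarrow> 'w) \<Rightarrow> nat \<Rightarrow> 'e mat2 \<Rightarrow> complex" where
  "S_part I \<phi> d = (if d \<in> I then to_S d (\<phi> d) else 0)"

lemma S_part_bij:
  assumes I: "\<And>d. d \<in> I \<Longrightarrow> 0 < d"
  shows "bij_betw (S_part I) {\<phi>. finite {d. \<phi> d \<noteq> 0} \<and> (\<forall>d\<in>I. \<phi> d \<in> pieces d) \<and> (\<forall>d. d \<notin> I \<longrightarrow> \<phi> d = 0)}
    (vs (rep_direct_sum (Kgrp E) I (S_rep E \<psi>' \<theta>)))"
  using bij_betw_finite_support[of I to_S pieces "\<lambda>d. vs (S_rep E \<psi>' \<theta> d)"] to_S_bij I to_S_zero pieces_zero_fun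
  by (simp add: S_part_def[abs_def] rep_direct_sum_def)

lemma cells_add: "cells a e (f + g) d = (\<lambda>x. cells a e f d x + cells a e g d x)"
  by (auto simp: cells_def)

lemma cells_scale: "cells a e (\<lambda>x. sc c (f x)) d = (\<lambda>x. sc c (cells a e f d x))"
  by (auto simp: cells_def)

lemma S_part_add:
  assumes "admissible a e" "I \<subseteq> {d. d mod 2 = e}" "f \<in> cInd_functions a e" "g \<in> cInd_functions a e"
  shows "S_part I (cells a e (f + g)) = S_part I (cells a e f) + S_part I (cells a e g)"
proof -
  have "cells a e f d \<in> pieces d" "cells a e g d \<in> pieces d" if "d \<in> I" for d
    using cells_families[OF assms(1)] assms(2-4) that by (auto simp: cell_families_def)
  thus ?thesis by (auto simp: S_part_def fun_eq_iff cells_add to_S_add)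
qed

lemma S_part_scale:
  assumes "admissible a e" "I \<subseteq> {d. d mod 2 = e}" "f \<in> cInd_functions a e"
  shows "S_part I (cells a e (\<lambda>x. sc c (f x))) = (\<lambda>d x. c * S_part I (cells a e f) d x)"
proof -
  have "cells a e f d \<in> pieces d" if "d \<in> I" for d
    using cells_families[OF assms(1)] assms(2,3) that by (auto simp: cell_families_def)
  thus ?thesis by (auto simp: S_part_def fun_eq_iff cells_scale to_S_scale)
qed

lemma S_part_translate:
  assumes "admissible a e" "k \<in> maxcpt E"
  shows "S_part I (cells a e (translateG k f)) =
    (\<lambda>d. if d \<in> I then act (S_rep E \<psi>' \<theta> d) k (S_part I (cells a e f) d) else 0)"
  using assms(2) by (auto simp: S_part_def fun_eq_iff cells_translate[OF assms(1)] to_S_translate S_rep_def Ind_def)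

lemma sum_simps:
  "grp (rep_direct_sum (Kgrp E) I (S_rep E \<psi>' \<theta>)) = Kgrp E"
  "scal (rep_direct_sum (Kgrp E) I (S_rep E \<psi>' \<theta>)) c \<phi> = (\<lambda>d x. c * \<phi> d x)"
  "act (rep_direct_sum (Kgrp E) I (S_rep E \<psi>' \<theta>)) k \<phi> =
    (\<lambda>d. if d \<in> I then act (S_rep E \<psi>' \<theta> d) k (\<phi> d) else 0)"
  by (simp_all add: rep_direct_sum_def S_rep_def Ind_def char_rep_def)

text \<open>The multiplier attached to \<open>eta E\<close> selects the odd cells. Each has d > 0,
  so each contributes some \<open>S_rep\<close>.\<close>

lemma odd_restriction:
  "Res (Kgrp E) (cInd (mat_top E) (Ggrp E) (conj_rep (eta E) \<sigma>\<^sub>K)) \<cong>\<^sub>r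
    rep_direct_sum (Kgrp E) {d. odd d} (S_rep E \<psi>' \<theta>)"
proof -
  let ?I = "{d::nat. odd d}"
  let ?T = "\<lambda>f. S_part ?I (cells (eta E) 1 f)"
  have I: "\<And>d. d \<in> ?I \<Longrightarrow> 0 < d" by (auto intro: Nat.gr0I)
  have e: "{d::nat. d mod 2 = 1} = ?I" by (auto simp: odd_iff_mod_2_eq_one)
  hence I': "?I \<subseteq> {d. d mod 2 = 1}" by simp
  note a = admissible_eta
  have bij: "bij_betw ?T (cInd_functions (eta E) 1) (vs (rep_direct_sum (Kgrp E) ?I (S_rep E \<psi>' \<theta>)))"
    using bij_betw_trans[OF cells_bij[OF a, unfolded cell_families_def e] S_part_bij[OF I]] by (simp only: comp_def)
  show ?thesis
    unfolding rep_iso_def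
  proof (intro conjI exI[of _ ?T] ballI allI)
    show "is_rep (Res (Kgrp E) (cInd (mat_top E) (Ggrp E) (conj_rep (eta E) \<sigma>\<^sub>K)))" by (rule cInd_rep[OF a])
    show "is_rep (rep_direct_sum (Kgrp E) ?I (S_rep E \<psi>' \<theta>))" by (rule S_sum_rep[OF I])
  qed (simp_all only: cInd_eq[OF a] rep.select_convs sum_simps bij S_part_add[OF a I'] S_part_scale[OF a I']
      S_part_translate[OF a] matgrp_simps)
qed

text \<open>For d = 0 the group \<open>Hgrp 0\<close> is all of K and conjugation is trivial, so a
  function is determined by its value at the identity: this cell gives the representation
  itself.\<close>

lemma piece_zero_bij: "bij_betw (\<lambda>F. F (mat 1)) (pieces 0) V"
proof (rule bij_betw_byWitness[where f' = "\<lambda>v x. if x \<in> maxcpt E then \<rho> x v else 0"])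
  have H: "Hgrp 0 = maxcpt E" by (auto simp: Hgrp_def maxcpt_iff integral_def)
  have c: "beta_conj 0 h = h" for h by (simp add: beta_conj_def mat2_eq_iff)
  have F: "F x = \<rho> x (F (mat 1))" if "F \<in> pieces 0" "x \<in> maxcpt E" for F x
  proof -
    have "F (x ** mat 1) = \<rho> (beta_conj 0 x) (F (mat 1))"
      using that maxcpt_one unfolding pieces_def H by blast
    thus ?thesis by (simp add: c)
  qed
  show "\<forall>F\<in>pieces 0. (\<lambda>x. if x \<in> maxcpt E then \<rho> x (F (mat 1)) else 0) = F"
    using F by (auto simp: fun_eq_iff pieces_def)
  show "\<forall>v\<in>V. (if mat 1 \<in> maxcpt E then \<rho> (mat 1) v else 0) = v" by (simp add: \<rho>_one)
  show "(\<lambda>F. F (mat 1)) ` pieces 0 \<subseteq> V" using pieces_V by blast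
  show "(\<lambda>v x. if x \<in> maxcpt E then \<rho> x v else 0) ` V \<subseteq> pieces 0"
    by (auto simp: pieces_def H c \<rho>_in \<rho>_mult maxcpt_mult)
qed

lemma even_restriction:
  "Res (Kgrp E) (cInd (mat_top E) (Ggrp E) \<sigma>\<^sub>K) \<cong>\<^sub>r
    \<sigma>\<^sub>K \<oplus>\<^sub>r rep_direct_sum (Kgrp E) {d. 0 < d \<and> even d} (S_rep E \<psi>' \<theta>)"
proof -
  let ?I = "{d::nat. 0 < d \<and> even d}"
  let ?D = "\<lambda>I. {\<phi> :: nat \<Rightarrow> 'e mat2 \<Rightarrow> 'w. finite {d. \<phi> d \<noteq> 0} \<and> (\<forall>d\<in>I. \<phi> d \<in> pieces d) \<and> (\<forall>d. d \<notin> I \<longrightarrow> \<phi> d = 0)}"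
  let ?S = "\<lambda>\<phi> :: nat \<Rightarrow> 'e mat2 \<Rightarrow> 'w. (\<phi> 0, \<phi>(0 := 0))"
  let ?T = "\<lambda>f. (f (mat 1), S_part ?I (cells (mat 1) 0 f))"
  have I: "\<And>d. d \<in> ?I \<Longrightarrow> 0 < d" by simp
  have e: "{d::nat. d mod 2 = 0} = insert 0 ?I" by (auto simp: even_iff_mod_2_eq_zero)
  hence I': "?I \<subseteq> {d. d mod 2 = 0}" by blast
  note a = admissible_one
  \<comment> \<open>Conjugation by the identity changes nothing, so the results for a general
    \<open>a\<close> apply.\<close>
  have conj: "conj_rep (mat 1) \<sigma>\<^sub>K = \<sigma>\<^sub>K"
    using matrix_inv_a[OF a] by (simp add: conj_rep_def \<sigma>\<^sub>K_def ainv_def[OF a] matgrp_def)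
  have b0: "beta 0 = mat 1" by (simp add: beta_def mat_mat22)
  \<comment> \<open>The cell d = 0 is split off, since it is not of the form
    \<open>S_rep\<close>.\<close>
  have "bij_betw ?S (?D (insert 0 ?I)) (pieces 0 \<times> ?D ?I)"
  proof (rule bij_betw_byWitness[where f' = "\<lambda>(F, \<phi>). \<phi>(0 := F)"])
    show "?S ` ?D (insert 0 ?I) \<subseteq> pieces 0 \<times> ?D ?I"
    proof (rule image_subsetI)
      fix \<phi> assume \<phi>: "\<phi> \<in> ?D (insert 0 ?I)"
      have "finite {d. (\<phi>(0 := 0)) d \<noteq> 0}" by (rule finite_subset[of _ "{d. \<phi> d \<noteq> 0}"]) (use \<phi> in auto)
      thus "?S \<phi> \<in> pieces 0 \<times> ?D ?I" using \<phi> by auto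
    qed
    show "(\<lambda>(F, \<phi>). \<phi>(0 := F)) ` (pieces 0 \<times> ?D ?I) \<subseteq> ?D (insert 0 ?I)"
    proof (rule image_subsetI)
      fix p assume p: "p \<in> pieces 0 \<times> ?D ?I"
      obtain F \<phi> where p': "p = (F, \<phi>)" by (cases p)
      have \<phi>: "F \<in> pieces 0" "\<phi> \<in> ?D ?I" using p p' by auto
      have "finite {d. (\<phi>(0 := F)) d \<noteq> 0}" by (rule finite_subset[of _ "insert 0 {d. \<phi> d \<noteq> 0}"]) (use \<phi> in auto)
      thus "(\<lambda>(F, \<phi>). \<phi>(0 := F)) p \<in> ?D (insert 0 ?I)" using \<phi> by (auto simp: p')
    qed
  qed auto
  moreover have "bij_betw (map_prod (\<lambda>F. F (mat 1)) (S_part ?I)) (pieces 0 \<times> ?D ?I)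
      (V \<times> vs (rep_direct_sum (Kgrp E) ?I (S_rep E \<psi>' \<theta>)))"
    using piece_zero_bij S_part_bij[OF I] by (rule bij_betw_map_prod)
  ultimately have "bij_betw (map_prod (\<lambda>F. F (mat 1)) (S_part ?I) \<circ> ?S) (?D (insert 0 ?I))
      (V \<times> vs (rep_direct_sum (Kgrp E) ?I (S_rep E \<psi>' \<theta>)))" by (rule bij_betw_trans)
  from bij_betw_trans[OF cells_bij[OF a, unfolded cell_families_def e] this]
  have "bij_betw (map_prod (\<lambda>F. F (mat 1)) (S_part ?I) \<circ> ?S \<circ> cells (mat 1) 0) (cInd_functions (mat 1) 0)
      (V \<times> vs (rep_direct_sum (Kgrp E) ?I (S_rep E \<psi>' \<theta>)))" .
  moreover have "map_prod (\<lambda>F. F (mat 1)) (S_part ?I) \<circ> ?S \<circ> cells (mat 1) 0 = ?T"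
    by (auto simp: fun_eq_iff S_part_def) (simp add: cells_def b0)
  ultimately have bij: "bij_betw ?T (cInd_functions (mat 1) 0) (V \<times> vs (rep_direct_sum (Kgrp E) ?I (S_rep E \<psi>' \<theta>)))" by simp
  have rS: "is_rep (rep_direct_sum (Kgrp E) ?I (S_rep E \<psi>' \<theta>))" by (rule S_sum_rep[OF I])
  have r: "is_rep (\<sigma>\<^sub>K \<oplus>\<^sub>r rep_direct_sum (Kgrp E) ?I (S_rep E \<psi>' \<theta>))"
    using \<sigma>\<^sub>K_irreducible rS by (intro is_rep_sum) (simp_all add: irreducible_rep_def \<sigma>\<^sub>K_def rep_direct_sum_def)
  have t1: "translateG k f (mat 1) = \<rho> k (f (mat 1))" if "k \<in> maxcpt E" "f \<in> cInd_functions (mat 1) 0" for k f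
  proof -
    have "mat 1 \<in> simil 0" by (simp add: simil_def)
    from cInd_functions_equivariant[OF a that(2,1) this] show ?thesis by (simp add: translateG_def)
  qed
  have "Res (Kgrp E) (cInd (mat_top E) (Ggrp E) (conj_rep (mat 1) \<sigma>\<^sub>K)) \<cong>\<^sub>r
    \<sigma>\<^sub>K \<oplus>\<^sub>r rep_direct_sum (Kgrp E) ?I (S_rep E \<psi>' \<theta>)"
    unfolding rep_iso_def
  proof (intro conjI exI[of _ ?T] ballI allI)
    show "is_rep (Res (Kgrp E) (cInd (mat_top E) (Ggrp E) (conj_rep (mat 1) \<sigma>\<^sub>K)))" by (rule cInd_rep[OF a])
    show "is_rep (\<sigma>\<^sub>K \<oplus>\<^sub>r rep_direct_sum (Kgrp E) ?I (S_rep E \<psi>' \<theta>))" by (rule r)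
  qed (simp_all only: cInd_eq[OF a] rep.select_convs rep_sum_def \<sigma>\<^sub>K_simps sum_simps bij S_part_add[OF a I']
      S_part_scale[OF a I'] S_part_translate[OF a] matgrp_simps t1 plus_fun_apply plus_prod_def fst_conv snd_conv prod.case)
  thus ?thesis unfolding conj .
qed

end

theorem corollary4p12:
  fixes E :: "('f::field, 'e::field) quad_ext"
    and \<psi>' :: "'f \<Rightarrow> complex"
    and \<sigma> :: "('e mat2 set, 'w::ab_group_add) rep"
    and \<theta> :: "'e \<Rightarrow> complex"
  assumes "unramified_quad_ext E"
    and "level_one_character E \<psi>'"
    and "cuspidal E \<sigma>"
    and "has_central_character E (inflated E \<sigma>) \<theta>"
  shows "irreducible_rep (inflated E \<sigma>)
    \<and> (\<forall>d>0. irreducible_rep (S_rep E \<psi>' \<theta> d))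
    \<and> Res (Kgrp E) (cInd (mat_top E) (Ggrp E) (inflated E \<sigma>))
        \<cong>\<^sub>r inflated E \<sigma> \<oplus>\<^sub>r rep_direct_sum (Kgrp E) {d. 0 < d \<and> even d} (S_rep E \<psi>' \<theta>)
    \<and> Res (Kgrp E) (cInd (mat_top E) (Ggrp E) (conj_rep (eta E) (inflated E \<sigma>)))
        \<cong>\<^sub>r rep_direct_sum (Kgrp E) {d. odd d} (S_rep E \<psi>' \<theta>)"
proof -
  interpret unramified_quad_ext E by (rule assms)
  define N where "N = congruence_subgroup 1"
  interpret N: normal N "Kgrp E" unfolding N_def by (rule congruence_subgroup_normal)
  let ?Q = "Kgrp E Mod N"
  define \<rho> where "\<rho> k = act \<sigma> (N #>\<^bsub>Kgrp E\<^esub> k)" for k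
  have irr: "irreducible_rep \<sigma>" and grp: "grp \<sigma> = ?Q"
    and cusp: "\<And>g x. g \<in> carrier ?Q \<Longrightarrow> x \<in> vs \<sigma> \<Longrightarrow>
      (\<And>u. u \<in> unip E \<Longrightarrow> act \<sigma> (g \<otimes>\<^bsub>?Q\<^esub> (N #>\<^bsub>Kgrp E\<^esub> u) \<otimes>\<^bsub>?Q\<^esub> inv\<^bsub>?Q\<^esub> g) x = x) \<Longrightarrow> x = 0"
    using assms(3) by (auto simp: cuspidal_def Let_def maxcpt_plus_eq N_def)
  have rep: "is_rep \<sigma>" using irr by (simp add: irreducible_rep_def)
  have inQ: "N #>\<^bsub>Kgrp E\<^esub> k \<in> carrier ?Q" if "k \<in> maxcpt E" for k
    using N.rcosetsI[OF N.subset, of k] that by (simp add: FactGroup_def)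
  have multQ: "(N #>\<^bsub>Kgrp E\<^esub> k) \<otimes>\<^bsub>?Q\<^esub> (N #>\<^bsub>Kgrp E\<^esub> h) = N #>\<^bsub>Kgrp E\<^esub> (k ** h)"
    if "k \<in> maxcpt E" "h \<in> maxcpt E" for k h
    using N.rcos_sum[of k h] that by (simp add: FactGroup_def)
  have oneQ: "N #>\<^bsub>Kgrp E\<^esub> (mat 1) = \<one>\<^bsub>?Q\<^esub>"
    using N.coset_mult_one[OF N.subset] by (simp add: FactGroup_def)
  have infl: "inflated E \<sigma> = \<lparr>grp = Kgrp E, scal = scal \<sigma>, vs = vs \<sigma>, act = \<rho>\<rparr>"
    by (simp add: inflated_def inflate_def maxcpt_plus_eq N_def \<rho>_def[abs_def])
  interpret vs: vector_space "scal \<sigma>" using rep by (simp add: is_rep_def)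
  have actQ: "act \<sigma> g x \<in> vs \<sigma>" "y \<in> vs \<sigma> \<Longrightarrow> act \<sigma> g (x + y) = act \<sigma> g x + act \<sigma> g y"
    "act \<sigma> g (scal \<sigma> c x) = scal \<sigma> c (act \<sigma> g x)" "act \<sigma> \<one>\<^bsub>?Q\<^esub> x = x"
    "h \<in> carrier ?Q \<Longrightarrow> act \<sigma> (g \<otimes>\<^bsub>?Q\<^esub> h) x = act \<sigma> g (act \<sigma> h x)"
    if "g \<in> carrier ?Q" "x \<in> vs \<sigma>" for g h x y c
    using rep that unfolding is_rep_def grp by blast+
  interpret cuspidal_data E "scal \<sigma>" "vs \<sigma>" \<rho> \<psi>' \<theta>
  proof
    show "level_one_character E \<psi>'" by (rule assms)
    show "vs.subspace (vs \<sigma>)" using rep by (simp add: is_rep_def)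
    show "vs \<sigma> \<noteq> {0}" using irr by (simp add: irreducible_rep_def)
    show "\<rho> k x \<in> vs \<sigma>" if "k \<in> maxcpt E" "x \<in> vs \<sigma>" for k x
      using actQ(1)[OF inQ[OF that(1)] that(2)] by (simp add: \<rho>_def)
    show "\<rho> k (x + y) = \<rho> k x + \<rho> k y" if "k \<in> maxcpt E" "x \<in> vs \<sigma>" "y \<in> vs \<sigma>" for k x y
      using actQ(2)[OF inQ[OF that(1)] that(2,3)] by (simp add: \<rho>_def)
    show "\<rho> k (scal \<sigma> c x) = scal \<sigma> c (\<rho> k x)" if "k \<in> maxcpt E" "x \<in> vs \<sigma>" for k c x
      using actQ(3)[OF inQ[OF that(1)] that(2)] by (simp add: \<rho>_def)
    show "\<rho> (mat 1) x = x" if "x \<in> vs \<sigma>" for x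
      using actQ(4)[OF inQ[OF maxcpt_one] that] by (simp add: \<rho>_def oneQ)
    show "\<rho> (k ** h) x = \<rho> k (\<rho> h x)" if "k \<in> maxcpt E" "h \<in> maxcpt E" "x \<in> vs \<sigma>" for k h x
      using actQ(5)[OF inQ[OF that(1)] that(3) inQ[OF that(2)]] unfolding \<rho>_def multQ[OF that(1,2)] .
    show "\<rho> k x = x" if "k \<in> congruence_subgroup 1" "x \<in> vs \<sigma>" for k x
    proof -
      have "N #>\<^bsub>Kgrp E\<^esub> k = N" using N.rcos_const[OF N.is_group] that(1) unfolding N_def by blast
      thus ?thesis using actQ(4)[OF inQ[OF maxcpt_one] that(2)] by (simp add: \<rho>_def)
    qed
    show "U = {0} \<or> U = vs \<sigma>"
      if "vs.subspace U" "U \<subseteq> vs \<sigma>" "\<And>k x. k \<in> maxcpt E \<Longrightarrow> x \<in> U \<Longrightarrow> \<rho> k x \<in> U" for U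
    proof -
      have "act \<sigma> g x \<in> U" if "g \<in> carrier ?Q" "x \<in> U" for g x
        using that \<open>\<And>k x. k \<in> maxcpt E \<Longrightarrow> x \<in> U \<Longrightarrow> \<rho> k x \<in> U\<close> by (auto simp: FactGroup_def RCOSETS_def \<rho>_def)
      thus ?thesis using irr that(1,2) unfolding irreducible_rep_def grp by blast
    qed
    show "x = 0" if x: "x \<in> vs \<sigma>" and fixed: "\<And>s. s \<in> PF 0 \<Longrightarrow> \<rho> (mat22 1 0 (\<delta> * \<iota> s) 1) x = x" for x
    proof -
      \<comment> \<open>The Weyl element exchanges the upper and lower unipotent matrices;
        cuspidality for the conjugate by w is the condition on lower ones.\<close>
      define w where "w = (mat22 0 1 1 0 :: 'e mat2)"
      have w: "w \<in> maxcpt E" by (simp add: w_def maxcpt_iff U11_iff integral_def mat_mat22)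
      show ?thesis
      proof (rule cusp[OF inQ[OF w] x])
        fix u assume "u \<in> unip E"
        then obtain s where s: "s \<in> PF 0" "u = mat22 1 (\<delta> * \<iota> s) 0 1" by (auto simp: unip_def)
        have u: "u \<in> maxcpt E" using s by (simp add: maxcpt_iff U11_iff integral_def mat_mat22)
        have "inv\<^bsub>?Q\<^esub> (N #>\<^bsub>Kgrp E\<^esub> w) = N #>\<^bsub>Kgrp E\<^esub> w"
        proof (rule group.inv_equality[OF N.factorgroup_is_group])
          have "w ** w = mat 1" by (simp add: w_def mat_mat22)
          thus "(N #>\<^bsub>Kgrp E\<^esub> w) \<otimes>\<^bsub>?Q\<^esub> (N #>\<^bsub>Kgrp E\<^esub> w) = \<one>\<^bsub>?Q\<^esub>"
            unfolding multQ[OF w w] by (simp only: oneQ)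
        qed (use inQ w in auto)
        moreover have "w ** u ** w = mat22 1 0 (\<delta> * \<iota> s) 1" by (simp add: w_def s)
        ultimately show "act \<sigma> ((N #>\<^bsub>Kgrp E\<^esub> w) \<otimes>\<^bsub>?Q\<^esub> (N #>\<^bsub>Kgrp E\<^esub> u) \<otimes>\<^bsub>?Q\<^esub> inv\<^bsub>?Q\<^esub> (N #>\<^bsub>Kgrp E\<^esub> w)) x = x"
          using fixed[OF s(1)] by (simp only: \<rho>_def multQ[OF w u] multQ[OF maxcpt_mult[OF w u] w])
      qed
    qed
    show "\<rho> (mat z) x = scal \<sigma> (\<theta> z) x" if "z \<in> norm_one E" "x \<in> vs \<sigma>" for z x
      using assms(4) that unfolding has_central_character_def infl by simp
  qed
  have s: "inflated E \<sigma> = \<sigma>\<^sub>K" by (simp add: infl \<sigma>\<^sub>K_def)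
  show ?thesis
    unfolding s using \<sigma>\<^sub>K_irreducible S_rep_irreducible even_restriction odd_restriction by blast
qed

end
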